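(* Let $U$ be a bounded open subset of $\mathbb{R}^d$ with $d \geq 3$. Let $\hat{A}=(\hat{a}_{ij})$ be a matrix of measurable functions with $\langle \hat A(x) \xi, \xi \rangle \geq \lambda \| \xi \|^2$ and $\max_{i,j} |\hat a_{ij}(x)| \leq M$ for a.e. $x$ and all $\xi\in\mathbb R^d$ (constants $\lambda,M>0$). Let $\hat{\mathbf{B}} \in L^2(U,\mathbb{R}^d)$ satisfy $\int_{U} \langle \hat{\mathbf{B}}, \nabla \varphi \rangle\,dx \geq 0$ for all $\varphi \in C_0^{\infty}(U)$ with $\varphi \geq 0$. Let $\hat{c} \in L^{1}(U)$ with $\hat{c} \ge 0$. Then: (i) If $\hat{v} \in H^{1,2}_0(U)$ with $\hat c\hat v\in L^1(U)$ satisfies $\int_{U} \langle \hat{A} \nabla \hat{v}, \nabla \varphi \rangle \,dx + \int_{U} \langle \hat{\mathbf{B}}, \nabla \hat{v} \rangle \varphi\,dx + \int_{U} \hat{c} \hat{v} \varphi\,dx = 0$ for all $\varphi \in C_0^{\infty}(U)$, then $\hat{v}=0$ a.e. in $U$. (ii) If $\hat{f} \in L^{\frac{\hat{p}d}{d+\hat{p}}}(U)$ for some $\hat{p} \in (d, \infty)$, then there exists a unique $\hat u\in H^{1,2}_0(U)$ (with $\hat c\hat u\in L^1(U)$) satisfying $\int_{U} \langle \hat{A} \nabla \hat{u}, \nabla \varphi \rangle \,dx + \int_{U} \langle \hat{\mathbf{B}}, \nabla \hat{u} \rangle \varphi\,dx + \int_{U} \hat{c} \hat{u} \varphi\,dx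 = \int_U \hat f\varphi\,dx$ for all $\varphi \in C_0^{\infty}(U)$, and it satisfies $\hat u\in L^\infty(U)$, $\| \nabla \hat{u} \|_{L^2(U)} \le \hat{C}_1 \|\hat{f}\|_{L^{\frac{2d}{d+2}}(U)}$ and $\|\hat{u}\|_{L^{\infty}(U)} \leq \hat{C}_2 \| \hat{f} \|_{L^{\frac{\hat{p}d}{d+\hat{p}}}(U)}$, where $\hat C_1>0$ depends only on $d,\lambda$ and $\hat{C}_2>0$ depends only on $\lambda$, $d$, $\hat{p}$ and $|U|$.
   Context: $H^{1,2}_0(U)$ is the closure of $C_0^\infty(U)$ in $W^{1,2}(U)$; $|U|$ is the Lebesgue measure of $U$. *)

theory Defs
  imports "HOL-Analysis.Analysis"
begin

definition pderiv :: "'n::finite \<Rightarrow> (real^'n \<Rightarrow> real) \<Rightarrow> real^'n \<Rightarrow> real" where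
  "pderiv i f x = frechet_derivative f (at x) (axis i 1)"

definition grad :: "(real^'n::finite \<Rightarrow> real) \<Rightarrow> real^'n \<Rightarrow> real^'n" where
  "grad f x = (\<chi> i. pderiv i f x)"

fun Ck :: "nat \<Rightarrow> (real^'n::finite \<Rightarrow> real) \<Rightarrow> bool" where
  "Ck 0 f \<longleftrightarrow> continuous_on UNIV f"
| "Ck (Suc k) f \<longleftrightarrow> f differentiable_on UNIV \<and> (\<forall>i. Ck k (pderiv i f))"

definition smooth :: "(real^'n::finite \<Rightarrow> real) \<Rightarrow> bool" where
  "smooth f \<longleftrightarrow> (\<forall>k. Ck k f)"

definition test_fun :: "(real^'n::finite) set \<Rightarrow> (real^'n \<Rightarrow> real) \<Rightarrow> bool" where
  "test_fun U \<phi> \<longleftrightarrow> smooth \<phi> \<and> compact (closure {x. \<phi> x \<noteq> 0}) \<and> closure {x. \<phi> x \<noteq> 0} \<subseteq> U"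

definition Lp :: "(real^'n::finite) set \<Rightarrow> real \<Rightarrow> (real^'n \<Rightarrow> real) \<Rightarrow> bool" where
  "Lp U p f \<longleftrightarrow> f \<in> borel_measurable (lebesgue_on U) \<and>
      integrable (lebesgue_on U) (\<lambda>x. \<bar>f x\<bar> powr p)"

definition Lp_norm :: "(real^'n::finite) set \<Rightarrow> real \<Rightarrow> (real^'n \<Rightarrow> real) \<Rightarrow> real" where
  "Lp_norm U p f = (integral\<^sup>L (lebesgue_on U) (\<lambda>x. \<bar>f x\<bar> powr p)) powr (1 / p)"

definition Linf :: "(real^'n::finite) set \<Rightarrow> (real^'n \<Rightarrow> real) \<Rightarrow> bool" where
  "Linf U f \<longleftrightarrow> f \<in> borel_measurable (lebesgue_on U) \<and>
      (\<exists>C. AE x in lebesgue_on U. \<bar>f x\<bar> \<le> C)"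

definition Linf_norm :: "(real^'n::finite) set \<Rightarrow> (real^'n \<Rightarrow> real) \<Rightarrow> real" where
  "Linf_norm U f = Inf {C. 0 \<le> C \<and> (AE x in lebesgue_on U. \<bar>f x\<bar> \<le> C)}"

definition L2vec :: "(real^'n::finite) set \<Rightarrow> (real^'n \<Rightarrow> real^'n) \<Rightarrow> bool" where
  "L2vec U G \<longleftrightarrow> G \<in> borel_measurable (lebesgue_on U) \<and>
      integrable (lebesgue_on U) (\<lambda>x. (norm (G x))\<^sup>2)"

definition L2vec_norm :: "(real^'n::finite) set \<Rightarrow> (real^'n \<Rightarrow> real^'n) \<Rightarrow> real" where
  "L2vec_norm U G = sqrt (integral\<^sup>L (lebesgue_on U) (\<lambda>x. (norm (G x))\<^sup>2))"

definition weak_grad :: "(real^'n::finite) set \<Rightarrow> (real^'n \<Rightarrow> real) \<Rightarrow> (real^'n \<Rightarrow> real^'n) \<Rightarrow> bool" where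
  "weak_grad U v G \<longleftrightarrow> (\<forall>\<phi> i. test_fun U \<phi> \<longrightarrow>
      integral\<^sup>L (lebesgue_on U) (\<lambda>x. v x * pderiv i \<phi> x) =
      - integral\<^sup>L (lebesgue_on U) (\<lambda>x. G x $ i * \<phi> x))"

definition W12 :: "(real^'n::finite) set \<Rightarrow> (real^'n \<Rightarrow> real) \<Rightarrow> (real^'n \<Rightarrow> real^'n) \<Rightarrow> bool" where
  "W12 U v G \<longleftrightarrow> Lp U 2 v \<and> L2vec U G \<and> weak_grad U v G"

definition W12_dist :: "(real^'n::finite) set \<Rightarrow> (real^'n \<Rightarrow> real) \<Rightarrow> (real^'n \<Rightarrow> real) \<Rightarrow> (real^'n \<Rightarrow> real^'n) \<Rightarrow> real" where
  "W12_dist U \<phi> v G = sqrt (integral\<^sup>L (lebesgue_on U) (\<lambda>x. (\<phi> x - v x)\<^sup>2)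
      + integral\<^sup>L (lebesgue_on U) (\<lambda>x. (norm (grad \<phi> x - G x))\<^sup>2))"

definition H012 :: "(real^'n::finite) set \<Rightarrow> (real^'n \<Rightarrow> real) \<Rightarrow> (real^'n \<Rightarrow> real^'n) \<Rightarrow> bool" where
  "H012 U v G \<longleftrightarrow> W12 U v G \<and>
     (\<exists>\<phi>s. (\<forall>k. test_fun U (\<phi>s k)) \<and> (\<lambda>k. W12_dist U (\<phi>s k) v G) \<longlonglongrightarrow> 0)"

definition coeff_assms :: "(real^'n::finite) set \<Rightarrow> real \<Rightarrow> real \<Rightarrow> (real^'n \<Rightarrow> real^'n^'n)
    \<Rightarrow> (real^'n \<Rightarrow> real^'n) \<Rightarrow> (real^'n \<Rightarrow> real) \<Rightarrow> bool" where
  "coeff_assms U lam M A B c \<longleftrightarrow>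
     open U \<and> bounded U \<and> lam > 0 \<and> M > 0 \<and>
     (\<forall>i j. (\<lambda>x. A x $ i $ j) \<in> borel_measurable (lebesgue_on U)) \<and>
     (AE x in lebesgue_on U. \<forall>\<xi>. (A x *v \<xi>) \<bullet> \<xi> \<ge> lam * (norm \<xi>)\<^sup>2) \<and>
     (AE x in lebesgue_on U. \<forall>i j. \<bar>A x $ i $ j\<bar> \<le> M) \<and>
     L2vec U B \<and>
     (\<forall>\<phi>. test_fun U \<phi> \<and> (\<forall>x. \<phi> x \<ge> 0) \<longrightarrow>
         integral\<^sup>L (lebesgue_on U) (\<lambda>x. B x \<bullet> grad \<phi> x) \<ge> 0) \<and>
     integrable (lebesgue_on U) c \<and> (AE x in lebesgue_on U. c x \<ge> 0)"

text \<open>u in H^{1,2}_0(U) with weak gradient G, c u in L^1(U), is a weak solution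
  of  -div(A grad u) + <B, grad u> + c u = f.\<close>
definition weak_sol :: "(real^'n::finite) set \<Rightarrow> (real^'n \<Rightarrow> real^'n^'n) \<Rightarrow> (real^'n \<Rightarrow> real^'n)
    \<Rightarrow> (real^'n \<Rightarrow> real) \<Rightarrow> (real^'n \<Rightarrow> real) \<Rightarrow> (real^'n \<Rightarrow> real) \<Rightarrow> (real^'n \<Rightarrow> real^'n) \<Rightarrow> bool" where
  "weak_sol U A B c f u G \<longleftrightarrow> H012 U u G \<and> integrable (lebesgue_on U) (\<lambda>x. c x * u x) \<and>
     (\<forall>\<phi>. test_fun U \<phi> \<longrightarrow>
        integral\<^sup>L (lebesgue_on U) (\<lambda>x. (A x *v G x) \<bullet> grad \<phi> x)
      + integral\<^sup>L (lebesgue_on U) (\<lambda>x. (B x \<bullet> G x) * \<phi> x)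
      + integral\<^sup>L (lebesgue_on U) (\<lambda>x. c x * u x * \<phi> x)
      = integral\<^sup>L (lebesgue_on U) (\<lambda>x. f x * \<phi> x))"

end

theory Submission
  imports Defs
begin

text \<open>
  Existence uses J.-L. Lions' variant of the Lax-Milgram theorem. With respect to the norm
  \<open>\<integral> |\<nabla>\<phi>|\<^sup>2 + \<integral> c \<phi>\<^sup>2\<close> on test functions, the bilinear form \<open>a(u, \<phi>)\<close> of the equation is bounded in \<open>u\<close>
  for each fixed test function \<open>\<phi>\<close> although \<open>B\<close> is only in \<open>L\<^sup>2\<close>, and it is coercive because
  \<open>2 \<integral> \<langle>B, \<nabla>\<phi>\<rangle> \<phi> = \<integral> \<langle>B, \<nabla>\<phi>\<^sup>2\<rangle> \<ge> 0\<close>. The gradient bound is the resulting a priori bound, since the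
  Sobolev inequality controls \<open>\<integral> f \<phi>\<close>.

  Uniqueness and the supremum bound come from testing the equation with \<open>F(u)\<close> for smooth bounded
  nondecreasing \<open>F\<close> that vanish on \<open>(-\<infinity>, k]\<close>, \<open>k \<ge> 0\<close>: the drift term is \<open>\<integral> \<langle>B, \<nabla>\<Psi>(u)\<rangle> \<ge> 0\<close> with
  \<open>\<Psi>' = F\<close>, \<open>\<Psi> \<ge> 0\<close>, so that \<open>\<lambda> \<integral> F'(u) |\<nabla>u|\<^sup>2 \<le> \<integral> f F(u)\<close>. As \<open>F\<close> is smooth, \<open>F(u)\<close> is a limit of the
  test functions \<open>F(\<phi>\<^sub>j)\<close> and no mollification is needed. The weak-type Sobolev inequality turns the
  estimate into a decay inequality for the measures of the superlevel sets, to which Stampacchia's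
  iteration applies.

  The weak-type Sobolev inequality follows by comparing a function with its averages over dilates of a
  ball; Maz'ya's truncation upgrades it to the strong one.
\<close>

section \<open>Calculus of test functions\<close>

text \<open>The drift term \<open>\<integral> \<langle>B, \<nabla>u\<rangle> \<phi>\<close> is in
  general defined only for bounded \<open>\<phi>\<close>. Hence the form is not continuous on
  \<open>H^{1,2}_0\<close>, which rules out the Lax-Milgram theorem, and the solution itself is no
  admissible test function, so that existence brings no uniqueness and the testing argument has to
  use bounded truncations. The abstract existence theorem stays at the level of Cauchy sequences of
  test functions: no Hilbert space is constructed, and the only completion takes place in
  \<open>L^2\<close>, for the triples \<open>(\<phi>, \<nabla>\<phi>, \<surd>c \<phi>)\<close>. The
  third component also makes \<open>c u\<close> integrable, as a product of the \<open>L^2\<close>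
  functions \<open>\<surd>c\<close> and \<open>\<surd>c u\<close>. Both Sobolev constants come from
  the whole space and are therefore independent of \<open>U\<close>; \<open>d \<ge> 3\<close> enters
  through the convergence of \<open>\<integral> s^(-d/2) ds\<close> at infinity. The iteration
  closes because, for \<open>q = pd/(d+p)\<close>, the condition
  \<open>d/(d-2) * (1 - 1/q) > 1\<close> amounts to \<open>p > d\<close>.\<close>

lemma pderiv_eqI:
  assumes "(f has_derivative f') (at x)"
  shows "pderiv i f x = f' (axis i 1)"
  using frechet_derivative_at[OF assms] by (simp add: pderiv_def)

lemma has_derivative_grad:
  fixes f :: "real^'n::finite \<Rightarrow> real"
  assumes "f differentiable (at x)"
  shows "(f has_derivative (\<lambda>h. grad f x \<bullet> h)) (at x)"
proof -
  have d: "(f has_derivative frechet_derivative f (at x)) (at x)"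
    using assms frechet_derivative_works by blast
  then have lin: "linear (frechet_derivative f (at x))"
    using has_derivative_linear by blast
  have "frechet_derivative f (at x) h = grad f x \<bullet> h" for h
  proof -
    have "frechet_derivative f (at x) h = frechet_derivative f (at x) (\<Sum>i\<in>UNIV. (h $ i) *\<^sub>R axis i 1)"
      using basis_expansion[of h] by (simp add: scalar_mult_eq_scaleR)
    also have "\<dots> = (\<Sum>i\<in>UNIV. (h $ i) * pderiv i f x)"
      by (simp add: linear_sum[OF lin] linear_cmul[OF lin] pderiv_def)
    also have "\<dots> = grad f x \<bullet> h"
      by (simp add: inner_vec_def grad_def mult.commute)
    finally show ?thesis .
  qed
  then have "frechet_derivative f (at x) = (\<lambda>h. grad f x \<bullet> h)" by auto
  with d show ?thesis by simp
qed

lemma Ck_SucD: "Ck (Suc k) f \<Longrightarrow> Ck k f"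
proof (induction k arbitrary: f)
  case 0
  then show ?case by (simp add: differentiable_imp_continuous_on)
next
  case (Suc k)
  have "f differentiable_on UNIV" "\<And>i. Ck (Suc k) (pderiv i f)"
    using Suc.prems Ck.simps(2)[of "Suc k" f] by blast+
  then show ?case using Suc.IH Ck.simps(2)[of k f] by blast
qed

lemma differentiable_on_UNIV_has_derivative:
  fixes f :: "real^'n::finite \<Rightarrow> real"
  assumes "f differentiable_on UNIV"
  shows "(f has_derivative (\<lambda>h. grad f x \<bullet> h)) (at x)"
  using assms by (auto simp: differentiable_on_def intro: has_derivative_grad)

lemma grad_axis: "grad f x \<bullet> axis i 1 = pderiv i f x"
  by (simp add: grad_def inner_axis)

lemma pderiv_add:
  assumes "f differentiable_on UNIV" "g differentiable_on UNIV"
  shows "pderiv i (\<lambda>x. f x + g x) = (\<lambda>x. pderiv i f x + pderiv i g x)"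
proof
  fix x
  have "((\<lambda>x. f x + g x) has_derivative (\<lambda>h. grad f x \<bullet> h + grad g x \<bullet> h)) (at x)"
    using assms by (intro has_derivative_add differentiable_on_UNIV_has_derivative)
  from pderiv_eqI[OF this] show "pderiv i (\<lambda>x. f x + g x) x = pderiv i f x + pderiv i g x"
    by (simp add: grad_axis)
qed

lemma pderiv_mult:
  assumes "f differentiable_on UNIV" "g differentiable_on UNIV"
  shows "pderiv i (\<lambda>x. f x * g x) = (\<lambda>x. f x * pderiv i g x + pderiv i f x * g x)"
proof
  fix x
  have "((\<lambda>x. f x * g x) has_derivative (\<lambda>h. f x * (grad g x \<bullet> h) + (grad f x \<bullet> h) * g x)) (at x)"
    using assms by (intro has_derivative_mult differentiable_on_UNIV_has_derivative)
  from pderiv_eqI[OF this] show "pderiv i (\<lambda>x. f x * g x) x = f x * pderiv i g x + pderiv i f x * g x"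
    by (simp add: grad_axis)
qed

lemma has_derivative_compose_real:
  assumes "f differentiable_on UNIV" "(F has_real_derivative F') (at (f x))"
  shows "((\<lambda>x. F (f x)) has_derivative (\<lambda>h. F' * (grad f x \<bullet> h))) (at x)"
  using has_derivative_compose[OF differentiable_on_UNIV_has_derivative[OF assms(1)], of F "\<lambda>h. F' * h" x]
    assms(2) by (simp add: has_field_derivative_def)

lemma pderiv_compose:
  assumes "f differentiable_on UNIV" "\<And>s. (F has_real_derivative F' s) (at s)"
  shows "pderiv i (\<lambda>x. F (f x)) = (\<lambda>x. F' (f x) * pderiv i f x)"
proof
  fix x
  show "pderiv i (\<lambda>x. F (f x)) x = F' (f x) * pderiv i f x"
    using pderiv_eqI[OF has_derivative_compose_real[OF assms(1) assms(2)]] by (simp add: grad_axis)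
qed

lemma Ck_const: "Ck k (\<lambda>x. c)"
proof (induction k arbitrary: c)
  case (Suc k)
  have "pderiv i (\<lambda>x. c) = (\<lambda>x. 0)" for i :: 'a
    using pderiv_eqI[of "\<lambda>x. c" "\<lambda>h. 0"] by auto
  with Suc show ?case by simp
qed simp

lemma Ck_add: "Ck k f \<Longrightarrow> Ck k g \<Longrightarrow> Ck k (\<lambda>x. f x + g x)"
proof (induction k arbitrary: f g)
  case 0
  then show ?case by (simp add: continuous_on_add)
next
  case (Suc k)
  then show ?case by (simp add: pderiv_add differentiable_on_add)
qed

lemma Ck_mult: "Ck k f \<Longrightarrow> Ck k g \<Longrightarrow> Ck k (\<lambda>x. f x * g x)"
proof (induction k arbitrary: f g)
  case 0
  then show ?case by (simp add: continuous_on_mult)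
next
  case (Suc k)
  have "Ck k f" "Ck k g" using Suc.prems Ck_SucD by blast+
  then have "Ck k (\<lambda>x. f x * pderiv i g x + pderiv i f x * g x)" for i
    using Suc.prems by (intro Ck_add Suc.IH) auto
  then show ?case using Suc.prems by (simp add: pderiv_mult differentiable_on_mult)
qed

text \<open>The outer function comes with the whole sequence of its derivatives because the
  induction has to pass from \<open>D j\<close> to \<open>D (Suc j)\<close>: the partial derivatives
  of the composition contain the next derivative. The truncations are later supplied in the same
  format.\<close>

lemma Ck_compose:
  assumes D: "\<And>j s. (D j has_real_derivative D (Suc j) s) (at s)"
  shows "Ck k f \<Longrightarrow> Ck k (\<lambda>x. D j (f x))"
proof (induction k arbitrary: f j)
  case 0
  have "continuous_on UNIV (D j)"
    using D by (meson DERIV_continuous continuous_at_imp_continuous_on)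
  then show ?case using 0 by (auto intro: continuous_on_compose2)
next
  case (Suc k)
  have diff: "f differentiable_on UNIV" using Suc.prems by simp
  have "(\<lambda>x. D j (f x)) differentiable_on UNIV"
    using has_derivative_compose_real[OF diff D]
    by (meson differentiable_at_imp_differentiable_on differentiableI)
  moreover have "Ck k (\<lambda>x. D (Suc j) (f x) * pderiv i f x)" for i
    using Suc Ck_SucD[OF Suc.prems] by (intro Ck_mult) auto
  ultimately show ?case using pderiv_compose[OF diff D] by simp
qed

lemma test_fun_Ck: "test_fun U f \<Longrightarrow> Ck k f"
  by (simp add: test_fun_def smooth_def)

lemma test_fun_differentiable: "test_fun U f \<Longrightarrow> f differentiable_on UNIV"
  using test_fun_Ck[of U f "Suc 0"] by simp

lemma test_fun_has_derivative:
  assumes "test_fun U f" shows "(f has_derivative (\<lambda>h. grad f x \<bullet> h)) (at x)"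
  using assms by (intro differentiable_on_UNIV_has_derivative test_fun_differentiable)

lemma test_fun_continuous: "test_fun U f \<Longrightarrow> continuous_on A f"
  using test_fun_Ck[of U f 0] by (auto intro: continuous_on_subset)

lemma test_fun_continuous_pderiv: "test_fun U f \<Longrightarrow> continuous_on A (pderiv i f)"
  using test_fun_Ck[of U f "Suc 0"] by (auto intro: continuous_on_subset)

lemma test_fun_continuous_grad: "test_fun U f \<Longrightarrow> continuous_on A (grad f)"
  unfolding grad_def[abs_def] by (intro continuous_on_vec_lambda test_fun_continuous_pderiv)

text \<open>A closed subset of the compact support is compact, so for multiples, products and
  compositions with functions vanishing at 0 only smoothness remains to be checked.\<close>

lemma test_fun_support_subset:
  assumes "test_fun U f" "smooth g" "\<And>x. f x = 0 \<Longrightarrow> g x = 0"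
  shows "test_fun U g"
proof -
  have sub: "closure {x. g x \<noteq> 0} \<subseteq> closure {x. f x \<noteq> 0}"
    using assms(3) by (intro closure_mono) auto
  moreover have "compact (closure {x. g x \<noteq> 0})"
    using sub assms(1) closed_closure compact_closure bounded_subset compact_imp_bounded
    unfolding test_fun_def by (metis compact_eq_bounded_closed)
  ultimately show ?thesis using assms unfolding test_fun_def by auto
qed

lemma test_fun_zero_outside: "test_fun U f \<Longrightarrow> x \<notin> U \<Longrightarrow> f x = 0"
  unfolding test_fun_def using closure_subset[of "{x. f x \<noteq> 0}"] by auto

text \<open>At a boundary point of \<open>U\<close>, vanishing off \<open>U\<close> would not decide
  the derivative. But the point lies outside the closed support, whose complement is an open set on
  which \<open>f\<close> is zero.\<close>

lemma grad_zero_outside: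
  assumes "test_fun U f" "x \<notin> U"
  shows "grad f x = 0"
proof -
  let ?S = "- closure {x. f x \<noteq> 0}"
  have x: "x \<in> ?S" using assms unfolding test_fun_def by auto
  have "\<And>y. y \<in> ?S \<Longrightarrow> f y = 0" using closure_subset[of "{x. f x \<noteq> 0}"] by auto
  note z = this
  have "((\<lambda>y. 0) has_derivative (\<lambda>h. grad f x \<bullet> h)) (at x)"
    by (rule has_derivative_transform_within_open[where s = ?S, OF test_fun_has_derivative[OF assms(1)] _ x])
      (rule open_Compl, rule closed_closure, erule z)
  then have "(\<lambda>h. grad f x \<bullet> h) = (\<lambda>h. 0)"
    by (rule has_derivative_unique) (rule has_derivative_const)
  then have "grad f x \<bullet> grad f x = 0" by metis
  then show ?thesis by simp
qed

lemma test_fun_add: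
  assumes "test_fun U f" "test_fun U g"
  shows "test_fun U (\<lambda>x. f x + g x)"
proof -
  have sub: "closure {x. f x + g x \<noteq> 0} \<subseteq> closure {x. f x \<noteq> 0} \<union> closure {x. g x \<noteq> 0}"
    unfolding closure_Un[symmetric] by (intro closure_mono) auto
  have c: "compact (closure {x. f x \<noteq> 0} \<union> closure {x. g x \<noteq> 0})"
    using assms unfolding test_fun_def by (intro compact_Un) auto
  have "bounded (closure {x. f x + g x \<noteq> 0})"
    using bounded_subset[OF compact_imp_bounded[OF c] sub] .
  then have "compact (closure {x. f x + g x \<noteq> 0})"
    by (simp add: compact_eq_bounded_closed)
  moreover have "smooth (\<lambda>x. f x + g x)"
    using assms Ck_add unfolding test_fun_def smooth_def by blast
  ultimately show ?thesis using assms sub unfolding test_fun_def by blast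
qed

lemma test_fun_cmult: "test_fun U f \<Longrightarrow> test_fun U (\<lambda>x. r * f x)"
  by (rule test_fun_support_subset[where f = f])
    (auto simp: test_fun_def smooth_def intro!: Ck_mult Ck_const)

lemma test_fun_mult: "test_fun U f \<Longrightarrow> test_fun U g \<Longrightarrow> test_fun U (\<lambda>x. f x * g x)"
  by (rule test_fun_support_subset[where f = f]) (auto simp: test_fun_def smooth_def intro!: Ck_mult)

lemma test_fun_compose:
  assumes "test_fun U f" "\<And>j s. (D j has_real_derivative D (Suc j) s) (at s)" "D 0 0 = 0"
  shows "test_fun U (\<lambda>x. D 0 (f x))"
proof (rule test_fun_support_subset[OF assms(1)])
  show "smooth (\<lambda>x. D 0 (f x))"
    unfolding smooth_def using Ck_compose[of D, OF assms(2) test_fun_Ck[OF assms(1)]] by blast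
qed (simp add: assms(3))

lemma grad_add:
  "test_fun U f \<Longrightarrow> test_fun U g \<Longrightarrow> grad (\<lambda>x. f x + g x) x = grad f x + grad g x"
  by (simp add: grad_def pderiv_add test_fun_differentiable vec_eq_iff)

lemma grad_mult:
  "test_fun U f \<Longrightarrow> test_fun U g \<Longrightarrow> grad (\<lambda>x. f x * g x) x = f x *\<^sub>R grad g x + g x *\<^sub>R grad f x"
  by (simp add: grad_def pderiv_mult test_fun_differentiable vec_eq_iff)

lemma grad_cmult:
  assumes "test_fun U f" shows "grad (\<lambda>x. r * f x) x = r *\<^sub>R grad f x"
  using pderiv_compose[OF test_fun_differentiable[OF assms], of "\<lambda>s. r * s" "\<lambda>s. r"]
  by (simp add: grad_def vec_eq_iff DERIV_cmult_Id)

lemma grad_compose: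
  assumes "test_fun U f" "\<And>s. (F has_real_derivative F' s) (at s)"
  shows "grad (\<lambda>x. F (f x)) x = F' (f x) *\<^sub>R grad f x"
  using pderiv_compose[OF test_fun_differentiable[OF assms(1)] assms(2)]
  by (simp add: grad_def vec_eq_iff)

lemma test_fun_zero: "test_fun U (\<lambda>x. 0)"
  by (simp add: test_fun_def smooth_def Ck_const)

section \<open>Sobolev inequality\<close>

text \<open>Compactly supported functions of class C^1. Unlike test functions they are stable under
  composition with C^1 functions vanishing at 0, such as the piecewise quadratic truncations below;
  the gradient is a parameter so that the chain rule can name it.\<close>

definition C1c :: "('a::euclidean_space \<Rightarrow> real) \<Rightarrow> ('a \<Rightarrow> 'a) \<Rightarrow> bool" where
  "C1c w G \<longleftrightarrow> (\<forall>x. (w has_derivative (\<lambda>h. G x \<bullet> h)) (at x)) \<and> continuous_on UNIV G \<and>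
     (\<exists>\<rho>. \<forall>x. norm x > \<rho> \<longrightarrow> w x = 0)"

lemma C1c_continuous: "C1c w G \<Longrightarrow> continuous_on UNIV w"
  unfolding C1c_def by (meson continuous_at_imp_continuous_on has_derivative_continuous)

lemma C1c_measurable:
  assumes "C1c w G"
  shows "w \<in> borel_measurable borel" "G \<in> borel_measurable borel"
  using C1c_continuous[OF assms] assms
  by (auto simp: C1c_def intro: borel_measurable_continuous_onI)

lemma nn_integral_lborel_translate:
  fixes h :: "'a::euclidean_space \<Rightarrow> ennreal"
  assumes [measurable]: "h \<in> borel_measurable borel"
  shows "(\<integral>\<^sup>+x. h (x + z) \<partial>lborel) = (\<integral>\<^sup>+x. h x \<partial>lborel)"
proof -
  have "(\<integral>\<^sup>+x. h x \<partial>lborel) = (\<integral>\<^sup>+x. h x \<partial>distr lborel borel ((+) z))"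
    by (simp add: lborel_distr_plus)
  also have "\<dots> = (\<integral>\<^sup>+x. h (z + x) \<partial>lborel)"
    by (subst nn_integral_distr) auto
  finally show ?thesis by (simp add: add.commute)
qed

lemma nn_integral_lborel_scale:
  fixes h :: "'a::euclidean_space \<Rightarrow> ennreal"
  assumes [measurable]: "h \<in> borel_measurable borel" and "s > 0"
  shows "ennreal (s ^ DIM('a)) * (\<integral>\<^sup>+y. h (x + s *\<^sub>R y) \<partial>lborel) = (\<integral>\<^sup>+y. h y \<partial>lborel)"
  using assms(2)
  by (subst (2) lborel_affine[of s x])
    (simp_all add: nn_integral_density nn_integral_distr nn_integral_cmult)

section \<open>The weak-type Sobolev inequality by averaging over dilated balls\<close>

lemma abs_diff_le_nn_integral_line:
  fixes x y :: "'a::euclidean_space"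
  assumes w: "C1c w G" and "a \<le> b"
  shows "ennreal \<bar>w (x + b *\<^sub>R y) - w (x + a *\<^sub>R y)\<bar>
     \<le> (\<integral>\<^sup>+s. ennreal (norm (G (x + s *\<^sub>R y)) * norm y) * indicator {a..b} s \<partial>lborel)"
proof -
  have contG: "continuous_on UNIV G" and der: "\<And>x. (w has_derivative (\<lambda>h. G x \<bullet> h)) (at x)"
    using w by (auto simp: C1c_def)
  let ?f = "\<lambda>s. G (x + s *\<^sub>R y) \<bullet> y"
  have cont: "continuous_on {a..b} ?f"
    by (intro continuous_intros continuous_on_compose2[OF contG]) auto
  have "((\<lambda>s. w (x + s *\<^sub>R y)) has_vector_derivative ?f s) (at s within {a..b})" for s
  proof -
    have "((\<lambda>s. w (x + s *\<^sub>R y)) has_derivative (\<lambda>h. G (x + s *\<^sub>R y) \<bullet> (h *\<^sub>R y))) (at s within {a..b})"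
      by (rule has_derivative_compose[OF _ der]) (auto intro!: derivative_eq_intros)
    then show ?thesis by (simp add: has_vector_derivative_def)
  qed
  then have eq: "(LINT s|lborel. indicator {a..b} s *\<^sub>R ?f s) = w (x + b *\<^sub>R y) - w (x + a *\<^sub>R y)"
    using assms(2) cont by (intro integral_FTC_atLeastAtMost) auto
  have int: "integrable lborel (\<lambda>s. indicator {a..b} s *\<^sub>R ?f s)"
    using borel_integrable_atLeastAtMost'[OF cont] by (simp add: set_integrable_def)
  have "ennreal \<bar>w (x + b *\<^sub>R y) - w (x + a *\<^sub>R y)\<bar>
      \<le> (\<integral>\<^sup>+s. ennreal (norm (indicator {a..b} s *\<^sub>R ?f s)) \<partial>lborel)"
    using integral_norm_bound_ennreal[OF int] eq by simp
  also have "\<dots> \<le> (\<integral>\<^sup>+s. ennreal (norm (G (x + s *\<^sub>R y)) * norm y) * indicator {a..b} s \<partial>lborel)"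
    by (intro nn_integral_mono) (auto simp: indicator_def Cauchy_Schwarz_ineq2 intro!: ennreal_leI)
  finally show ?thesis .
qed

text \<open>The difference is an integral of the gradient over the segment from \<open>x\<close> to
  \<open>x + y\<close>. Cauchy-Schwarz in the parameter of the segment, Fubini and translation
  invariance in \<open>x\<close> give the bound.\<close>

lemma nn_integral_translate_diff_le:
  fixes y :: "'a::euclidean_space"
  assumes w: "C1c w G"
  shows "(\<integral>\<^sup>+x. ennreal ((w (x + y) - w x)\<^sup>2) \<partial>lborel)
    \<le> ennreal ((norm y)\<^sup>2) * (\<integral>\<^sup>+x. ennreal ((norm (G x))\<^sup>2) \<partial>lborel)"
proof -
  note [measurable] = C1c_measurable[OF w]
  have pw: "ennreal ((w (x + y) - w x)\<^sup>2)
    \<le> (\<integral>\<^sup>+s. ennreal ((norm (G (x + s *\<^sub>R y)))\<^sup>2 * (norm y)\<^sup>2) * indicator {0..1} s \<partial>lborel)" for x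
  proof -
    let ?h = "\<lambda>s. ennreal (norm (G (x + s *\<^sub>R y)) * norm y) * indicator {0..1::real} s"
    have "ennreal \<bar>w (x + y) - w x\<bar> \<le> (\<integral>\<^sup>+s. ?h s \<partial>lborel)"
      using abs_diff_le_nn_integral_line[OF w, of 0 1 x y] by simp
    \<comment> \<open>The indicator is idempotent; the second copy serves as the other factor of the
      Cauchy-Schwarz inequality, and its square has integral 1.\<close>
    also have "\<dots> = (\<integral>\<^sup>+s. indicator {0..1} s * ?h s \<partial>lborel)"
      by (intro nn_integral_cong) (auto simp: indicator_def)
    finally have "(ennreal \<bar>w (x + y) - w x\<bar>)\<^sup>2 \<le> (\<integral>\<^sup>+s. indicator {0..1} s * ?h s \<partial>lborel)\<^sup>2"
      by (intro power_mono) auto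
    also have "\<dots> \<le> (\<integral>\<^sup>+s. (indicator {0..1::real} s)\<^sup>2 \<partial>lborel) * (\<integral>\<^sup>+s. (?h s)\<^sup>2 \<partial>lborel)"
      by (intro Cauchy_Schwarz_nn_integral) auto
    also have "(\<integral>\<^sup>+s. (indicator {0..1::real} s)\<^sup>2 \<partial>lborel) = (\<integral>\<^sup>+s. indicator {0..1::real} s \<partial>lborel)"
      by (intro nn_integral_cong) (auto simp: indicator_def)
    also have "\<dots> = 1" by simp
    also have "(\<integral>\<^sup>+s. (?h s)\<^sup>2 \<partial>lborel)
       = (\<integral>\<^sup>+s. ennreal ((norm (G (x + s *\<^sub>R y)))\<^sup>2 * (norm y)\<^sup>2) * indicator {0..1} s \<partial>lborel)"
      by (intro nn_integral_cong) (auto simp: indicator_def ennreal_power power_mult_distrib)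
    finally show ?thesis by (simp add: ennreal_power)
  qed
  have "(\<integral>\<^sup>+x. ennreal ((w (x + y) - w x)\<^sup>2) \<partial>lborel)
    \<le> (\<integral>\<^sup>+x. (\<integral>\<^sup>+s. ennreal ((norm (G (x + s *\<^sub>R y)))\<^sup>2 * (norm y)\<^sup>2) * indicator {0..1::real} s \<partial>lborel) \<partial>lborel)"
    by (intro nn_integral_mono pw)
  also have "\<dots> = (\<integral>\<^sup>+s. (\<integral>\<^sup>+x. ennreal ((norm (G (x + s *\<^sub>R y)))\<^sup>2 * (norm y)\<^sup>2) * indicator {0..1::real} s \<partial>lborel) \<partial>lborel)"
    by (rule lborel_pair.Fubini'[symmetric]) measurable
  also have "\<dots> = (\<integral>\<^sup>+s. (ennreal ((norm y)\<^sup>2) * (\<integral>\<^sup>+x. ennreal ((norm (G x))\<^sup>2) \<partial>lborel)) * indicator {0..1::real} s \<partial>lborel)"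
  proof (rule nn_integral_cong)
    fix s :: real
    have "(\<integral>\<^sup>+x. ennreal ((norm (G (x + s *\<^sub>R y)))\<^sup>2 * (norm y)\<^sup>2) * indicator {0..1::real} s \<partial>lborel)
      = (\<integral>\<^sup>+x. ennreal ((norm (G (x + s *\<^sub>R y)))\<^sup>2) \<partial>lborel) * ennreal ((norm y)\<^sup>2) * indicator {0..1::real} s"
      by (subst nn_integral_multc[symmetric], measurable)+ (simp add: ennreal_mult)
    also have "(\<integral>\<^sup>+x. ennreal ((norm (G (x + s *\<^sub>R y)))\<^sup>2) \<partial>lborel) = (\<integral>\<^sup>+x. ennreal ((norm (G x))\<^sup>2) \<partial>lborel)"
      by (rule nn_integral_lborel_translate) measurable
    finally show "(\<integral>\<^sup>+x. ennreal ((norm (G (x + s *\<^sub>R y)))\<^sup>2 * (norm y)\<^sup>2) * indicator {0..1::real} s \<partial>lborel)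
      = (ennreal ((norm y)\<^sup>2) * (\<integral>\<^sup>+x. ennreal ((norm (G x))\<^sup>2) \<partial>lborel)) * indicator {0..1::real} s"
      by (simp add: mult.commute)
  qed
  also have "\<dots> = ennreal ((norm y)\<^sup>2) * (\<integral>\<^sup>+x. ennreal ((norm (G x))\<^sup>2) \<partial>lborel)"
    by (subst nn_integral_cmult_indicator) auto
  finally show ?thesis .
qed

text \<open>Applied with \<open>a\<close> equal to half the dimension; finiteness of this tail is
  where dimension at least 3 is used.\<close>

lemma nn_integral_powr_tail:
  fixes a r :: real
  assumes "a > 1" "r > 0"
  shows "(\<integral>\<^sup>+s. ennreal (s powr (-a)) * indicator {r..} s \<partial>lborel) = ennreal (r powr (1 - a) / (a - 1))"
proof -
  have "(\<integral>\<^sup>+s. ennreal (s powr (-a)) * indicator {r..} s \<partial>lborel)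
    = ennreal (0 - (- (r powr (1 - a) / (a - 1))))"
  proof (rule nn_integral_FTC_atLeast[where F = "\<lambda>s. - (s powr (1 - a) / (a - 1))"])
    fix s :: real assume "r \<le> s"
    then show "((\<lambda>s. - (s powr (1 - a) / (a - 1))) has_real_derivative s powr (-a)) (at s)"
    proof -
      have "- ((1 - a) * s powr - a / (a - 1)) = s powr - a" using assms by (simp add: field_simps)
      then show ?thesis
        using DERIV_minus[OF DERIV_cdivide[OF has_real_derivative_powr[of s "1 - a"], of "a - 1"]]
          \<open>r \<le> s\<close> assms by simp
    qed
  next
    have "((\<lambda>s::real. s powr (1 - a)) \<longlongrightarrow> 0) at_top"
      using assms by (intro tendsto_neg_powr filterlim_ident) auto
    then show "((\<lambda>s. - (s powr (1 - a) / (a - 1))) \<longlongrightarrow> 0) at_top"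
      using tendsto_minus[OF tendsto_divide[OF _ tendsto_const], of _ 0 at_top "a - 1"] assms by fastforce
  qed auto
  then show ?thesis by simp
qed

text \<open>Averaging over the dilates of a ball that stays away from the origin, every value
  \<^term>\<open>w (x + r *\<^sub>R y)\<close> can be written as an integral of the gradient along the outgoing ray.\<close>

lemma nn_integral_dilated_ball_le:
  fixes w :: "'a::euclidean_space \<Rightarrow> real" and z :: 'a
  defines "a \<equiv> real DIM('a) / 2"
  assumes w: "C1c w G" and d: "a > 1" and z: "norm z = 2" and r: "r > 0" and n: "n > 0"
    and N: "(\<integral>\<^sup>+x. ennreal ((norm (G x))\<^sup>2) \<partial>lborel) \<le> ennreal n"
  shows "(\<integral>\<^sup>+y. ennreal \<bar>w (x + r *\<^sub>R y)\<bar> * indicator (ball z 1) y \<partial>lborel)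
    \<le> ennreal (3 * (1 + measure lborel (ball z 1)) / (2 * (a - 1)) * sqrt n * r powr (1 - a))"
proof -
  note [measurable] = C1c_measurable[OF w]
  let ?A = "ball z 1"
  let ?m = "measure lborel ?A"
  have [measurable]: "?A \<in> sets borel" by simp
  have m: "emeasure lborel ?A = ennreal ?m"
    using emeasure_lborel_ball_finite[of z 1] by (simp add: emeasure_eq_ennreal_measure)
  \<comment> \<open>The centre has norm 2 and the radius is 1. The lower bound pushes every ray out
    of the support of \<open>w\<close>, the upper bound controls the factor \<open>norm y\<close> of
    the line integral.\<close>
  have normA: "1 \<le> norm y \<and> norm y \<le> 3" if "y \<in> ?A" for y
    using that z norm_triangle_ineq2[of z y] norm_triangle_ineq2[of y z]
    by (auto simp: dist_norm norm_minus_commute)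
  obtain \<rho> where \<rho>: "\<And>x. norm x > \<rho> \<Longrightarrow> w x = 0" using w unfolding C1c_def by auto
  \<comment> \<open>The right side of \<open>2 N \<le> q N^2 + 1/q\<close> for
    \<open>q = s^a / sqrt n\<close>, with \<open>N\<close> the norm of the gradient. This weight
    balances the two terms: after integration over \<open>y\<close> in the ball both are bounded by
    a multiple of \<open>sqrt n * s^(-a)\<close>.\<close>
  let ?g = "\<lambda>s y. 1 / sqrt n * (s powr a * (norm (G (x + s *\<^sub>R y)))\<^sup>2) + sqrt n * s powr (-a)"
  have pw: "ennreal \<bar>w (x + r *\<^sub>R y)\<bar> * indicator ?A y
    \<le> (\<integral>\<^sup>+s. ennreal (3/2 * ?g s y) * indicator {r..} s * indicator ?A y \<partial>lborel)" for y
  proof (cases "y \<in> ?A")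
    case True
    \<comment> \<open>As \<open>norm y \<ge> 1\<close>, the point \<open>x + R y\<close> lies beyond
      the radius \<open>\<rho>\<close> outside which \<open>w\<close> vanishes.\<close>
    define R where "R = max r (\<bar>\<rho>\<bar> + norm x + 1)"
    have "R * 1 \<le> R * norm y" using normA[OF True] by (intro mult_left_mono) (use r in \<open>auto simp: R_def\<close>)
    moreover have "norm (R *\<^sub>R y) \<le> norm (x + R *\<^sub>R y) + norm x"
      using norm_triangle_ineq4[of "x + R *\<^sub>R y" x] by simp
    moreover have "R \<ge> 0" "R \<ge> \<bar>\<rho>\<bar> + norm x + 1" using r by (auto simp: R_def)
    ultimately have "norm (x + R *\<^sub>R y) > \<rho>" by simp
    then have w0: "w (x + R *\<^sub>R y) = 0" by (rule \<rho>)
    have "ennreal \<bar>w (x + r *\<^sub>R y)\<bar>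
       \<le> (\<integral>\<^sup>+s. ennreal (norm (G (x + s *\<^sub>R y)) * norm y) * indicator {r..R} s \<partial>lborel)"
      using abs_diff_le_nn_integral_line[OF w, of r R x y] w0 by (simp add: R_def)
    also have "\<dots> \<le> (\<integral>\<^sup>+s. ennreal (3/2 * ?g s y) * indicator {r..} s \<partial>lborel)"
    proof (rule nn_integral_mono)
      fix s :: real
      have "norm (G (x + s *\<^sub>R y)) * norm y \<le> 3/2 * ?g s y" if "s \<ge> r"
      proof -
        let ?N = "norm (G (x + s *\<^sub>R y))"
        have s: "s > 0" using that r by simp
        define q where "q = s powr a / sqrt n"
        have q: "q > 0" using s n by (simp add: q_def)
        have "0 \<le> (q * ?N - 1)\<^sup>2 / q" using q by simp
        also have "\<dots> = q * ?N\<^sup>2 - 2 * ?N + 1 / q"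
          using q by (simp add: field_simps power2_eq_square)
        finally have "2 * ?N \<le> q * ?N\<^sup>2 + 1 / q" by simp
        also have "\<dots> = ?g s y"
          using s n by (simp add: q_def powr_minus field_simps)
        finally have "2 * ?N \<le> ?g s y" .
        moreover have "?N * norm y \<le> ?N * 3" using normA[OF True] by (intro mult_left_mono) auto
        ultimately show ?thesis by simp
      qed
      then show "ennreal (norm (G (x + s *\<^sub>R y)) * norm y) * indicator {r..R} s
         \<le> ennreal (3/2 * ?g s y) * indicator {r..} s"
        by (auto simp: indicator_def intro!: ennreal_leI)
    qed
    finally show ?thesis using True by simp
  qed simp
  have slice: "(\<integral>\<^sup>+y. ennreal (3/2 * ?g s y) * indicator {r..} s * indicator ?A y \<partial>lborel)
     \<le> ennreal (3/2 * (1 + ?m) * sqrt n) * (ennreal (s powr (-a)) * indicator {r..} s)" for s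
  proof (cases "s \<ge> r")
    case True
    then have s: "s > 0" using r by simp
    have sd: "s ^ DIM('a) = s powr a * s powr a"
      using s by (simp add: a_def powr_add[symmetric] powr_realpow)
    \<comment> \<open>The \<open>y\<close>-integral is enlarged from the ball to the whole space,
      where the substitution \<open>y \<mapsto> x + s y\<close> turns it into the full Dirichlet
      integral divided by \<open>s^d\<close>.\<close>
    have "ennreal (s ^ DIM('a)) * (\<integral>\<^sup>+y. ennreal ((norm (G (x + s *\<^sub>R y)))\<^sup>2) \<partial>lborel) \<le> ennreal n"
      using nn_integral_lborel_scale[of "\<lambda>y. ennreal ((norm (G y))\<^sup>2)", OF _ s] N by simp
    then have "ennreal (1 / s ^ DIM('a)) * (ennreal (s ^ DIM('a)) * (\<integral>\<^sup>+y. ennreal ((norm (G (x + s *\<^sub>R y)))\<^sup>2) \<partial>lborel))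
       \<le> ennreal (1 / s ^ DIM('a)) * ennreal n"
      by (rule mult_left_mono) simp
    then have I: "(\<integral>\<^sup>+y. ennreal ((norm (G (x + s *\<^sub>R y)))\<^sup>2) \<partial>lborel) \<le> ennreal (n / s ^ DIM('a))"
      using s n by (simp add: mult.assoc[symmetric] ennreal_mult[symmetric])
    have split: "(\<integral>\<^sup>+y. P * ennreal ((norm (G (x + s *\<^sub>R y)))\<^sup>2) + Q * indicator ?A y \<partial>lborel)
       = P * (\<integral>\<^sup>+y. ennreal ((norm (G (x + s *\<^sub>R y)))\<^sup>2) \<partial>lborel) + Q * ennreal ?m" for P Q :: ennreal
    proof -
      have G2: "(\<lambda>y. ennreal ((norm (G (x + s *\<^sub>R y)))\<^sup>2)) \<in> borel_measurable lborel" by measurable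
      have I: "(indicator ?A :: 'a \<Rightarrow> ennreal) \<in> borel_measurable lborel" by measurable
      show ?thesis
        by (subst nn_integral_add[OF borel_measurable_times_ennreal[OF borel_measurable_const G2]
              borel_measurable_times_ennreal[OF borel_measurable_const I]])
          (simp only: nn_integral_cmult[OF G2] nn_integral_cmult_indicator m sets_lborel borel_open open_ball)
    qed
    have "(\<integral>\<^sup>+y. ennreal (3/2 * ?g s y) * indicator {r..} s * indicator ?A y \<partial>lborel)
      \<le> (\<integral>\<^sup>+y. ennreal (3/2 / sqrt n * s powr a) * ennreal ((norm (G (x + s *\<^sub>R y)))\<^sup>2)
           + ennreal (3/2 * sqrt n * s powr (-a)) * indicator ?A y \<partial>lborel)"
    proof (rule nn_integral_mono)
      fix y :: 'a
      let ?P = "3/2 / sqrt n * s powr a" and ?Q = "3/2 * sqrt n * s powr (-a)" and ?X = "(norm (G (x + s *\<^sub>R y)))\<^sup>2"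
      have nn: "?P \<ge> 0" "?Q \<ge> 0" using n by auto
      have "3/2 * ?g s y = ?P * ?X + ?Q" by (simp add: algebra_simps)
      then have "ennreal (3/2 * ?g s y) = ennreal (?P * ?X + ?Q)" by (simp only:)
      also have "\<dots> = ennreal (?P * ?X) + ennreal ?Q"
        by (intro ennreal_plus mult_nonneg_nonneg nn) simp
      also have "ennreal (?P * ?X) = ennreal ?P * ennreal ?X"
        by (intro ennreal_mult nn) simp
      finally show "ennreal (3/2 * ?g s y) * indicator {r..} s * indicator ?A y
          \<le> ennreal ?P * ennreal ?X + ennreal ?Q * indicator ?A y"
        using True by (cases "y \<in> ?A") (simp_all del: ennreal_plus times_divide_eq_right times_divide_eq_left)
    qed
    also have "\<dots> = ennreal (3/2 / sqrt n * s powr a) * (\<integral>\<^sup>+y. ennreal ((norm (G (x + s *\<^sub>R y)))\<^sup>2) \<partial>lborel)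
           + ennreal (3/2 * sqrt n * s powr (-a)) * ennreal ?m"
      by (rule split)
    also have "\<dots> \<le> ennreal (3/2 / sqrt n * s powr a) * ennreal (n / s ^ DIM('a))
           + ennreal (3/2 * sqrt n * s powr (-a)) * ennreal ?m"
      by (intro add_mono mult_left_mono I) auto
    also have "\<dots> = ennreal (3/2 / sqrt n * s powr a * (n / s ^ DIM('a)) + 3/2 * sqrt n * s powr (-a) * ?m)"
      using n s by (simp add: ennreal_mult[symmetric] ennreal_plus[symmetric] del: ennreal_plus)
    also have "3/2 / sqrt n * s powr a * (n / s ^ DIM('a)) = 3/2 * sqrt n * s powr (-a)"
      using n s unfolding sd by (simp add: powr_minus field_simps)
    also have "3/2 * sqrt n * s powr (-a) + 3/2 * sqrt n * s powr (-a) * ?m = 3/2 * (1 + ?m) * sqrt n * s powr (-a)"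
      by (simp add: algebra_simps)
    also have "ennreal \<dots> = ennreal (3/2 * (1 + ?m) * sqrt n) * (ennreal (s powr (-a)) * indicator {r..} s)"
      using True n by (subst ennreal_mult) auto
    finally show ?thesis .
  qed simp
  have "(\<integral>\<^sup>+y. ennreal \<bar>w (x + r *\<^sub>R y)\<bar> * indicator ?A y \<partial>lborel)
    \<le> (\<integral>\<^sup>+y. (\<integral>\<^sup>+s. ennreal (3/2 * ?g s y) * indicator {r..} s * indicator ?A y \<partial>lborel) \<partial>lborel)"
    by (intro nn_integral_mono pw)
  also have "\<dots> = (\<integral>\<^sup>+s. (\<integral>\<^sup>+y. ennreal (3/2 * ?g s y) * indicator {r..} s * indicator ?A y \<partial>lborel) \<partial>lborel)"
    by (rule lborel_pair.Fubini'[symmetric]) measurable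
  also have "\<dots> \<le> (\<integral>\<^sup>+s. ennreal (3/2 * (1 + ?m) * sqrt n) * (ennreal (s powr (-a)) * indicator {r..} s) \<partial>lborel)"
    by (intro nn_integral_mono slice)
  also have "\<dots> = ennreal (3/2 * (1 + ?m) * sqrt n) * ennreal (r powr (1 - a) / (a - 1))"
    by (subst nn_integral_cmult, measurable) (simp only: nn_integral_powr_tail[OF d r])
  also have "\<dots> = ennreal (3/2 * (1 + ?m) * sqrt n * (r powr (1 - a) / (a - 1)))"
    using n d by (intro ennreal_mult[symmetric]) auto
  also have "3/2 * (1 + ?m) * sqrt n * (r powr (1 - a) / (a - 1)) = 3 * (1 + ?m) / (2 * (a - 1)) * sqrt n * r powr (1 - a)"
    by simp
  finally show ?thesis .
qed


text \<open>For a suitable radius \<open>r\<close> the average of \<open>\<bar>w\<bar>\<close> over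
  \<open>x + r A\<close> is at most \<open>t / 2\<close> for every \<open>x\<close>. Where
  \<open>\<bar>w x\<bar> \<ge> t\<close>, the oscillation
  \<open>\<bar>w (x + r y) - w x\<bar>\<close> therefore has average at least \<open>t / 2\<close>
  over \<open>A\<close>. Its square integrated over \<open>x\<close> is bounded by the translation
  estimate, and Chebyshev's inequality bounds the measure.\<close>

theorem weak_Sobolev:
  assumes "DIM('a::euclidean_space) \<ge> 3"
  shows "\<exists>C>0. \<forall>(w::'a \<Rightarrow> real) G n t. C1c w G \<longrightarrow> n > 0 \<longrightarrow> t > 0 \<longrightarrow>
      (\<integral>\<^sup>+x. ennreal ((norm (G x))\<^sup>2) \<partial>lborel) \<le> ennreal n \<longrightarrow>
      emeasure lborel {x. \<bar>w x\<bar> \<ge> t} \<le> ennreal (C * (n / t\<^sup>2) powr (real DIM('a) / (real DIM('a) - 2)))"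
proof -
  obtain b :: 'a where "b \<in> Basis" using SOME_Basis by blast
  define z where "z = 2 *\<^sub>R b"
  have z: "norm z = 2" using \<open>b \<in> Basis\<close> by (simp add: z_def)
  let ?A = "ball z 1"
  have [measurable]: "?A \<in> sets borel" by simp
  define m where "m = measure lborel ?A"
  define a where "a = real DIM('a) / 2"
  have a: "a > 1" using assms by (simp add: a_def)
  have m: "m > 0" using content_ball_pos[of 1 z] by (simp add: m_def)
  have em: "emeasure lborel ?A = ennreal m"
    using emeasure_lborel_ball_finite[of z 1] by (simp add: m_def emeasure_eq_ennreal_measure)
  define C0 where "C0 = 3 * (1 + m) / (2 * (a - 1))"
  have C0: "C0 > 0" using a m by (simp add: C0_def)
  define K where "K = 2 * C0 / m"
  have K: "K > 0" using C0 m by (simp add: K_def)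
  \<comment> \<open>Comparing \<open>m * t^2 / 4\<close> times the measure with
    \<open>9 * r^2 * n * m\<close> leaves the factor 36 times \<open>r^2 * n / t^2\<close>; the rest
    is the \<open>K\<close>-part of \<open>r^2\<close>.\<close>
  define C where "C = 36 * (K\<^sup>2) powr (1 / (a - 1))"
  show ?thesis
  proof (intro exI[of _ C] conjI allI impI)
    show "C > 0" using K by (simp add: C_def)
    fix w :: "'a \<Rightarrow> real" and G and n t :: real
    assume w: "C1c w G" and n: "n > 0" and t: "t > 0"
      and N: "(\<integral>\<^sup>+x. ennreal ((norm (G x))\<^sup>2) \<partial>lborel) \<le> ennreal n"
    note [measurable] = C1c_measurable[OF w]
    define \<tau> where "\<tau> = n / t\<^sup>2"
    have \<tau>: "\<tau> > 0" using n t by (simp add: \<tau>_def)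
    \<comment> \<open>The solution of \<open>C0 * sqrt n * r powr (1 - a) = m * t / 2\<close>, which
      makes the average over the dilated ball exactly half the level.\<close>
    define r where "r = (K\<^sup>2 * \<tau>) powr (1 / (2 * (a - 1)))"
    have r: "r > 0" using K \<tau> by (simp add: r_def)
    have rp: "r powr (1 - a) = t / (K * sqrt n)"
    proof -
      have "1 / (2 * (a - 1)) * (1 - a) = - (1/2)" using a by (simp add: field_simps)
      then have "r powr (1 - a) = (K\<^sup>2 * \<tau>) powr (- (1/2))"
        unfolding r_def powr_powr by simp
      also have "\<dots> = 1 / sqrt (K\<^sup>2 * \<tau>)"
        using K \<tau> by (simp add: powr_minus powr_half_sqrt field_simps)
      also have "\<dots> = t / (K * sqrt n)"
        using K t n by (simp add: \<tau>_def real_sqrt_mult real_sqrt_divide)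
      finally show ?thesis .
    qed
    have avg: "(\<integral>\<^sup>+y. ennreal \<bar>w (x + r *\<^sub>R y)\<bar> * indicator ?A y \<partial>lborel) \<le> ennreal (m * t / 2)" for x
    proof -
      have "(\<integral>\<^sup>+y. ennreal \<bar>w (x + r *\<^sub>R y)\<bar> * indicator ?A y \<partial>lborel)
         \<le> ennreal (C0 * sqrt n * r powr (1 - a))"
        using nn_integral_dilated_ball_le[OF w a[unfolded a_def] z r n N, of x]
        by (simp add: C0_def m_def a_def)
      also have "C0 * sqrt n * r powr (1 - a) = m * t / 2"
        unfolding rp using K C0 m n by (simp add: K_def field_simps)
      finally show ?thesis .
    qed
    define E where "E x = (\<integral>\<^sup>+y. ennreal ((w (x + r *\<^sub>R y) - w x)\<^sup>2) * indicator ?A y \<partial>lborel)" for x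
    have [measurable]: "E \<in> borel_measurable borel" unfolding E_def by measurable
    \<comment> \<open>Triangle inequality under the integral, subtraction of the average from
      \<open>m * t\<close>, then Cauchy-Schwarz on the ball of measure \<open>m\<close> to pass from
      the first to the second moment.\<close>
    have lower: "ennreal (m * t\<^sup>2 / 4) \<le> E x" if "\<bar>w x\<bar> \<ge> t" for x
    proof -
      let ?D = "\<integral>\<^sup>+y. indicator ?A y * (ennreal \<bar>w (x + r *\<^sub>R y) - w x\<bar> * indicator ?A y) \<partial>lborel"
      have "ennreal (m * t) = (\<integral>\<^sup>+y. ennreal t * indicator ?A y \<partial>lborel)"
        using m t by (simp add: nn_integral_cmult_indicator em ennreal_mult[symmetric] mult.commute)
      also have "\<dots> \<le> (\<integral>\<^sup>+y. indicator ?A y * (ennreal \<bar>w (x + r *\<^sub>R y) - w x\<bar> * indicator ?A y)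
            + ennreal \<bar>w (x + r *\<^sub>R y)\<bar> * indicator ?A y \<partial>lborel)"
        using that by (intro nn_integral_mono)
          (auto simp: indicator_def ennreal_plus[symmetric] simp del: ennreal_plus intro!: ennreal_leI)
      also have "\<dots> = ?D + (\<integral>\<^sup>+y. ennreal \<bar>w (x + r *\<^sub>R y)\<bar> * indicator ?A y \<partial>lborel)"
        by (rule nn_integral_add) measurable
      also have "\<dots> \<le> ?D + ennreal (m * t / 2)" by (intro add_left_mono avg)
      finally have 1: "ennreal (m * t) \<le> ?D + ennreal (m * t / 2)" .
      have "ennreal (m * t) = ennreal (m * t / 2) + ennreal (m * t / 2)"
        using m t by (simp add: ennreal_plus[symmetric] del: ennreal_plus)
      with 1 have "ennreal (m * t / 2) + ennreal (m * t / 2) \<le> ennreal (m * t / 2) + ?D"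
        by (simp only: add.commute)
      then have "ennreal (m * t / 2) \<le> ?D"
        unfolding ennreal_add_left_cancel_le by simp
      then have "(ennreal (m * t / 2))\<^sup>2 \<le> ?D\<^sup>2" by (intro power_mono) auto
      also have "\<dots> \<le> (\<integral>\<^sup>+y. (indicator ?A y)\<^sup>2 \<partial>lborel)
           * (\<integral>\<^sup>+y. (ennreal \<bar>w (x + r *\<^sub>R y) - w x\<bar> * indicator ?A y)\<^sup>2 \<partial>lborel)"
        by (intro Cauchy_Schwarz_nn_integral) measurable
      also have "(\<integral>\<^sup>+y. (indicator ?A y)\<^sup>2 \<partial>lborel) = (\<integral>\<^sup>+y. indicator ?A y \<partial>lborel)"
        by (intro nn_integral_cong) (auto simp: indicator_def)
      also have "\<dots> = ennreal m" by (simp add: em)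
      also have "(\<integral>\<^sup>+y. (ennreal \<bar>w (x + r *\<^sub>R y) - w x\<bar> * indicator ?A y)\<^sup>2 \<partial>lborel) = E x"
        unfolding E_def by (intro nn_integral_cong) (auto simp: indicator_def ennreal_power)
      finally have "ennreal ((m * t / 2)\<^sup>2) \<le> ennreal m * E x"
        using m t by (simp add: ennreal_power)
      then have "ennreal (1 / m) * ennreal ((m * t / 2)\<^sup>2) \<le> ennreal (1 / m) * (ennreal m * E x)"
        by (rule mult_left_mono) simp
      then show ?thesis
        using m t by (simp add: mult.assoc[symmetric] ennreal_mult[symmetric] power2_eq_square)
        (simp add: mult_ac)
    qed
    have upper: "(\<integral>\<^sup>+x. E x \<partial>lborel) \<le> ennreal (9 * r\<^sup>2 * n * m)"
    proof -
      have "(\<integral>\<^sup>+x. E x \<partial>lborel)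
          = (\<integral>\<^sup>+y. (\<integral>\<^sup>+x. ennreal ((w (x + r *\<^sub>R y) - w x)\<^sup>2) * indicator ?A y \<partial>lborel) \<partial>lborel)"
        unfolding E_def by (rule lborel_pair.Fubini'[symmetric]) measurable
      also have "\<dots> \<le> (\<integral>\<^sup>+y. ennreal (9 * r\<^sup>2 * n) * indicator ?A y \<partial>lborel)"
      proof (rule nn_integral_mono)
        fix y
        show "(\<integral>\<^sup>+x. ennreal ((w (x + r *\<^sub>R y) - w x)\<^sup>2) * indicator ?A y \<partial>lborel)
            \<le> ennreal (9 * r\<^sup>2 * n) * indicator ?A y"
        proof (cases "y \<in> ?A")
          case True
          then have "norm y \<le> 3"
            using z norm_triangle_ineq2[of y z] by (auto simp: dist_norm norm_minus_commute)
          then have "r * norm y \<le> r * 3" using r by (intro mult_left_mono) auto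
          then have "(norm (r *\<^sub>R y))\<^sup>2 \<le> (r * 3)\<^sup>2" using r by (intro power_mono) auto
          then have yy: "(norm (r *\<^sub>R y))\<^sup>2 \<le> 9 * r\<^sup>2" by (simp add: power_mult_distrib)
          have "(\<integral>\<^sup>+x. ennreal ((w (x + r *\<^sub>R y) - w x)\<^sup>2) \<partial>lborel)
             \<le> ennreal ((norm (r *\<^sub>R y))\<^sup>2) * (\<integral>\<^sup>+x. ennreal ((norm (G x))\<^sup>2) \<partial>lborel)"
            by (rule nn_integral_translate_diff_le[OF w])
          also have "\<dots> \<le> ennreal (9 * r\<^sup>2) * ennreal n"
            using yy by (intro mult_mono N ennreal_leI) auto
          also have "\<dots> = ennreal (9 * r\<^sup>2 * n)" using n by (simp add: ennreal_mult)
          finally show ?thesis using True by simp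
        qed simp
      qed
      also have "\<dots> = ennreal (9 * r\<^sup>2 * n) * ennreal m"
        by (simp add: nn_integral_cmult_indicator em)
      finally show ?thesis using n m by (simp add: ennreal_mult)
    qed
    have "ennreal (m * t\<^sup>2 / 4) * emeasure lborel {x. \<bar>w x\<bar> \<ge> t}
       = (\<integral>\<^sup>+x. ennreal (m * t\<^sup>2 / 4) * indicator {x. \<bar>w x\<bar> \<ge> t} x \<partial>lborel)"
      by (rule nn_integral_cmult_indicator[symmetric]) measurable
    also have "\<dots> \<le> (\<integral>\<^sup>+x. E x \<partial>lborel)"
      using lower by (intro nn_integral_mono) (auto simp: indicator_def)
    also note upper
    finally have "ennreal (4 / (m * t\<^sup>2)) * (ennreal (m * t\<^sup>2 / 4) * emeasure lborel {x. \<bar>w x\<bar> \<ge> t})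
       \<le> ennreal (4 / (m * t\<^sup>2)) * ennreal (9 * r\<^sup>2 * n * m)"
      by (rule mult_left_mono) simp
    then have "emeasure lborel {x. \<bar>w x\<bar> \<ge> t} \<le> ennreal (36 * (r\<^sup>2 * \<tau>))"
      using m t n by (simp add: mult.assoc[symmetric] ennreal_mult[symmetric] \<tau>_def)
    also have "r\<^sup>2 * \<tau> = (K\<^sup>2) powr (1 / (a - 1)) * \<tau> powr (a / (a - 1))"
    proof -
      have "r\<^sup>2 = r powr 2" using r by simp
      also have "\<dots> = (K\<^sup>2 * \<tau>) powr (1 / (a - 1))"
      proof -
        have "1 / (2 * (a - 1)) * 2 = 1 / (a - 1)" using a by (simp add: field_simps)
        then show ?thesis by (simp only: r_def powr_powr)
      qed
      also have "\<dots> = (K\<^sup>2) powr (1 / (a - 1)) * \<tau> powr (1 / (a - 1))"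
        using K \<tau> by (simp add: powr_mult)
      finally have "r\<^sup>2 * \<tau> = (K\<^sup>2) powr (1 / (a - 1)) * (\<tau> powr (1 / (a - 1)) * \<tau> powr 1)"
        using \<tau> by simp
      also have "\<tau> powr (1 / (a - 1)) * \<tau> powr 1 = \<tau> powr (a / (a - 1))"
        using a by (simp only: powr_add[symmetric]) (simp add: field_simps)
      finally show ?thesis .
    qed
    also have "36 * ((K\<^sup>2) powr (1 / (a - 1)) * \<tau> powr (a / (a - 1))) = C * \<tau> powr (a / (a - 1))"
      by (simp add: C_def)
    also have "a / (a - 1) = real DIM('a) / (real DIM('a) - 2)"
      using a by (simp add: a_def field_simps)
    finally show "emeasure lborel {x. \<bar>w x\<bar> \<ge> t} \<le> ennreal (C * (n / t\<^sup>2) powr (real DIM('a) / (real DIM('a) - 2)))"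
      by (simp add: \<tau>_def)
  qed
qed

text \<open>The case \<open>n = 0\<close> is added by letting positive bounds shrink; the dyadic
  argument below meets levels on which the gradient carries no mass.\<close>

corollary weak_Sobolev_measure:
  assumes "DIM('a::euclidean_space) \<ge> 3"
  obtains C where "C > 0" "\<And>(w::'a \<Rightarrow> real) G n t. C1c w G \<Longrightarrow> n \<ge> 0 \<Longrightarrow> t > 0 \<Longrightarrow>
      (\<integral>\<^sup>+x. ennreal ((norm (G x))\<^sup>2) \<partial>lborel) \<le> ennreal n \<Longrightarrow>
      emeasure lborel {x. \<bar>w x\<bar> \<ge> t} \<le> ennreal (C * (n / t\<^sup>2) powr (real DIM('a) / (real DIM('a) - 2)))"
proof -
  define \<kappa> where "\<kappa> = real DIM('a) / (real DIM('a) - 2)"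
  have \<kappa>: "\<kappa> > 0" using assms by (simp add: \<kappa>_def)
  obtain C where C: "C > 0" and W: "\<And>(w::'a \<Rightarrow> real) G n t. C1c w G \<Longrightarrow> n > 0 \<Longrightarrow> t > 0 \<Longrightarrow>
      (\<integral>\<^sup>+x. ennreal ((norm (G x))\<^sup>2) \<partial>lborel) \<le> ennreal n \<Longrightarrow>
      emeasure lborel {x. \<bar>w x\<bar> \<ge> t} \<le> ennreal (C * (n / t\<^sup>2) powr \<kappa>)"
    using weak_Sobolev[OF assms] unfolding \<kappa>_def by blast
  have "emeasure lborel {x. \<bar>w x\<bar> \<ge> t} \<le> ennreal (C * (n / t\<^sup>2) powr \<kappa>)"
    if w: "C1c w G" and n: "n \<ge> 0" and t: "t > 0"
      and N: "(\<integral>\<^sup>+x. ennreal ((norm (G x))\<^sup>2) \<partial>lborel) \<le> ennreal n"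
    for w :: "'a \<Rightarrow> real" and G n t
  proof (cases "n = 0")
    case True
    have "emeasure lborel {x. \<bar>w x\<bar> \<ge> t} \<le> 0"
    proof (rule ennreal_le_epsilon)
      fix e :: real assume e: "e > 0"
      \<comment> \<open>The value for which the bound of the inequality is exactly
        \<open>e\<close>.\<close>
      let ?n = "t\<^sup>2 * (e / C) powr (1 / \<kappa>)"
      have "?n > 0" using e C t by simp
      then have "emeasure lborel {x. \<bar>w x\<bar> \<ge> t} \<le> ennreal (C * (?n / t\<^sup>2) powr \<kappa>)"
        using N True by (intro W[OF w _ t]) auto
      also have "C * (?n / t\<^sup>2) powr \<kappa> = e" using t e C \<kappa> by (simp add: powr_powr)
      finally show "emeasure lborel {x. \<bar>w x\<bar> \<ge> t} \<le> 0 + ennreal e" by simp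
    qed
    then show ?thesis by simp
  next
    case False
    then show ?thesis using W[OF w _ t N] n by simp
  qed
  then show thesis using C that unfolding \<kappa>_def by blast
qed

section \<open>Truncation by C^1 functions and the strong Sobolev inequality\<close>

lemma C1c_compose:
  assumes w: "C1c w G" and F: "\<And>s. (F has_real_derivative F' s) (at s)"
    and F': "continuous_on UNIV F'" and "F 0 = 0"
  shows "C1c (\<lambda>x. F (w x)) (\<lambda>x. F' (w x) *\<^sub>R G x)"
  unfolding C1c_def
proof (intro conjI allI)
  fix x
  have "(w has_derivative (\<lambda>h. G x \<bullet> h)) (at x)" using w by (simp add: C1c_def)
  from has_derivative_compose[OF this F[unfolded has_field_derivative_def]]
  show "((\<lambda>x. F (w x)) has_derivative (\<lambda>h. (F' (w x) *\<^sub>R G x) \<bullet> h)) (at x)" by simp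
  show "continuous_on UNIV (\<lambda>x. F' (w x) *\<^sub>R G x)"
    using w C1c_continuous[OF w]
    by (intro continuous_on_scaleR continuous_on_compose2[OF F']) (auto simp: C1c_def)
  show "\<exists>\<rho>. \<forall>x. norm x > \<rho> \<longrightarrow> F (w x) = 0"
    using w assms(4) unfolding C1c_def by metis
qed

lemma test_fun_C1c:
  assumes "test_fun U \<phi>" shows "C1c \<phi> (grad \<phi>)"
  unfolding C1c_def
proof (intro conjI allI)
  have "bounded {x. \<phi> x \<noteq> 0}"
    using assms unfolding test_fun_def by (meson bounded_subset closure_subset compact_imp_bounded)
  then obtain \<rho> where "\<And>x. \<phi> x \<noteq> 0 \<Longrightarrow> norm x \<le> \<rho>" by (auto simp: bounded_iff)
  then show "\<exists>\<rho>. \<forall>x. norm x > \<rho> \<longrightarrow> \<phi> x = 0" by (meson leD)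
qed (use assms in \<open>auto intro: test_fun_has_derivative test_fun_continuous_grad\<close>)

lemma C1c_bounded:
  assumes "C1c w (G :: 'a::euclidean_space \<Rightarrow> 'a)"
  obtains B where "B > 0" "\<And>x. \<bar>w x\<bar> \<le> B"
proof -
  obtain \<rho> where \<rho>: "\<And>x. norm x > \<rho> \<Longrightarrow> w x = 0" using assms by (auto simp: C1c_def)
  have "compact (w ` cball 0 \<rho>)"
    using C1c_continuous[OF assms] continuous_on_subset by (intro compact_continuous_image) auto
  then obtain B where B: "\<And>x. x \<in> cball 0 \<rho> \<Longrightarrow> \<bar>w x\<bar> \<le> B"
    using bounded_iff[of "w ` cball 0 \<rho>"] compact_imp_bounded by (metis image_eqI real_norm_def)
  have "\<bar>w x\<bar> \<le> max B 1" for x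
    using B[of x] \<rho>[of x] by (cases "norm x > \<rho>") auto
  then show thesis using that[of "max B 1"] by simp
qed

lemma DERIV_pos_part_square:
  "((\<lambda>x::real. (max 0 x)\<^sup>2) has_real_derivative 2 * max 0 x) (at x)"
proof -
  consider "x > 0" | "x < 0" | "x = 0" by linarith
  then show ?thesis
  proof cases
    case 1
    have "((\<lambda>x::real. x\<^sup>2) has_real_derivative 2 * max 0 x) (at x)"
      using 1 by (auto intro!: derivative_eq_intros)
    then show ?thesis
      by (rule has_field_derivative_transform_within_open[of _ _ _ "{0<..}"]) (use 1 in auto)
  next
    case 2
    have "((\<lambda>x::real. 0) has_real_derivative 2 * max 0 x) (at x)" using 2 by simp
    then show ?thesis
      by (rule has_field_derivative_transform_within_open[of _ _ _ "{..<0}"]) (use 2 in auto)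
  next
    case 3
    have "((\<lambda>h::real. max 0 h) \<longlongrightarrow> max 0 0) (at 0)" by (intro tendsto_intros)
    then have lim: "((\<lambda>h::real. max 0 h) \<longlongrightarrow> 0) (at 0)" by simp
    have "((\<lambda>h::real. (max 0 h)\<^sup>2 / h) \<longlongrightarrow> 0) (at 0)"
      by (rule Lim_transform_eventually[OF lim])
        (auto simp: eventually_at_filter power2_eq_square max_def intro!: always_eventually)
    then show ?thesis using 3 by (simp add: DERIV_def)
  qed
qed

text \<open>The primitive of the tent of height 2 over the unit interval, written as a second
  difference of squared positive parts: a C^1 transition from 0 to 1.\<close>

definition smoothstep :: "real \<Rightarrow> real" where
  "smoothstep x = 2 * ((max 0 x)\<^sup>2 - 2 * (max 0 (x - 1/2))\<^sup>2 + (max 0 (x - 1))\<^sup>2)"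

definition smoothstep' :: "real \<Rightarrow> real" where
  "smoothstep' x = 4 * (max 0 x - 2 * max 0 (x - 1/2) + max 0 (x - 1))"

lemma DERIV_smoothstep: "(smoothstep has_real_derivative smoothstep' x) (at x)"
proof -
  have shift: "((\<lambda>x::real. (max 0 (x - c))\<^sup>2) has_real_derivative 2 * max 0 (x - c)) (at x)" for c
    using DERIV_pos_part_square[of "x - c"] DERIV_shift[of "\<lambda>x. (max 0 x)\<^sup>2" _ x "- c"] by simp
  show ?thesis
    unfolding smoothstep_def[abs_def] smoothstep'_def
    by (rule derivative_eq_intros shift DERIV_pos_part_square refl | simp)+
qed

lemma continuous_smoothstep': "continuous_on A smoothstep'"
  unfolding smoothstep'_def[abs_def] by (intro continuous_intros)

lemma smoothstep_eq_0: "x \<le> 0 \<Longrightarrow> smoothstep x = 0"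
  by (simp add: smoothstep_def max_def)

lemma smoothstep_eq_1: "x \<ge> 1 \<Longrightarrow> smoothstep x = 1"
  by (simp add: smoothstep_def max_def power2_eq_square algebra_simps)

lemma smoothstep'_bound: "\<bar>smoothstep' x\<bar> \<le> 2"
  by (simp add: smoothstep'_def max_def abs_if)

lemma smoothstep'_eq_0: "x \<le> 0 \<or> x \<ge> 1 \<Longrightarrow> smoothstep' x = 0"
  by (auto simp: smoothstep'_def max_def)

text \<open>Maz'ya's truncation argument: applying the weak inequality to smooth truncations between
  consecutive dyadic levels of \<^term>\<open>w\<^sup>2\<close> and summing yields the strong inequality.\<close>

theorem Sobolev:
  assumes dim: "DIM('a::euclidean_space) \<ge> 3"
  obtains C where "C > 0" "\<And>(w::'a \<Rightarrow> real) G n. C1c w G \<Longrightarrow> n \<ge> 0 \<Longrightarrow>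
      (\<integral>\<^sup>+x. ennreal ((norm (G x))\<^sup>2) \<partial>lborel) \<le> ennreal n \<Longrightarrow>
      (\<integral>\<^sup>+x. ennreal (\<bar>w x\<bar> powr (2 * real DIM('a) / (real DIM('a) - 2))) \<partial>lborel)
        \<le> ennreal (C * n powr (real DIM('a) / (real DIM('a) - 2)))"
proof -
  define \<kappa> where "\<kappa> = real DIM('a) / (real DIM('a) - 2)"
  have \<kappa>: "\<kappa> > 1" using dim by (simp add: \<kappa>_def)
  have \<kappa>2: "2 * real DIM('a) / (real DIM('a) - 2) = 2 * \<kappa>" by (simp add: \<kappa>_def)
  obtain C where C: "C > 0" and W: "\<And>(w::'a \<Rightarrow> real) G n t. C1c w G \<Longrightarrow> n \<ge> 0 \<Longrightarrow> t > 0 \<Longrightarrow>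
      (\<integral>\<^sup>+x. ennreal ((norm (G x))\<^sup>2) \<partial>lborel) \<le> ennreal n \<Longrightarrow>
      emeasure lborel {x. \<bar>w x\<bar> \<ge> t} \<le> ennreal (C * (n / t\<^sup>2) powr \<kappa>)"
    using weak_Sobolev_measure[OF dim] unfolding \<kappa>_def by metis
  have "(\<integral>\<^sup>+x. ennreal (\<bar>w x\<bar> powr (2 * \<kappa>)) \<partial>lborel) \<le> ennreal (C * 128 powr \<kappa> * n powr \<kappa>)"
    if w: "C1c w G" and n: "n \<ge> 0" and N: "(\<integral>\<^sup>+x. ennreal ((norm (G x))\<^sup>2) \<partial>lborel) \<le> ennreal n"
    for w :: "'a \<Rightarrow> real" and G n
  proof -
    note [measurable] = C1c_measurable[OF w]
    obtain B where B: "B > 0" "\<And>x. \<bar>w x\<bar> \<le> B" using C1c_bounded[OF w] by blast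
    \<comment> \<open>A strict upper bound of \<open>w^2\<close>, so that the dyadic levels descend
      from a top level and are indexed by natural numbers.\<close>
    define \<Lambda> where "\<Lambda> = B\<^sup>2 + 1"
    have \<Lambda>: "\<Lambda> > 0" by (simp add: \<Lambda>_def add_nonneg_pos)
    have w_less: "(w x)\<^sup>2 < \<Lambda>" for x
      using power_mono[OF B(2)[of x], of 2] by (simp add: \<Lambda>_def)
    define l where "l j = \<Lambda> / 4 / 2 ^ j" for j :: nat
    have l: "l j > 0" for j using \<Lambda> by (simp add: l_def)
    \<comment> \<open>The truncation at level \<open>j\<close> has its gradient on
      \<open>E j\<close> and equals 1 on \<open>F j\<close>. The sets \<open>E j\<close> are
      disjoint, so their shares \<open>a j\<close> of the Dirichlet integral sum to at most
      \<open>n\<close>, while the sets \<open>F j\<close> cover the points where \<open>w\<close> is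
      nonzero.\<close>
    define E where "E j = {x. l j < (w x)\<^sup>2 \<and> (w x)\<^sup>2 < 2 * l j}" for j
    define F where "F j = {x. 2 * l j \<le> (w x)\<^sup>2 \<and> (w x)\<^sup>2 < 4 * l j}" for j
    have [measurable]: "E j \<in> sets borel" "F j \<in> sets borel" for j unfolding E_def F_def by measurable
    define a where "a j = enn2real (\<integral>\<^sup>+x. ennreal ((norm (G x))\<^sup>2) * indicator (E j) x \<partial>lborel)" for j
    have le_n: "(\<integral>\<^sup>+x. ennreal ((norm (G x))\<^sup>2) * indicator (E j) x \<partial>lborel) \<le> ennreal n" for j
      by (rule order_trans[OF nn_integral_mono N]) (auto simp: indicator_def)
    have a: "(\<integral>\<^sup>+x. ennreal ((norm (G x))\<^sup>2) * indicator (E j) x \<partial>lborel) = ennreal (a j)" for j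
      unfolding a_def using le_n[of j] by (intro ennreal_enn2real[symmetric]) (simp add: order_le_less_trans)
    have a0: "a j \<ge> 0" for j by (simp add: a_def)
    have an: "a j \<le> n" for j using le_n[of j] n unfolding a by simp
    have level: "emeasure lborel (F j) \<le> ennreal (C * (32 * a j / l j) powr \<kappa>)" for j
    proof -
      \<comment> \<open>Levels of \<open>s^2\<close> treat both signs of \<open>w\<close> at once
        and avoid the kink of the absolute value. On \<open>E j\<close> the squared derivative is at
        most \<open>2^2 * 4 s^2 / l^2 \<le> 32 / l\<close>, as \<open>s^2 < 2 l\<close>
        there.\<close>
      let ?S = "\<lambda>s. smoothstep (s\<^sup>2 / l j - 1)" and ?S' = "\<lambda>s. smoothstep' (s\<^sup>2 / l j - 1) * (2 * s / l j)"
      have S: "(?S has_real_derivative ?S' s) (at s)" for s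
      proof -
        have "((\<lambda>s. s\<^sup>2 / l j - 1) has_real_derivative (2 * s / l j)) (at s)"
          using l[of j] by (auto intro!: derivative_eq_intros)
        from DERIV_chain2[OF DERIV_smoothstep this] show ?thesis .
      qed
      have cS: "continuous_on UNIV ?S'"
        using l[of j] by (intro continuous_intros continuous_on_compose2[OF continuous_smoothstep']) auto
      have wS: "C1c (\<lambda>x. ?S (w x)) (\<lambda>x. ?S' (w x) *\<^sub>R G x)"
        using S cS by (intro C1c_compose[OF w]) (auto simp: smoothstep_eq_0)
      have "(\<integral>\<^sup>+x. ennreal ((norm (?S' (w x) *\<^sub>R G x))\<^sup>2) \<partial>lborel)
         \<le> (\<integral>\<^sup>+x. ennreal (32 / l j) * (ennreal ((norm (G x))\<^sup>2) * indicator (E j) x) \<partial>lborel)"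
      proof (rule nn_integral_mono)
        fix x
        show "ennreal ((norm (?S' (w x) *\<^sub>R G x))\<^sup>2) \<le> ennreal (32 / l j) * (ennreal ((norm (G x))\<^sup>2) * indicator (E j) x)"
        proof (cases "x \<in> E j")
          case True
          have "(smoothstep' ((w x)\<^sup>2 / l j - 1))\<^sup>2 \<le> 2\<^sup>2"
            using smoothstep'_bound by (intro abs_le_square_iff[THEN iffD1]) simp
          moreover have "(2 * w x / l j)\<^sup>2 \<le> 8 / l j"
            using True l[of j] by (simp add: E_def power2_eq_square field_simps)
          ultimately have "(?S' (w x))\<^sup>2 \<le> 2\<^sup>2 * (8 / l j)"
            unfolding power_mult_distrib[of "smoothstep' _"] using l[of j] by (intro mult_mono) auto
          then have "(?S' (w x))\<^sup>2 * (norm (G x))\<^sup>2 \<le> 32 / l j * (norm (G x))\<^sup>2"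
            by (intro mult_right_mono) auto
          then have "(norm (?S' (w x) *\<^sub>R G x))\<^sup>2 \<le> 32 / l j * (norm (G x))\<^sup>2"
            by (simp only: norm_scaleR power_mult_distrib power2_abs)
          then show ?thesis using True l[of j] by (simp add: ennreal_mult[symmetric] ennreal_leI)
        next
          case False
          then have "(w x)\<^sup>2 / l j - 1 \<le> 0 \<or> (w x)\<^sup>2 / l j - 1 \<ge> 1"
            using l[of j] by (auto simp: E_def field_simps)
          then show ?thesis by (simp add: smoothstep'_eq_0)
        qed
      qed
      also have "\<dots> = ennreal (32 / l j) * ennreal (a j)"
        by (subst nn_integral_cmult) (auto simp: a)
      also have "\<dots> = ennreal (32 * a j / l j)" using l[of j] a0[of j] by (simp add: ennreal_mult[symmetric])
      finally have 1: "emeasure lborel {x. \<bar>?S (w x)\<bar> \<ge> 1} \<le> ennreal (C * (32 * a j / l j / 1\<^sup>2) powr \<kappa>)"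
        using a0[of j] l[of j] by (intro W[OF wS]) auto
      have 2: "F j \<subseteq> {x. \<bar>?S (w x)\<bar> \<ge> 1}"
        using l[of j] by (auto simp: F_def smoothstep_eq_1 field_simps)
      have 3: "{x. \<bar>?S (w x)\<bar> \<ge> 1} \<in> sets lborel"
        using C1c_measurable(1)[OF wS] by measurable
      show ?thesis using order_trans[OF emeasure_mono[OF 2 3] 1] by simp
    qed
    have piece: "(\<integral>\<^sup>+x. ennreal (\<bar>w x\<bar> powr (2 * \<kappa>)) * indicator (F j) x \<partial>lborel)
       \<le> ennreal (C * 128 powr \<kappa> * n powr (\<kappa> - 1)) * ennreal (a j)" for j
    proof -
      have "(\<integral>\<^sup>+x. ennreal (\<bar>w x\<bar> powr (2 * \<kappa>)) * indicator (F j) x \<partial>lborel)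
         \<le> (\<integral>\<^sup>+x. ennreal ((4 * l j) powr \<kappa>) * indicator (F j) x \<partial>lborel)"
      proof (rule nn_integral_mono)
        fix x
        have "\<bar>w x\<bar> powr (2 * \<kappa>) \<le> (4 * l j) powr \<kappa>" if "x \<in> F j"
        proof -
          have "\<bar>w x\<bar> powr (2 * \<kappa>) = ((w x)\<^sup>2) powr \<kappa>"
            by (simp add: powr_powr[symmetric] powr_numeral)
          also have "\<dots> \<le> (4 * l j) powr \<kappa>"
            using that \<kappa> by (intro powr_mono2) (auto simp: F_def)
          finally show ?thesis .
        qed
        then show "ennreal (\<bar>w x\<bar> powr (2 * \<kappa>)) * indicator (F j) x \<le> ennreal ((4 * l j) powr \<kappa>) * indicator (F j) x"
          by (auto simp: indicator_def intro!: ennreal_leI)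
      qed
      also have "\<dots> = ennreal ((4 * l j) powr \<kappa>) * emeasure lborel (F j)"
        by (rule nn_integral_cmult_indicator) simp
      also have "\<dots> \<le> ennreal ((4 * l j) powr \<kappa>) * ennreal (C * (32 * a j / l j) powr \<kappa>)"
        by (intro mult_left_mono level) simp
      also have "\<dots> = ennreal (C * 128 powr \<kappa> * a j powr \<kappa>)"
      proof -
        have "(4 * l j) powr \<kappa> * (32 * a j / l j) powr \<kappa> = (128 * a j) powr \<kappa>"
          using l[of j] a0[of j] by (simp add: powr_mult[symmetric])
        also have "\<dots> = 128 powr \<kappa> * a j powr \<kappa>" using a0[of j] by (simp add: powr_mult)
        finally have "(4 * l j) powr \<kappa> * (C * (32 * a j / l j) powr \<kappa>) = C * 128 powr \<kappa> * a j powr \<kappa>"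
          by (simp add: mult_ac)
        then show ?thesis using C by (simp add: ennreal_mult[symmetric])
      qed
      also have "\<dots> \<le> ennreal (C * 128 powr \<kappa> * n powr (\<kappa> - 1) * a j)"
      proof -
        \<comment> \<open>Since \<open>\<kappa> > 1\<close>, all but one power of \<open>a j\<close>
          is estimated by \<open>n\<close>; the remaining bound is linear in \<open>a j\<close> and
          can be summed over \<open>j\<close>.\<close>
        have "a j powr \<kappa> \<le> n powr (\<kappa> - 1) * a j"
        proof (cases "a j = 0")
          case False
          then have p: "a j > 0" using a0[of j] by simp
          have "a j powr \<kappa> = a j powr (\<kappa> - 1) * a j powr 1" by (simp only: powr_add[symmetric]) simp
          also have "\<dots> \<le> n powr (\<kappa> - 1) * a j"
            using p an[of j] \<kappa> by (auto intro!: mult_right_mono powr_mono2)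
          finally show ?thesis .
        qed (use \<kappa> in simp)
        then have "(C * 128 powr \<kappa>) * a j powr \<kappa> \<le> (C * 128 powr \<kappa>) * (n powr (\<kappa> - 1) * a j)"
          using C by (intro mult_left_mono) auto
        then show ?thesis by (intro ennreal_leI) (simp add: mult.assoc)
      qed
      also have "\<dots> = ennreal (C * 128 powr \<kappa> * n powr (\<kappa> - 1)) * ennreal (a j)"
        using C a0[of j] by (intro ennreal_mult) auto
      finally show ?thesis .
    qed
    have cover: "\<exists>j. x \<in> F j" if "w x \<noteq> 0" for x
    proof -
      let ?P = "\<lambda>j::nat. \<Lambda> / 2 ^ Suc j \<le> (w x)\<^sup>2"
      have pos: "(w x)\<^sup>2 > 0" using that by simp
      obtain j where "(1/2::real) ^ j < (w x)\<^sup>2 / \<Lambda>"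
        using real_arch_pow_inv[of "(w x)\<^sup>2 / \<Lambda>" "1/2"] pos \<Lambda> by auto
      then have "\<Lambda> / 2 ^ j < (w x)\<^sup>2" using \<Lambda> by (simp add: field_simps power_divide)
      moreover have "\<Lambda> / 2 ^ Suc j \<le> \<Lambda> / 2 ^ j" using \<Lambda> by (simp add: field_simps)
      ultimately have "?P j" by linarith
      \<comment> \<open>Minimality gives the upper bound \<open>\<Lambda> / 2^k\<close>; for
        \<open>k = 0\<close> it is the strict bound of \<open>w^2\<close> by
        \<open>\<Lambda>\<close> instead.\<close>
      define k where "k = (LEAST j. ?P j)"
      have Pk: "?P k" unfolding k_def by (rule LeastI[of ?P, OF \<open>?P j\<close>])
      have "(w x)\<^sup>2 < \<Lambda> / 2 ^ k"
      proof (cases k)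
        case 0
        then show ?thesis using w_less[of x] by simp
      next
        case (Suc i)
        then have "\<not> ?P i" unfolding k_def by (metis (no_types, lifting) lessI not_less_Least)
        then show ?thesis using Suc by simp
      qed
      then have "x \<in> F k" using Pk by (simp add: F_def l_def field_simps)
      then show ?thesis ..
    qed
    have disj: "disjoint_family E"
      unfolding disjoint_family_on_def
    proof (intro ballI impI)
      have "E i \<inter> E j = {}" if "i < j" for i j
      proof -
        have "(2::real) ^ Suc i \<le> 2 ^ j" using that by (intro power_increasing) auto
        then have "2 * l j \<le> l i" using \<Lambda> by (simp add: l_def field_simps)
        then show ?thesis by (auto simp: E_def)
      qed
      then show "E i \<inter> E j = {}" if "i \<noteq> j" for i j using that by (metis inf_commute linorder_neqE_nat)
    qed
    have "(\<integral>\<^sup>+x. ennreal (\<bar>w x\<bar> powr (2 * \<kappa>)) \<partial>lborel)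
       \<le> (\<integral>\<^sup>+x. (\<Sum>j. ennreal (\<bar>w x\<bar> powr (2 * \<kappa>)) * indicator (F j) x) \<partial>lborel)"
    proof (rule nn_integral_mono)
      fix x
      let ?f = "\<lambda>j. ennreal (\<bar>w x\<bar> powr (2 * \<kappa>)) * indicator (F j) x"
      show "ennreal (\<bar>w x\<bar> powr (2 * \<kappa>)) \<le> suminf ?f"
      proof (cases "w x = 0")
        case False
        then obtain j where "x \<in> F j" using cover by blast
        then have "ennreal (\<bar>w x\<bar> powr (2 * \<kappa>)) = sum ?f {j}" by simp
        also have "\<dots> \<le> suminf ?f" by (intro sum_le_suminf) auto
        finally show ?thesis .
      qed simp
    qed
    also have "\<dots> = (\<Sum>j. \<integral>\<^sup>+x. ennreal (\<bar>w x\<bar> powr (2 * \<kappa>)) * indicator (F j) x \<partial>lborel)"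
      by (rule nn_integral_suminf) measurable
    also have "\<dots> \<le> (\<Sum>j. ennreal (C * 128 powr \<kappa> * n powr (\<kappa> - 1)) * ennreal (a j))"
      by (intro suminf_le piece) auto
    also have "\<dots> = ennreal (C * 128 powr \<kappa> * n powr (\<kappa> - 1)) * (\<Sum>j. ennreal (a j))"
      by (rule ennreal_suminf_cmult)
    also have "(\<Sum>j. ennreal (a j)) = (\<integral>\<^sup>+x. (\<Sum>j. ennreal ((norm (G x))\<^sup>2) * indicator (E j) x) \<partial>lborel)"
      unfolding a[symmetric] by (rule nn_integral_suminf[symmetric]) measurable
    also have "\<dots> \<le> (\<integral>\<^sup>+x. ennreal ((norm (G x))\<^sup>2) \<partial>lborel)"
      unfolding ennreal_suminf_cmult suminf_indicator[OF disj]
      by (intro nn_integral_mono) (auto simp: indicator_def)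
    also note N
    finally have "(\<integral>\<^sup>+x. ennreal (\<bar>w x\<bar> powr (2 * \<kappa>)) \<partial>lborel)
       \<le> ennreal (C * 128 powr \<kappa> * n powr (\<kappa> - 1)) * ennreal n" by (simp add: mult_left_mono)
    also have "\<dots> = ennreal (C * 128 powr \<kappa> * (n powr (\<kappa> - 1) * n))"
      using C n by (simp add: ennreal_mult[symmetric] mult.assoc)
    also have "n powr (\<kappa> - 1) * n = n powr \<kappa>"
      using n by (cases "n = 0") (simp_all add: powr_mult_base powr_diff)
    finally show ?thesis .
  qed
  moreover have "C * 128 powr \<kappa> > 0" using C by simp
  ultimately show thesis using that[of "C * 128 powr \<kappa>"] unfolding \<kappa>2 \<kappa>_def by blast
qed

section \<open>Square-integrable functions\<close>

text \<open>Values in an arbitrary Euclidean space let the same lemmas serve functions, gradients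
  and the triples that combine a function with its gradient and its weighted value.\<close>

definition L2 :: "'a measure \<Rightarrow> ('a \<Rightarrow> 'b::euclidean_space) \<Rightarrow> bool" where
  "L2 M f \<longleftrightarrow> f \<in> borel_measurable M \<and> integrable M (\<lambda>x. (norm (f x))\<^sup>2)"

lemma L2_norm_mult_integrable:
  fixes f :: "'a \<Rightarrow> 'b::euclidean_space" and g :: "'a \<Rightarrow> 'c::euclidean_space"
  assumes f: "L2 M f" and g: "L2 M g"
  shows "integrable M (\<lambda>x. norm (f x) * norm (g x))"
proof (rule Bochner_Integration.integrable_bound)
  show "integrable M (\<lambda>x. (norm (f x))\<^sup>2 + (norm (g x))\<^sup>2)" using f g by (simp add: L2_def)
  have [measurable]: "f \<in> borel_measurable M" "g \<in> borel_measurable M" using f g by (auto simp: L2_def)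
  show "(\<lambda>x. norm (f x) * norm (g x)) \<in> borel_measurable M" by measurable
  have "a * b \<le> a\<^sup>2 + b\<^sup>2" if "a \<ge> 0" "b \<ge> 0" for a b :: real
    using sum_squares_bound[of a b] mult_nonneg_nonneg[OF that] by linarith
  then show "AE x in M. norm (norm (f x) * norm (g x)) \<le> norm ((norm (f x))\<^sup>2 + (norm (g x))\<^sup>2)"
    by simp
qed

lemma L2_inner_integrable:
  assumes f: "L2 M f" and g: "L2 M g"
  shows "integrable M (\<lambda>x. f x \<bullet> g x)"
proof (rule Bochner_Integration.integrable_bound[OF L2_norm_mult_integrable[OF f g]])
  have [measurable]: "f \<in> borel_measurable M" "g \<in> borel_measurable M" using f g by (auto simp: L2_def)
  show "(\<lambda>x. f x \<bullet> g x) \<in> borel_measurable M" by measurable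
qed (simp add: Cauchy_Schwarz_ineq2)

lemma L2_bound:
  assumes f: "L2 M f" and g: "g \<in> borel_measurable M" and le: "AE x in M. norm (g x) \<le> K * norm (f x)"
  shows "L2 M g"
  unfolding L2_def
proof
  note [measurable] = g
  show "integrable M (\<lambda>x. (norm (g x))\<^sup>2)"
  proof (rule Bochner_Integration.integrable_bound)
    show "integrable M (\<lambda>x. K\<^sup>2 * (norm (f x))\<^sup>2)" using f by (simp add: L2_def)
    show "AE x in M. norm ((norm (g x))\<^sup>2) \<le> norm (K\<^sup>2 * (norm (f x))\<^sup>2)"
      using le
    proof eventually_elim
      case (elim x)
      have "(norm (g x))\<^sup>2 \<le> (K * norm (f x))\<^sup>2" using elim by (intro power_mono) auto
      then show ?case by (simp add: power_mult_distrib)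
    qed
  qed measurable
qed (rule g)

lemma L2_add:
  assumes f: "L2 M f" and g: "L2 M g"
  shows "L2 M (\<lambda>x. f x + g x)"
  unfolding L2_def
proof
  have [measurable]: "f \<in> borel_measurable M" "g \<in> borel_measurable M" using f g by (auto simp: L2_def)
  show "(\<lambda>x. f x + g x) \<in> borel_measurable M" by measurable
  show "integrable M (\<lambda>x. (norm (f x + g x))\<^sup>2)"
  proof (rule Bochner_Integration.integrable_bound)
    show "integrable M (\<lambda>x. 2 * (norm (f x))\<^sup>2 + 2 * (norm (g x))\<^sup>2)" using f g by (simp add: L2_def)
    have "(norm (a + b))\<^sup>2 \<le> 2 * (norm a)\<^sup>2 + 2 * (norm b)\<^sup>2" for a b :: 'b
    proof -
      have "(norm (a + b))\<^sup>2 \<le> (norm a + norm b)\<^sup>2" by (intro power_mono norm_triangle_ineq) auto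
      also have "\<dots> \<le> 2 * (norm a)\<^sup>2 + 2 * (norm b)\<^sup>2"
        using sum_squares_bound[of "norm a" "norm b"] by (simp add: power2_sum)
      finally show ?thesis .
    qed
    then show "AE x in M. norm ((norm (f x + g x))\<^sup>2) \<le> norm (2 * (norm (f x))\<^sup>2 + 2 * (norm (g x))\<^sup>2)"
      by simp
  qed measurable
qed

lemma L2_scaleR: "L2 M f \<Longrightarrow> L2 M (\<lambda>x. c *\<^sub>R f x)"
  by (rule L2_bound[where f = f and K = "\<bar>c\<bar>"]) (auto simp: L2_def)

lemma L2_diff: "L2 M f \<Longrightarrow> L2 M g \<Longrightarrow> L2 M (\<lambda>x. f x - g x)"
  using L2_add[of M f "\<lambda>x. (-1) *\<^sub>R g x"] L2_scaleR[of M g "-1"] by simp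

lemma L2_Cauchy_Schwarz:
  fixes f :: "'a \<Rightarrow> 'b::euclidean_space" and g :: "'a \<Rightarrow> 'c::euclidean_space"
  assumes f: "L2 M f" and g: "L2 M g"
  shows "(\<integral>x. norm (f x) * norm (g x) \<partial>M)\<^sup>2 \<le> (\<integral>x. (norm (f x))\<^sup>2 \<partial>M) * (\<integral>x. (norm (g x))\<^sup>2 \<partial>M)"
proof -
  have [measurable]: "f \<in> borel_measurable M" "g \<in> borel_measurable M" using f g by (auto simp: L2_def)
  have "(\<integral>\<^sup>+x. ennreal (norm (f x)) * ennreal (norm (g x)) \<partial>M)\<^sup>2
     \<le> (\<integral>\<^sup>+x. (ennreal (norm (f x)))\<^sup>2 \<partial>M) * (\<integral>\<^sup>+x. (ennreal (norm (g x)))\<^sup>2 \<partial>M)"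
    by (rule Cauchy_Schwarz_nn_integral) measurable
  moreover have "(\<integral>\<^sup>+x. ennreal (norm (f x)) * ennreal (norm (g x)) \<partial>M) = ennreal (\<integral>x. norm (f x) * norm (g x) \<partial>M)"
    unfolding ennreal_mult[OF norm_ge_zero norm_ge_zero, symmetric]
    by (rule nn_integral_eq_integral[OF L2_norm_mult_integrable[OF f g]]) simp
  moreover have "(\<integral>\<^sup>+x. (ennreal (norm (f x)))\<^sup>2 \<partial>M) = ennreal (\<integral>x. (norm (f x))\<^sup>2 \<partial>M)"
    using f by (simp add: ennreal_power nn_integral_eq_integral L2_def)
  moreover have "(\<integral>\<^sup>+x. (ennreal (norm (g x)))\<^sup>2 \<partial>M) = ennreal (\<integral>x. (norm (g x))\<^sup>2 \<partial>M)"
    using g by (simp add: ennreal_power nn_integral_eq_integral L2_def)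
  ultimately show ?thesis by (simp add: ennreal_power ennreal_mult[symmetric] ennreal_le_iff)
qed

lemma L2_inner_Cauchy_Schwarz:
  fixes f g :: "'a \<Rightarrow> 'b::euclidean_space"
  assumes f: "L2 M f" and g: "L2 M g"
  shows "(\<integral>x. f x \<bullet> g x \<partial>M)\<^sup>2 \<le> (\<integral>x. (norm (f x))\<^sup>2 \<partial>M) * (\<integral>x. (norm (g x))\<^sup>2 \<partial>M)"
proof -
  have "\<bar>\<integral>x. f x \<bullet> g x \<partial>M\<bar> \<le> (\<integral>x. \<bar>f x \<bullet> g x\<bar> \<partial>M)" by (rule integral_abs_bound)
  also have "\<dots> \<le> (\<integral>x. norm (f x) * norm (g x) \<partial>M)"
    using L2_inner_integrable[OF f g] L2_norm_mult_integrable[OF f g]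
    by (intro integral_mono) (auto simp: Cauchy_Schwarz_ineq2)
  finally have "\<bar>\<integral>x. f x \<bullet> g x \<partial>M\<bar>\<^sup>2 \<le> (\<integral>x. norm (f x) * norm (g x) \<partial>M)\<^sup>2"
    by (intro power_mono) auto
  with L2_Cauchy_Schwarz[OF f g] show ?thesis by simp
qed

lemma L2_tendsto_norm_mult:
  fixes f :: "nat \<Rightarrow> 'a \<Rightarrow> 'b::euclidean_space" and g :: "'a \<Rightarrow> 'c::euclidean_space"
  assumes f: "\<And>k. L2 M (f k)" and lim: "(\<lambda>k. \<integral>x. (norm (f k x))\<^sup>2 \<partial>M) \<longlonglongrightarrow> 0" and g: "L2 M g"
  shows "(\<lambda>k. \<integral>x. norm (f k x) * norm (g x) \<partial>M) \<longlonglongrightarrow> 0"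
proof -
  have "(\<lambda>k. (\<integral>x. norm (f k x) * norm (g x) \<partial>M)\<^sup>2) \<longlonglongrightarrow> 0"
  proof (rule Lim_null_comparison)
    show "(\<lambda>k. (\<integral>x. (norm (f k x))\<^sup>2 \<partial>M) * (\<integral>x. (norm (g x))\<^sup>2 \<partial>M)) \<longlonglongrightarrow> 0"
      using tendsto_mult_left_zero[OF lim] .
  qed (simp add: L2_Cauchy_Schwarz[OF f g])
  then show ?thesis by (simp add: power_tendsto_0_iff)
qed

lemma L2_tendsto_inner:
  fixes f :: "nat \<Rightarrow> 'a \<Rightarrow> 'b::euclidean_space"
  assumes f: "\<And>k. L2 M (f k)" and h: "L2 M h"
    and lim: "(\<lambda>k. \<integral>x. (norm (f k x - h x))\<^sup>2 \<partial>M) \<longlonglongrightarrow> 0" and g: "L2 M g"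
  shows "(\<lambda>k. \<integral>x. f k x \<bullet> g x \<partial>M) \<longlonglongrightarrow> (\<integral>x. h x \<bullet> g x \<partial>M)"
proof -
  have fh: "L2 M (\<lambda>x. f k x - h x)" for k by (intro L2_diff f h)
  have "(\<lambda>k. (\<integral>x. f k x \<bullet> g x \<partial>M) - (\<integral>x. h x \<bullet> g x \<partial>M)) \<longlonglongrightarrow> 0"
  proof (rule Lim_null_comparison[OF _ L2_tendsto_norm_mult[OF fh lim g]], intro always_eventually allI)
    fix k
    have "(\<integral>x. f k x \<bullet> g x \<partial>M) - (\<integral>x. h x \<bullet> g x \<partial>M) = (\<integral>x. (f k x - h x) \<bullet> g x \<partial>M)"
      by (simp add: inner_diff_left L2_inner_integrable[OF f g] L2_inner_integrable[OF h g])
    also have "norm \<dots> \<le> (\<integral>x. \<bar>(f k x - h x) \<bullet> g x\<bar> \<partial>M)" using integral_abs_bound by simp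
    also have "\<dots> \<le> (\<integral>x. norm (f k x - h x) * norm (g x) \<partial>M)"
      using L2_inner_integrable[OF fh g] L2_norm_mult_integrable[OF fh g]
      by (intro integral_mono) (auto simp: Cauchy_Schwarz_ineq2)
    finally show "norm ((\<integral>x. f k x \<bullet> g x \<partial>M) - (\<integral>x. h x \<bullet> g x \<partial>M)) \<le> (\<integral>x. norm (f k x - h x) * norm (g x) \<partial>M)" .
  qed
  then show ?thesis by (simp add: LIM_zero_iff)
qed

lemma L2_AE_subseq:
  fixes f :: "nat \<Rightarrow> 'a \<Rightarrow> 'b::euclidean_space"
  assumes f: "\<And>k. L2 M (f k)" and h: "L2 M h"
    and lim: "(\<lambda>k. \<integral>x. (norm (f k x - h x))\<^sup>2 \<partial>M) \<longlonglongrightarrow> 0"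
  obtains r :: "nat \<Rightarrow> nat" where "strict_mono r" "AE x in M. (\<lambda>k. f (r k) x) \<longlonglongrightarrow> h x"
proof -
  have "integrable M (\<lambda>x. (norm (f k x - h x))\<^sup>2)" for k using L2_diff[OF f h] by (simp add: L2_def)
  from tendsto_L1_AE_subseq[of M "\<lambda>k x. (norm (f k x - h x))\<^sup>2", OF this] lim obtain r :: "nat \<Rightarrow> nat"
    where r: "strict_mono r" "AE x in M. (\<lambda>k. norm (f (r k) x - h x)) \<longlonglongrightarrow> 0" by auto
  have "AE x in M. (\<lambda>k. f (r k) x) \<longlonglongrightarrow> h x"
    using r(2) by eventually_elim (simp add: tendsto_norm_zero_iff LIM_zero_iff)
  with r(1) show thesis using that by blast
qed

text \<open>On a finite measure space an \<open>L^2\<close> Cauchy sequence is Cauchy in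
  \<open>L^1\<close> and so has an almost everywhere convergent subsequence; Fatou's lemma shows
  that its limit is the \<open>L^2\<close> limit of the whole sequence.\<close>

lemma L2_complete:
  fixes f :: "nat \<Rightarrow> 'a \<Rightarrow> 'b::euclidean_space"
  assumes "finite_measure M" and f: "\<And>k. L2 M (f k)"
    and cau: "\<And>e. e > 0 \<Longrightarrow> \<exists>N. \<forall>i\<ge>N. \<forall>j\<ge>N. (\<integral>x. (norm (f i x - f j x))\<^sup>2 \<partial>M) < e"
  obtains h where "L2 M h" "(\<lambda>k. \<integral>x. (norm (f k x - h x))\<^sup>2 \<partial>M) \<longlonglongrightarrow> 0"
proof -
  interpret finite_measure M by fact
  have one: "L2 M (\<lambda>x. 1::real)" by (simp add: L2_def)
  have [measurable]: "f k \<in> borel_measurable M" for k using f by (auto simp: L2_def)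
  have ff: "L2 M (\<lambda>x. f i x - f j x)" for i j by (intro L2_diff f)
  have int: "integrable M (f k)" for k
    using L2_norm_mult_integrable[OF f[of k] one] by (simp add: integrable_norm_iff)
  have "\<exists>N. \<forall>i\<ge>N. \<forall>j\<ge>N. (\<integral>x. norm (f i x - f j x) \<partial>M) < e" if e: "e > 0" for e
  proof -
    \<comment> \<open>The added 1 keeps the divisor positive when the space has measure
      zero.\<close>
    define m where "m = measure M (space M) + 1"
    have m: "m > 0" by (simp add: m_def add_nonneg_pos)
    have "e\<^sup>2 / m > 0" using e m by simp
    then obtain N where N: "\<And>i j. i \<ge> N \<Longrightarrow> j \<ge> N \<Longrightarrow> (\<integral>x. (norm (f i x - f j x))\<^sup>2 \<partial>M) < e\<^sup>2 / m"
      using cau by blast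
    have "(\<integral>x. norm (f i x - f j x) \<partial>M) < e" if "i \<ge> N" "j \<ge> N" for i j
    proof -
      have "(\<integral>x. norm (f i x - f j x) \<partial>M)\<^sup>2 \<le> (\<integral>x. (norm (f i x - f j x))\<^sup>2 \<partial>M) * measure M (space M)"
        using L2_Cauchy_Schwarz[OF ff one, of i j] by simp
      also have "\<dots> \<le> (\<integral>x. (norm (f i x - f j x))\<^sup>2 \<partial>M) * m"
        by (intro mult_left_mono) (auto simp: m_def)
      also have "\<dots> < e\<^sup>2 / m * m" using N[OF that] m by (intro mult_strict_right_mono)
      finally have "(\<integral>x. norm (f i x - f j x) \<partial>M)\<^sup>2 < e\<^sup>2" using m by simp
      then show ?thesis using e by (intro power2_less_imp_less[of _ e]) auto
    qed
    then show ?thesis by blast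
  qed
  then obtain r where r: "strict_mono r" and AEc: "AE x in M. Cauchy (\<lambda>i. f (r i) x)"
    using cauchy_L1_AE_cauchy_subseq[of M f, OF int] by blast
  define h where "h x = lim (\<lambda>i. f (r i) x)" for x
  have [measurable]: "h \<in> borel_measurable M" unfolding h_def[abs_def] by measurable
  have AEl: "AE x in M. (\<lambda>i. f (r i) x) \<longlonglongrightarrow> h x"
    using AEc by eventually_elim (simp add: h_def Cauchy_convergent convergent_LIMSEQ_iff[symmetric])
  \<comment> \<open>The index \<open>k\<close> stays fixed while the other one runs through the
    subsequence. Nonnegative integrals are used because \<open>h\<close> is not yet known to be
    square-integrable.\<close>
  have fatou: "(\<integral>\<^sup>+x. ennreal ((norm (f k x - h x))\<^sup>2) \<partial>M) \<le> ennreal e"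
    if N: "\<And>i j. i \<ge> N \<Longrightarrow> j \<ge> N \<Longrightarrow> (\<integral>x. (norm (f i x - f j x))\<^sup>2 \<partial>M) < e" and k: "k \<ge> N" for k N e
  proof -
    have "(\<integral>\<^sup>+x. ennreal ((norm (f k x - h x))\<^sup>2) \<partial>M)
       = (\<integral>\<^sup>+x. liminf (\<lambda>i. ennreal ((norm (f k x - f (r i) x))\<^sup>2)) \<partial>M)"
    proof (rule nn_integral_cong_AE)
      show "AE x in M. ennreal ((norm (f k x - h x))\<^sup>2) = liminf (\<lambda>i. ennreal ((norm (f k x - f (r i) x))\<^sup>2))"
        using AEl
      proof eventually_elim
        case (elim x)
        have "(\<lambda>i. ennreal ((norm (f k x - f (r i) x))\<^sup>2)) \<longlonglongrightarrow> ennreal ((norm (f k x - h x))\<^sup>2)"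
          using elim by (intro tendsto_intros)
        then show ?case by (rule lim_imp_Liminf[OF sequentially_bot, symmetric])
      qed
    qed
    also have "\<dots> \<le> liminf (\<lambda>i. \<integral>\<^sup>+x. ennreal ((norm (f k x - f (r i) x))\<^sup>2) \<partial>M)"
      by (rule nn_integral_liminf) measurable
    also have "\<dots> \<le> ennreal e"
    proof (rule Liminf_le)
      show "\<forall>\<^sub>F i in sequentially. (\<integral>\<^sup>+x. ennreal ((norm (f k x - f (r i) x))\<^sup>2) \<partial>M) \<le> ennreal e"
        unfolding eventually_sequentially
      proof (intro exI[of _ N] allI impI)
        fix i assume "i \<ge> N"
        then have "r i \<ge> N" using seq_suble[OF r, of i] by linarith
        have "(\<integral>\<^sup>+x. ennreal ((norm (f k x - f (r i) x))\<^sup>2) \<partial>M) = ennreal (\<integral>x. (norm (f k x - f (r i) x))\<^sup>2 \<partial>M)"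
          using ff[of k "r i"] by (intro nn_integral_eq_integral) (auto simp: L2_def)
        also have "\<dots> \<le> ennreal e" using N[OF k \<open>r i \<ge> N\<close>] by (intro ennreal_leI) simp
        finally show "(\<integral>\<^sup>+x. ennreal ((norm (f k x - f (r i) x))\<^sup>2) \<partial>M) \<le> ennreal e" .
      qed
    qed simp
    finally show ?thesis .
  qed
  have L2d: "L2 M (\<lambda>x. f k x - h x) \<and> (\<integral>x. (norm (f k x - h x))\<^sup>2 \<partial>M) \<le> e"
    if N: "\<And>i j. i \<ge> N \<Longrightarrow> j \<ge> N \<Longrightarrow> (\<integral>x. (norm (f i x - f j x))\<^sup>2 \<partial>M) < e" and k: "k \<ge> N" and e: "e > 0" for k N e
  proof -
    have le: "(\<integral>\<^sup>+x. ennreal ((norm (f k x - h x))\<^sup>2) \<partial>M) \<le> ennreal e" by (rule fatou[OF N k])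
    have I: "integrable M (\<lambda>x. (norm (f k x - h x))\<^sup>2)"
      using order_le_less_trans[OF le] by (intro integrableI_bounded) auto
    have "ennreal (\<integral>x. (norm (f k x - h x))\<^sup>2 \<partial>M) \<le> ennreal e"
      using le nn_integral_eq_integral[OF I] by simp
    then have "(\<integral>x. (norm (f k x - h x))\<^sup>2 \<partial>M) \<le> e" using e by (simp add: ennreal_le_iff)
    with I show ?thesis by (simp add: L2_def)
  qed
  obtain N where "\<forall>i\<ge>N. \<forall>j\<ge>N. (\<integral>x. (norm (f i x - f j x))\<^sup>2 \<partial>M) < 1" using cau[of 1] by auto
  then have "L2 M (\<lambda>x. f N x - h x)" using L2d[of N 1 N] by simp
  from L2_diff[OF f[of N] this] have "L2 M h" by simp
  moreover have "(\<lambda>k. \<integral>x. (norm (f k x - h x))\<^sup>2 \<partial>M) \<longlonglongrightarrow> 0"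
  proof (rule LIMSEQ_I)
    fix e :: real assume e: "e > 0"
    then obtain N where N: "\<forall>i\<ge>N. \<forall>j\<ge>N. (\<integral>x. (norm (f i x - f j x))\<^sup>2 \<partial>M) < e / 2" using cau[of "e/2"] by auto
    have "norm ((\<integral>x. (norm (f k x - h x))\<^sup>2 \<partial>M) - 0) < e" if "k \<ge> N" for k
      using L2d[of N "e/2" k] N that e by auto
    then show "\<exists>no. \<forall>n\<ge>no. norm ((\<integral>x. (norm (f n x - h x))\<^sup>2 \<partial>M) - 0) < e" by blast
  qed
  ultimately show thesis using that by blast
qed

text \<open>Young's inequality gives integrability directly, and the norm bound after division of
  both factors by their norms. If a norm vanishes, the product is zero almost everywhere.\<close>

lemma Hoelder_integral:
  fixes f g :: "'a \<Rightarrow> real" and p q :: real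
  assumes pq: "p > 1" "q > 1" "1 / p + 1 / q = 1"
    and [measurable]: "f \<in> borel_measurable M" "g \<in> borel_measurable M"
    and f: "integrable M (\<lambda>x. \<bar>f x\<bar> powr p)" and g: "integrable M (\<lambda>x. \<bar>g x\<bar> powr q)"
  shows "integrable M (\<lambda>x. f x * g x)"
    and "(\<integral>x. \<bar>f x * g x\<bar> \<partial>M) \<le> (\<integral>x. \<bar>f x\<bar> powr p \<partial>M) powr (1 / p) * (\<integral>x. \<bar>g x\<bar> powr q \<partial>M) powr (1 / q)"
proof -
  have Y: "\<bar>f x * g x\<bar> \<le> \<bar>f x\<bar> powr p / p + \<bar>g x\<bar> powr q / q" for x
    using Youngs_inequality[OF pq, of "\<bar>f x\<bar>" "\<bar>g x\<bar>"] by (simp add: abs_mult)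
  show I: "integrable M (\<lambda>x. f x * g x)"
  proof (rule Bochner_Integration.integrable_bound)
    show "integrable M (\<lambda>x. \<bar>f x\<bar> powr p / p + \<bar>g x\<bar> powr q / q)" using f g by simp
    show "AE x in M. norm (f x * g x) \<le> norm (\<bar>f x\<bar> powr p / p + \<bar>g x\<bar> powr q / q)"
      by (intro always_eventually allI) (use Y pq in auto)
  qed measurable
  define A where "A = (\<integral>x. \<bar>f x\<bar> powr p \<partial>M)"
  define B where "B = (\<integral>x. \<bar>g x\<bar> powr q \<partial>M)"
  have AB: "A \<ge> 0" "B \<ge> 0" by (simp_all add: A_def B_def)
  consider "A = 0" | "B = 0" | "A > 0" "B > 0" using AB by linarith
  then show "(\<integral>x. \<bar>f x * g x\<bar> \<partial>M) \<le> (\<integral>x. \<bar>f x\<bar> powr p \<partial>M) powr (1 / p) * (\<integral>x. \<bar>g x\<bar> powr q \<partial>M) powr (1 / q)"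
  proof cases
    case 1
    then have "AE x in M. \<bar>f x\<bar> powr p = 0"
      using integral_nonneg_eq_0_iff_AE[OF f] by (simp add: A_def)
    then have "AE x in M. \<bar>f x * g x\<bar> = 0" by eventually_elim simp
    then have "(\<integral>x. \<bar>f x * g x\<bar> \<partial>M) = 0" by (simp add: integral_eq_zero_AE)
    then show ?thesis by simp
  next
    case 2
    then have "AE x in M. \<bar>g x\<bar> powr q = 0"
      using integral_nonneg_eq_0_iff_AE[OF g] by (simp add: B_def)
    then have "AE x in M. \<bar>f x * g x\<bar> = 0" by eventually_elim simp
    then have "(\<integral>x. \<bar>f x * g x\<bar> \<partial>M) = 0" by (simp add: integral_eq_zero_AE)
    then show ?thesis by simp
  next
    case 3
    define s where "s = A powr (1 / p)"
    define t where "t = B powr (1 / q)"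
    have st: "s > 0" "t > 0" using 3 by (simp_all add: s_def t_def)
    have sp: "s powr p = A" "t powr q = B" using 3 pq by (simp_all add: s_def t_def powr_powr)
    have pw: "\<bar>f x * g x\<bar> / (s * t) \<le> \<bar>f x\<bar> powr p / (A * p) + \<bar>g x\<bar> powr q / (B * q)" for x
      using Youngs_inequality[OF pq, of "\<bar>f x\<bar> / s" "\<bar>g x\<bar> / t"] st
      by (simp add: abs_mult powr_divide sp)
    have "(\<integral>x. \<bar>f x * g x\<bar> \<partial>M) / (s * t) = (\<integral>x. \<bar>f x * g x\<bar> / (s * t) \<partial>M)" by simp
    also have "\<dots> \<le> (\<integral>x. \<bar>f x\<bar> powr p / (A * p) + \<bar>g x\<bar> powr q / (B * q) \<partial>M)"
      using I f g by (intro integral_mono pw) auto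
    also have "\<dots> = A / (A * p) + B / (B * q)" using f g by (simp add: A_def B_def)
    also have "\<dots> = 1" using 3 pq by simp
    finally have "(\<integral>x. \<bar>f x * g x\<bar> \<partial>M) \<le> s * t" using st by (simp add: field_simps)
    then show ?thesis by (simp add: s_def t_def A_def B_def)
  qed
qed

section \<open>Lions' theorem in pre-Hilbert spaces\<close>

text \<open>A real vector space with a semidefinite symmetric form, neither definite nor complete.
  Carrier and operations are explicit because the test functions are a set rather than a type, and
  the form is a parameter because a second form on the same vectors appears in the proof of Lions'
  theorem.\<close>

locale inner_form =
  fixes V :: "'v set" and add :: "'v \<Rightarrow> 'v \<Rightarrow> 'v" and scl :: "real \<Rightarrow> 'v \<Rightarrow> 'v"
    and b :: "'v \<Rightarrow> 'v \<Rightarrow> real"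
  assumes nonempty: "V \<noteq> {}"
    and add_closed: "x \<in> V \<Longrightarrow> y \<in> V \<Longrightarrow> add x y \<in> V"
    and scl_closed: "x \<in> V \<Longrightarrow> scl r x \<in> V"
    and sym: "x \<in> V \<Longrightarrow> y \<in> V \<Longrightarrow> b x y = b y x"
    and add_left: "x \<in> V \<Longrightarrow> y \<in> V \<Longrightarrow> z \<in> V \<Longrightarrow> b (add x y) z = b x z + b y z"
    and scl_left: "x \<in> V \<Longrightarrow> z \<in> V \<Longrightarrow> b (scl r x) z = r * b x z"
    and nonneg: "x \<in> V \<Longrightarrow> 0 \<le> b x x"
begin

text \<open>The squared seminorm of \<open>x - y\<close>, expanded so that it can be written without
  a subtraction on the carrier.\<close>

definition dist2 :: "'v \<Rightarrow> 'v \<Rightarrow> real" where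
  "dist2 x y = b x x - 2 * b x y + b y y"

definition cauchy2 :: "(nat \<Rightarrow> 'v) \<Rightarrow> bool" where
  "cauchy2 X \<longleftrightarrow> (\<forall>e>0. \<exists>N. \<forall>i\<ge>N. \<forall>j\<ge>N. dist2 (X i) (X j) < e)"

definition linear_form :: "('v \<Rightarrow> real) \<Rightarrow> bool" where
  "linear_form L \<longleftrightarrow> (\<forall>x\<in>V. \<forall>y\<in>V. L (add x y) = L x + L y) \<and> (\<forall>r. \<forall>x\<in>V. L (scl r x) = r * L x)"

lemma add_right: "x \<in> V \<Longrightarrow> y \<in> V \<Longrightarrow> z \<in> V \<Longrightarrow> b z (add x y) = b z x + b z y"
  by (simp add: sym[of z] add_closed add_left)

lemma scl_right: "x \<in> V \<Longrightarrow> z \<in> V \<Longrightarrow> b z (scl r x) = r * b z x"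
  by (simp add: sym[of z] scl_closed scl_left)

lemmas bilin = add_left add_right scl_left scl_right add_closed scl_closed

lemma linear_formD:
  assumes "linear_form L"
  shows "x \<in> V \<Longrightarrow> y \<in> V \<Longrightarrow> L (add x y) = L x + L y" "x \<in> V \<Longrightarrow> L (scl r x) = r * L x"
  using assms by (auto simp: linear_form_def)

lemma dist2_eq: "x \<in> V \<Longrightarrow> y \<in> V \<Longrightarrow> dist2 x y = b (add x (scl (-1) y)) (add x (scl (-1) y))"
  by (simp add: dist2_def bilin sym[of y x])

lemma dist2_sym: "x \<in> V \<Longrightarrow> y \<in> V \<Longrightarrow> dist2 x y = dist2 y x"
  by (simp add: dist2_def sym[of y x])

text \<open>By the parallelogram identity the difference of the two sides is the square of
  \<open>x + y - 2 z\<close>.\<close>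

lemma dist2_triangle:
  assumes "x \<in> V" "y \<in> V" "z \<in> V"
  shows "dist2 x y \<le> 2 * dist2 x z + 2 * dist2 z y"
proof -
  let ?v = "add (add x y) (scl (-2) z)"
  have "0 \<le> b ?v ?v" using assms by (intro nonneg bilin)
  also have "b ?v ?v = 2 * dist2 x z + 2 * dist2 z y - dist2 x y"
    using assms by (simp add: bilin dist2_def sym[of y x] sym[of z x] sym[of z y])
  finally show ?thesis by simp
qed

lemma Cauchy_Schwarz:
  assumes "x \<in> V" "y \<in> V"
  shows "(b x y)\<^sup>2 \<le> b x x * b y y"
proof -
  have q: "0 \<le> b x x + 2 * s * b x y + s\<^sup>2 * b y y" for s
  proof -
    let ?v = "add x (scl s y)"
    have "0 \<le> b ?v ?v" using assms by (intro nonneg bilin)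
    also have "b ?v ?v = b x x + 2 * s * b x y + s\<^sup>2 * b y y"
      using assms by (simp add: bilin sym[of y x] power2_eq_square algebra_simps)
    finally show ?thesis .
  qed
  show ?thesis
  proof (cases "b y y = 0")
    case True
    have "b x y = 0"
    proof (rule ccontr)
      assume n: "b x y \<noteq> 0"
      \<comment> \<open>For \<open>b y y = 0\<close> the quadratic is affine in \<open>s\<close>,
        and this choice of \<open>s\<close> gives it a negative value.\<close>
      have "b x x + 2 * (- (b x x + 1) / (2 * b x y)) * b x y = -1"
        using n by (simp add: field_simps)
      then show False using q[of "- (b x x + 1) / (2 * b x y)"] True by simp
    qed
    then show ?thesis using True by simp
  next
    case False
    then have p: "b y y > 0" using nonneg[OF assms(2)] by simp
    have "0 \<le> b x x + 2 * (- b x y / b y y) * b x y + (- b x y / b y y)\<^sup>2 * b y y" by (rule q)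
    also have "\<dots> = b x x - (b x y)\<^sup>2 / b y y"
      using p by (simp add: power2_eq_square field_simps)
    finally show ?thesis using p by (simp add: field_simps)
  qed
qed

text \<open>A pre-Hilbert version of the Riesz representation theorem: the representing vector is only
  produced as a Cauchy sequence, namely a minimising sequence of \<open>b x x - 2 * L x\<close>.\<close>

lemma Riesz_sequence:
  assumes L: "linear_form L" and bd: "\<And>x. x \<in> V \<Longrightarrow> (L x)\<^sup>2 \<le> C * b x x" and C: "C \<ge> 0"
  shows "\<exists>X. (\<forall>k. X k \<in> V) \<and> cauchy2 X \<and> (\<forall>y\<in>V. (\<lambda>k. b (X k) y) \<longlonglongrightarrow> L y) \<and>
     (\<forall>k. b (X k) (X k) \<le> 4 * C + 2 / real (Suc k))"
proof -
  note Lin = linear_formD[OF L]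
  define J where "J x = b x x - 2 * L x" for x
  \<comment> \<open>The arithmetic-geometric mean inequality: \<open>t = 1\<close> bounds the
    functional \<open>J\<close> from below, \<open>t = 1/2\<close> absorbs \<open>L\<close> in the
    final norm bound.\<close>
  have L_le: "2 * \<bar>L x\<bar> \<le> t * b x x + C / t" if "x \<in> V" "t > 0" for x t
  proof -
    have "(2 * \<bar>L x\<bar>)\<^sup>2 \<le> 4 * (C * b x x)" using bd[OF that(1)] by simp
    also have "\<dots> = 4 * (t * b x x) * (C / t)" using that by simp
    also have "\<dots> = (t * b x x + C / t)\<^sup>2 - (t * b x x - C / t)\<^sup>2"
    proof -
      have "4 * p * q = (p + q)\<^sup>2 - (p - q)\<^sup>2" for p q :: real
        by (simp add: power2_eq_square algebra_simps)
      then show ?thesis .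
    qed
    also have "\<dots> \<le> (t * b x x + C / t)\<^sup>2" by simp
    finally show ?thesis
      by (rule power2_le_imp_le) (use C that nonneg[OF that(1)] in auto)
  qed
  have J_ge: "- C \<le> J x" if "x \<in> V" for x
    using L_le[OF that, of 1] abs_ge_self[of "L x"] by (simp add: J_def)
  have bdd: "bdd_below (J ` V)" using J_ge by (intro bdd_belowI2)
  define m where "m = Inf (J ` V)"
  have m_le: "m \<le> J x" if "x \<in> V" for x
    unfolding m_def using bdd that by (intro cInf_lower) auto
  have m0: "m \<le> 0"
  proof -
    obtain x where x: "x \<in> V" using nonempty by auto
    have "J (scl 0 x) = 0" using x by (simp add: J_def bilin Lin)
    then show ?thesis using m_le[OF scl_closed[OF x, of 0]] by simp
  qed
  define \<delta> where "\<delta> k = 1 / real (Suc k)" for k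
  have \<delta>: "\<delta> k > 0" "\<delta> k \<le> 1" for k by (auto simp: \<delta>_def)
  have \<delta>2: "(\<delta> k)\<^sup>2 \<le> \<delta> k" for k
    using \<delta>[of k] by (simp add: power2_eq_square mult_le_cancel_left2)
  have \<delta>0: "\<delta> \<longlonglongrightarrow> 0" unfolding \<delta>_def using lim_1_over_n LIMSEQ_Suc by blast
  have "\<exists>x\<in>V. J x < m + (\<delta> k)\<^sup>2" for k
  proof -
    have "Inf (J ` V) < m + (\<delta> k)\<^sup>2" using \<delta>[of k] by (simp add: m_def)
    then show ?thesis using nonempty bdd by (subst (asm) cInf_less_iff) auto
  qed
  \<comment> \<open>The tolerance is a square because the first variation below is tested with steps
    of size \<open>\<delta> k\<close> and then divided by that size.\<close>
  then obtain X where X: "\<And>k. X k \<in> V" and JX: "\<And>k. J (X k) < m + (\<delta> k)\<^sup>2" by metis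
  have d: "dist2 (X i) (X j) \<le> 2 * \<delta> i + 2 * \<delta> j" for i j
  proof -
    let ?z = "scl (1/2) (add (X i) (X j))"
    have "m \<le> J ?z" using X by (intro m_le bilin)
    \<comment> \<open>The parallelogram identity at the midpoint: two near-minimisers are close,
      since \<open>J\<close> at the midpoint cannot drop below the infimum.\<close>
    also have "J ?z = (2 * J (X i) + 2 * J (X j) - dist2 (X i) (X j)) / 4"
      using X by (simp add: J_def bilin Lin dist2_def sym[of "X j" "X i"] field_simps)
    finally show ?thesis using JX[of i] JX[of j] \<delta>2[of i] \<delta>2[of j] by simp
  qed
  have "cauchy2 X"
    unfolding cauchy2_def
  proof (intro allI impI)
    fix e :: real assume "e > 0"
    then obtain N where N: "\<And>i. i \<ge> N \<Longrightarrow> \<delta> i < e / 4"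
      using order_tendstoD(2)[OF \<delta>0, of "e/4"] by (auto simp: eventually_sequentially)
    have "dist2 (X i) (X j) < e" if "i \<ge> N" "j \<ge> N" for i j
      using d[of i j] N[OF that(1)] N[OF that(2)] by simp
    then show "\<exists>N. \<forall>i\<ge>N. \<forall>j\<ge>N. dist2 (X i) (X j) < e" by blast
  qed
  moreover have "(\<lambda>k. b (X k) y) \<longlonglongrightarrow> L y" if y: "y \<in> V" for y
  proof -
    have "norm (b (X k) y - L y) \<le> \<delta> k * (1 + b y y)" for k
    proof -
      let ?D = "b (X k) y - L y"
      have q: "0 \<le> (\<delta> k)\<^sup>2 + 2 * s * ?D + s\<^sup>2 * b y y" for s
      proof -
        have "m \<le> J (add (X k) (scl s y))" using X y by (intro m_le bilin)
        also have "\<dots> = J (X k) + 2 * s * ?D + s\<^sup>2 * b y y"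
          using X y by (simp add: J_def bilin Lin sym[of y "X k"] power2_eq_square algebra_simps)
        finally show ?thesis using JX[of k] by simp
      qed
      \<comment> \<open>The steps \<open>\<delta> k\<close> and \<open>- \<delta> k\<close> bound
        the approximate first variation on both sides.\<close>
      have "2 * \<bar>?D\<bar> * \<delta> k \<le> (\<delta> k * (1 + b y y)) * \<delta> k"
        using q[of "\<delta> k"] q[of "- \<delta> k"] by (simp add: power2_eq_square algebra_simps abs_if)
      then have "2 * \<bar>?D\<bar> \<le> \<delta> k * (1 + b y y)" using \<delta>[of k] by (simp only: mult_le_cancel_right)
      moreover have "norm ?D \<le> 2 * \<bar>?D\<bar>" by simp
      ultimately show ?thesis by (rule order_trans[rotated])
    qed
    moreover have "(\<lambda>k. \<delta> k * (1 + b y y)) \<longlonglongrightarrow> 0"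
      using tendsto_mult_left_zero[OF \<delta>0] by simp
    ultimately have "(\<lambda>k. b (X k) y - L y) \<longlonglongrightarrow> 0"
      by (rule Lim_null_comparison[OF always_eventually[OF allI]])
    then show ?thesis by (simp add: LIM_zero_iff)
  qed
  moreover have "b (X k) (X k) \<le> 4 * C + 2 / real (Suc k)" for k
  proof -
    have "b (X k) (X k) \<le> 2 * L (X k) + (\<delta> k)\<^sup>2" using JX[of k] m0 by (simp add: J_def)
    also have "2 * L (X k) \<le> 1/2 * b (X k) (X k) + C / (1/2)"
      using L_le[OF X, of "1/2" k] abs_ge_self[of "L (X k)"] by simp
    finally have "b (X k) (X k) \<le> 4 * C + 2 * \<delta> k" using \<delta>2[of k] by simp
    then show ?thesis by (simp add: \<delta>_def)
  qed
  ultimately show ?thesis using X by blast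
qed

text \<open>Let \<open>T x\<close> represent the bounded form \<open>a(-, x)\<close>, so that
  \<open>b (T x) y = a y x\<close>. The form \<open>b2 x y = b (T x) (T y) = a (T x) y\<close> is
  symmetric and, by coercivity, at least \<open>\<alpha>^2 b\<close> on the diagonal. If
  \<open>\<Phi>\<close> represents \<open>L\<close> with respect to \<open>b2\<close>, then
  \<open>u = T \<Phi>\<close> satisfies \<open>a u y = b2 \<Phi> y = L y\<close>. Since
  \<open>T x\<close> and \<open>\<Phi>\<close> exist only as Cauchy sequences, \<open>u\<close> is
  obtained as a diagonal sequence.\<close>

theorem Lions_sequence:
  fixes a :: "'v \<Rightarrow> 'v \<Rightarrow> real"
  assumes a1: "\<And>x. x \<in> V \<Longrightarrow> linear_form (\<lambda>y. a y x)" and a2: "\<And>x. x \<in> V \<Longrightarrow> linear_form (a x)"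
    and abd: "\<And>x. x \<in> V \<Longrightarrow> \<exists>K\<ge>0. \<forall>y\<in>V. (a y x)\<^sup>2 \<le> K * b y y"
    and coer: "\<And>x. x \<in> V \<Longrightarrow> \<alpha> * b x x \<le> a x x" and \<alpha>: "\<alpha> > 0"
    and L: "linear_form L" and Lbd: "\<And>x. x \<in> V \<Longrightarrow> (L x)\<^sup>2 \<le> C * b x x" and C: "C \<ge> 0"
  shows "\<exists>X. (\<forall>k. X k \<in> V) \<and> cauchy2 X \<and> (\<forall>y\<in>V. (\<lambda>k. a (X k) y) \<longlonglongrightarrow> L y) \<and>
     (\<forall>k. b (X k) (X k) \<le> 4 * C / \<alpha>\<^sup>2 + 3 / real (Suc k))"
proof -
  from abd obtain K where K: "\<And>x. x \<in> V \<Longrightarrow> K x \<ge> 0" "\<And>x y. x \<in> V \<Longrightarrow> y \<in> V \<Longrightarrow> (a y x)\<^sup>2 \<le> K x * b y y"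
    by metis
  have adist: "(a y x - a z x)\<^sup>2 \<le> K x * dist2 y z" if "x \<in> V" "y \<in> V" "z \<in> V" for x y z
  proof -
    have "a (add y (scl (-1) z)) x = a y x - a z x"
      using linear_formD[OF a1[OF that(1)]] that by (simp add: bilin)
    then show ?thesis using K(2)[OF that(1), of "add y (scl (-1) z)"] that by (simp add: dist2_eq bilin)
  qed
  have "\<forall>x\<in>V. \<exists>X. (\<forall>k. X k \<in> V) \<and> cauchy2 X \<and> (\<forall>y\<in>V. (\<lambda>k. b (X k) y) \<longlonglongrightarrow> a y x) \<and>
     (\<forall>k. b (X k) (X k) \<le> 4 * K x + 2 / real (Suc k))"
    using Riesz_sequence[OF a1 K(2) K(1)] by blast
  then obtain T where T: "\<And>x k. x \<in> V \<Longrightarrow> T x k \<in> V" "\<And>x. x \<in> V \<Longrightarrow> cauchy2 (T x)"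
      "\<And>x y. x \<in> V \<Longrightarrow> y \<in> V \<Longrightarrow> (\<lambda>k. b (T x k) y) \<longlonglongrightarrow> a y x"
      "\<And>x k. x \<in> V \<Longrightarrow> b (T x k) (T x k) \<le> 4 * K x + 2 / real (Suc k)"
    by metis
  have Tb: "b (T x k) (T x k) \<le> 4 * K x + 2" if "x \<in> V" for x k
  proof -
    have "2 / real (Suc k) \<le> 2" by (simp add: field_simps)
    then show ?thesis using T(4)[OF that, of k] by linarith
  qed
  \<comment> \<open>Boundedness of \<open>a\<close> in its first argument, with a constant that
    depends on \<open>y\<close>, carries the Cauchy property of \<open>T x\<close> over to real
    numbers.\<close>
  have conv: "convergent (\<lambda>k. a (T x k) y)" if "x \<in> V" "y \<in> V" for x y
  proof (rule Cauchy_convergent, rule metric_CauchyI)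
    fix e :: real assume e: "e > 0"
    then have "e\<^sup>2 / (K y + 1) > 0" using K(1)[OF that(2)] by (simp add: divide_pos_pos)
    then obtain N where N: "\<And>i j. i \<ge> N \<Longrightarrow> j \<ge> N \<Longrightarrow> dist2 (T x i) (T x j) < e\<^sup>2 / (K y + 1)"
      using T(2)[OF \<open>x \<in> V\<close>] unfolding cauchy2_def by blast
    have "dist (a (T x i) y) (a (T x j) y) < e" if "i \<ge> N" "j \<ge> N" for i j
    proof -
      have "(a (T x i) y - a (T x j) y)\<^sup>2 \<le> K y * dist2 (T x i) (T x j)"
        using \<open>x \<in> V\<close> \<open>y \<in> V\<close> by (intro adist T)
      also have "\<dots> \<le> K y * (e\<^sup>2 / (K y + 1))"
        using N[OF that] K(1)[OF \<open>y \<in> V\<close>] by (intro mult_left_mono) auto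
      also have "\<dots> < e\<^sup>2" using K(1)[OF \<open>y \<in> V\<close>] e by (simp add: field_simps)
      finally have "\<bar>a (T x i) y - a (T x j) y\<bar>\<^sup>2 < e\<^sup>2" by simp
      then have "\<bar>a (T x i) y - a (T x j) y\<bar> < e"
        by (rule power2_less_imp_less) (use e in simp)
      then show ?thesis by (simp add: dist_real_def)
    qed
    then show "\<exists>M. \<forall>m\<ge>M. \<forall>n\<ge>M. dist (a (T x m) y) (a (T x n) y) < e" by blast
  qed
  define b2 where "b2 x y = lim (\<lambda>k. a (T x k) y)" for x y
  have b2: "(\<lambda>k. a (T x k) y) \<longlonglongrightarrow> b2 x y" if "x \<in> V" "y \<in> V" for x y
    using conv[OF that] by (simp add: b2_def convergent_LIMSEQ_iff)
  \<comment> \<open>The diagonal limit agrees with the iterated one: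
    \<open>b (T x k) (T y j)\<close> tends to \<open>a (T x k) y\<close> in \<open>j\<close>, and
    the Cauchy property of \<open>T y\<close> together with the uniform bound on
    \<open>T x k\<close> controls the error. This description makes \<open>b2\<close> visibly
    symmetric and nonnegative.\<close>
  have b2': "(\<lambda>k. b (T x k) (T y k)) \<longlonglongrightarrow> b2 x y" if "x \<in> V" "y \<in> V" for x y
  proof -
    have "(\<lambda>k. b (T x k) (T y k) - a (T x k) y) \<longlonglongrightarrow> 0"
    proof (rule LIMSEQ_I)
      fix r :: real assume r: "r > 0"
      define M where "M = 4 * K x + 2"
      have M: "M > 0" using K(1)[OF that(1)] by (simp add: M_def)
      have "(r/2)\<^sup>2 / M > 0" using r M by simp
      then obtain N where N: "\<And>i j. i \<ge> N \<Longrightarrow> j \<ge> N \<Longrightarrow> dist2 (T y i) (T y j) < (r/2)\<^sup>2 / M"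
        using T(2)[OF \<open>y \<in> V\<close>] unfolding cauchy2_def by blast
      have "norm (b (T x k) (T y k) - a (T x k) y - 0) < r" if k: "k \<ge> N" for k
      proof -
        have ev: "\<bar>b (T x k) (T y k) - b (T y j) (T x k)\<bar> \<le> r/2" if "j \<ge> N" for j
        proof -
          let ?d = "add (T y k) (scl (-1) (T y j))"
          have "(b (T x k) ?d)\<^sup>2 \<le> b (T x k) (T x k) * b ?d ?d"
            using \<open>x \<in> V\<close> \<open>y \<in> V\<close> by (intro Cauchy_Schwarz T bilin)
          also have "\<dots> \<le> M * ((r/2)\<^sup>2 / M)"
          proof (rule mult_mono)
            show "b (T x k) (T x k) \<le> M" using Tb[OF \<open>x \<in> V\<close>] by (simp add: M_def)
            show "b ?d ?d \<le> (r/2)\<^sup>2 / M"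
              using N[OF k that] \<open>y \<in> V\<close> by (simp add: dist2_eq T(1))
            show "0 \<le> M" using M by simp
            show "0 \<le> b ?d ?d" using \<open>y \<in> V\<close> by (intro nonneg bilin T)
          qed
          also have "\<dots> = (r/2)\<^sup>2" using M by simp
          finally have "\<bar>b (T x k) ?d\<bar>\<^sup>2 \<le> (r/2)\<^sup>2" by simp
          then have "\<bar>b (T x k) ?d\<bar> \<le> r/2" by (rule power2_le_imp_le) (use r in simp)
          then show ?thesis
            using \<open>x \<in> V\<close> \<open>y \<in> V\<close> by (simp add: bilin T(1) sym[of "T y j" "T x k"])
        qed
        have "(\<lambda>j. \<bar>b (T x k) (T y k) - b (T y j) (T x k)\<bar>) \<longlonglongrightarrow> \<bar>b (T x k) (T y k) - a (T x k) y\<bar>"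
          using \<open>x \<in> V\<close> \<open>y \<in> V\<close> by (intro tendsto_intros T)
        then have "\<bar>b (T x k) (T y k) - a (T x k) y\<bar> \<le> r/2"
          by (rule LIMSEQ_le_const2) (use ev in blast)
        then show ?thesis using r by simp
      qed
      then show "\<exists>no. \<forall>n\<ge>no. norm (b (T x n) (T y n) - a (T x n) y - 0) < r" by blast
    qed
    from tendsto_add[OF this b2[OF that]] show ?thesis by simp
  qed
  have b2sym: "b2 x y = b2 y x" if "x \<in> V" "y \<in> V" for x y
    using b2'[OF that] b2'[OF that(2,1)] that
    by (simp add: sym[of "T x _"] T(1)) (metis LIMSEQ_unique)
  have b2add: "b2 z (add x y) = b2 z x + b2 z y" if "x \<in> V" "y \<in> V" "z \<in> V" for x y z
  proof -
    have "(\<lambda>k. a (T z k) (add x y)) \<longlonglongrightarrow> b2 z x + b2 z y"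
      using tendsto_add[OF b2[OF that(3,1)] b2[OF that(3,2)]] that
      by (simp add: linear_formD(1)[OF a2] T(1))
    then show ?thesis using b2[OF that(3) add_closed[OF that(1,2)]] LIMSEQ_unique by blast
  qed
  have b2scl: "b2 z (scl r x) = r * b2 z x" if "x \<in> V" "z \<in> V" for x z r
  proof -
    have "(\<lambda>k. a (T z k) (scl r x)) \<longlonglongrightarrow> r * b2 z x"
      using tendsto_mult_left[OF b2[OF that(2,1)], of r] that
      by (simp add: linear_formD(2)[OF a2] T(1))
    then show ?thesis using b2[OF that(2) scl_closed[OF that(1)]] LIMSEQ_unique by blast
  qed
  interpret B2: inner_form V add scl b2
  proof
    show "V \<noteq> {}" by (rule nonempty)
    show "0 \<le> b2 x x" if "x \<in> V" for x
      by (rule LIMSEQ_le_const[OF b2'[OF that that]]) (use that T nonneg in blast)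
    show "b2 (add x y) z = b2 x z + b2 y z" if "x \<in> V" "y \<in> V" "z \<in> V" for x y z
      using that by (simp add: b2sym[of _ z] b2add bilin)
    show "b2 (scl r x) z = r * b2 x z" if "x \<in> V" "z \<in> V" for x z r
      using that by (simp add: b2sym[of _ z] b2scl bilin)
  qed (auto intro: b2sym bilin)
  \<comment> \<open>In the limit \<open>a x x = b (T x) x\<close>, so Cauchy-Schwarz gives
    \<open>(\<alpha> * b x x)^2 \<le> (a x x)^2 \<le> b2 x x * b x x\<close>; one factor
    \<open>b x x\<close> cancels.\<close>
  have coer2: "\<alpha>\<^sup>2 * b x x \<le> b2 x x" if x: "x \<in> V" for x
  proof (cases "b x x = 0")
    case True
    then show ?thesis using B2.nonneg[OF x] by simp
  next
    case False
    then have p: "b x x > 0" using nonneg[OF x] by simp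
    have "(a x x)\<^sup>2 \<le> b2 x x * b x x"
    proof (rule LIMSEQ_le)
      show "(\<lambda>k. (b (T x k) x)\<^sup>2) \<longlonglongrightarrow> (a x x)\<^sup>2" using x by (intro tendsto_intros T)
      show "(\<lambda>k. b (T x k) (T x k) * b x x) \<longlonglongrightarrow> b2 x x * b x x" using x by (intro tendsto_intros b2')
      show "\<exists>N. \<forall>n\<ge>N. (b (T x n) x)\<^sup>2 \<le> b (T x n) (T x n) * b x x"
        using x Cauchy_Schwarz T(1) by blast
    qed
    moreover have "(\<alpha> * b x x)\<^sup>2 \<le> (a x x)\<^sup>2" using coer[OF x] \<alpha> p by (intro power_mono) auto
    ultimately have "(\<alpha>\<^sup>2 * b x x) * b x x \<le> b2 x x * b x x" by (simp add: power2_eq_square mult_ac)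
    then show ?thesis using p by simp
  qed
  have Lbd2: "(L x)\<^sup>2 \<le> (C / \<alpha>\<^sup>2) * b2 x x" if "x \<in> V" for x
  proof -
    have "(L x)\<^sup>2 \<le> C * b x x" by (rule Lbd[OF that])
    also have "\<dots> = (C / \<alpha>\<^sup>2) * (\<alpha>\<^sup>2 * b x x)" using \<alpha> by simp
    also have "\<dots> \<le> (C / \<alpha>\<^sup>2) * b2 x x" using C by (intro mult_left_mono coer2 that) auto
    finally show ?thesis .
  qed
  have L2: "B2.linear_form L" using L by (simp add: linear_form_def B2.linear_form_def)
  have "C / \<alpha>\<^sup>2 \<ge> 0" using C by simp
  from B2.Riesz_sequence[OF L2 Lbd2 this]
  obtain \<Phi> where \<Phi>: "\<And>k. \<Phi> k \<in> V" "B2.cauchy2 \<Phi>" "\<And>y. y \<in> V \<Longrightarrow> (\<lambda>k. b2 (\<Phi> k) y) \<longlonglongrightarrow> L y"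
      "\<And>k. b2 (\<Phi> k) (\<Phi> k) \<le> 4 * (C / \<alpha>\<^sup>2) + 2 / real (Suc k)" by blast
  define \<delta> where "\<delta> k = 1 / real (Suc k)" for k
  have \<delta>: "\<delta> k > 0" for k by (auto simp: \<delta>_def)
  have \<delta>0: "\<delta> \<longlonglongrightarrow> 0" unfolding \<delta>_def using lim_1_over_n LIMSEQ_Suc by blast
  \<comment> \<open>The diagonal index: late enough in the sequence \<open>T (\<Phi> k)\<close> that
    its norm and its distance to all later members are within \<open>\<delta> k\<close> of the
    limiting behaviour.\<close>
  have "\<exists>j. b (T (\<Phi> k) j) (T (\<Phi> k) j) \<le> b2 (\<Phi> k) (\<Phi> k) + \<delta> k \<and>
      (\<forall>i\<ge>j. dist2 (T (\<Phi> k) j) (T (\<Phi> k) i) \<le> \<delta> k)" for k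
  proof -
    obtain N where N: "\<And>i j. i \<ge> N \<Longrightarrow> j \<ge> N \<Longrightarrow> dist2 (T (\<Phi> k) i) (T (\<Phi> k) j) < \<delta> k"
      using T(2)[OF \<Phi>(1)[of k]] \<delta>[of k] unfolding cauchy2_def by blast
    obtain N' where N': "\<And>i. i \<ge> N' \<Longrightarrow> b (T (\<Phi> k) i) (T (\<Phi> k) i) < b2 (\<Phi> k) (\<Phi> k) + \<delta> k"
      using order_tendstoD(2)[OF b2'[OF \<Phi>(1)[of k] \<Phi>(1)[of k]], of "b2 (\<Phi> k) (\<Phi> k) + \<delta> k"] \<delta>[of k]
      by (auto simp: eventually_sequentially)
    show ?thesis
      by (rule exI[of _ "max N N'"]) (use N N' in \<open>auto intro!: less_imp_le\<close>)
  qed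
  then obtain j where j1: "\<And>k. b (T (\<Phi> k) (j k)) (T (\<Phi> k) (j k)) \<le> b2 (\<Phi> k) (\<Phi> k) + \<delta> k"
    and j2: "\<And>k i. i \<ge> j k \<Longrightarrow> dist2 (T (\<Phi> k) (j k)) (T (\<Phi> k) i) \<le> \<delta> k" by metis
  define X where "X k = T (\<Phi> k) (j k)" for k
  have X: "X k \<in> V" for k by (simp add: X_def T \<Phi>)
  \<comment> \<open>Both points are compared at a common late index \<open>m\<close>, where the
    distance of \<open>T (\<Phi> k)\<close> and \<open>T (\<Phi> l)\<close> approaches the
    \<open>b2\<close>-distance; each use of the weak triangle inequality doubles the terms.\<close>
  have dX: "dist2 (X k) (X l) \<le> 2 * \<delta> k + 4 * \<delta> l + 4 * B2.dist2 (\<Phi> k) (\<Phi> l)" for k l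
  proof (rule LIMSEQ_le_const)
    show "(\<lambda>m. 2 * \<delta> k + 4 * \<delta> l + 4 * dist2 (T (\<Phi> k) m) (T (\<Phi> l) m))
       \<longlonglongrightarrow> 2 * \<delta> k + 4 * \<delta> l + 4 * B2.dist2 (\<Phi> k) (\<Phi> l)"
      unfolding dist2_def B2.dist2_def by (intro tendsto_intros b2' \<Phi>)
    have "dist2 (X k) (X l) \<le> 2 * \<delta> k + 4 * \<delta> l + 4 * dist2 (T (\<Phi> k) m) (T (\<Phi> l) m)"
      if "m \<ge> max (j k) (j l)" for m
    proof -
      have "dist2 (X k) (X l) \<le> 2 * dist2 (X k) (T (\<Phi> k) m) + 2 * dist2 (T (\<Phi> k) m) (X l)"
        by (intro dist2_triangle X T \<Phi>)
      moreover have "dist2 (T (\<Phi> k) m) (X l) \<le> 2 * dist2 (T (\<Phi> k) m) (T (\<Phi> l) m) + 2 * dist2 (T (\<Phi> l) m) (X l)"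
        by (intro dist2_triangle X T \<Phi>)
      moreover have "dist2 (X k) (T (\<Phi> k) m) \<le> \<delta> k" using j2[of k m] that by (simp add: X_def)
      moreover have "dist2 (T (\<Phi> l) m) (X l) \<le> \<delta> l"
        using j2[of l m] that dist2_sym[OF T(1)[OF \<Phi>(1)] X, of l m l] by (simp add: X_def)
      ultimately show ?thesis by linarith
    qed
    then show "\<exists>N. \<forall>m\<ge>N. dist2 (X k) (X l) \<le> 2 * \<delta> k + 4 * \<delta> l + 4 * dist2 (T (\<Phi> k) m) (T (\<Phi> l) m)"
      by blast
  qed
  have "cauchy2 X"
    unfolding cauchy2_def
  proof (intro allI impI)
    fix e :: real assume "e > 0"
    then obtain N where N: "\<And>i. i \<ge> N \<Longrightarrow> \<delta> i < e / 16"
      using order_tendstoD(2)[OF \<delta>0, of "e/16"] by (auto simp: eventually_sequentially)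
    from \<open>e > 0\<close> have "e / 16 > 0" by simp
    then obtain N' where N': "\<And>i j. i \<ge> N' \<Longrightarrow> j \<ge> N' \<Longrightarrow> B2.dist2 (\<Phi> i) (\<Phi> j) < e / 16"
      using \<Phi>(2) unfolding B2.cauchy2_def by blast
    have "dist2 (X i) (X j) < e" if "i \<ge> max N N'" "j \<ge> max N N'" for i j
      using dX[of i j] N[of i] N[of j] N'[of i j] that \<open>e > 0\<close> by simp
    then show "\<exists>N. \<forall>i\<ge>N. \<forall>j\<ge>N. dist2 (X i) (X j) < e" by blast
  qed
  moreover have "(\<lambda>k. a (X k) y) \<longlonglongrightarrow> L y" if y: "y \<in> V" for y
  proof -
    have sq: "(a (X k) y - b2 (\<Phi> k) y)\<^sup>2 \<le> K y * \<delta> k" for k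
    proof (rule LIMSEQ_le_const2)
      show "(\<lambda>m. (a (X k) y - a (T (\<Phi> k) m) y)\<^sup>2) \<longlonglongrightarrow> (a (X k) y - b2 (\<Phi> k) y)\<^sup>2"
        by (intro tendsto_intros b2 \<Phi> y)
      have "(a (X k) y - a (T (\<Phi> k) m) y)\<^sup>2 \<le> K y * \<delta> k" if "m \<ge> j k" for m
      proof -
        have "(a (X k) y - a (T (\<Phi> k) m) y)\<^sup>2 \<le> K y * dist2 (X k) (T (\<Phi> k) m)"
          by (intro adist y X T \<Phi>)
        also have "\<dots> \<le> K y * \<delta> k" using j2[OF that] K(1)[OF y] by (intro mult_left_mono) (auto simp: X_def)
        finally show ?thesis .
      qed
      then show "\<exists>N. \<forall>m\<ge>N. (a (X k) y - a (T (\<Phi> k) m) y)\<^sup>2 \<le> K y * \<delta> k" by blast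
    qed
    have "(\<lambda>k. (a (X k) y - b2 (\<Phi> k) y)\<^sup>2) \<longlonglongrightarrow> 0"
    proof (rule Lim_null_comparison)
      show "(\<lambda>k. K y * \<delta> k) \<longlonglongrightarrow> 0" using tendsto_mult_right_zero[OF \<delta>0] by simp
      show "\<forall>\<^sub>F k in sequentially. norm ((a (X k) y - b2 (\<Phi> k) y)\<^sup>2) \<le> K y * \<delta> k"
        using sq by simp
    qed
    then have "(\<lambda>k. a (X k) y - b2 (\<Phi> k) y) \<longlonglongrightarrow> 0"
      by (simp add: power_tendsto_0_iff)
    from tendsto_add[OF this \<Phi>(3)[OF y]] show ?thesis by simp
  qed
  \<comment> \<open>Two of the three error units stem from the representing sequence of
    \<open>L\<close>, the third from the choice of the diagonal index.\<close>
  moreover have "b (X k) (X k) \<le> 4 * C / \<alpha>\<^sup>2 + 3 / real (Suc k)" for k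
    using j1[of k] \<Phi>(4)[of k] by (simp add: X_def \<delta>_def field_simps)
  ultimately show ?thesis using X by blast
qed

end

section \<open>Test functions on bounded open sets\<close>

lemma borel_measurable_lebesgue_on_borel:
  "f \<in> borel_measurable borel \<Longrightarrow> f \<in> borel_measurable (lebesgue_on U)"
  by (intro measurable_restrict_space1 measurable_completion) simp

lemma nn_integral_lebesgue_on_eq_lborel:
  fixes h :: "'a::euclidean_space \<Rightarrow> ennreal"
  assumes "open U" "\<And>x. x \<notin> U \<Longrightarrow> h x = 0"
  shows "(\<integral>\<^sup>+x. h x \<partial>lebesgue_on U) = (\<integral>\<^sup>+x. h x \<partial>lborel)"
proof -
  have "(\<integral>\<^sup>+x. h x \<partial>lebesgue_on U) = (\<integral>\<^sup>+x. h x * indicator U x \<partial>lebesgue)"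
    using assms(1) by (subst nn_integral_restrict_space) (auto simp: borel_open)
  also have "(\<lambda>x. h x * indicator U x) = h" using assms(2) by (auto simp: indicator_def fun_eq_iff)
  finally show ?thesis by (simp add: nn_integral_completion)
qed

lemma integral_lebesgue_on_eq_lborel:
  fixes h :: "'a::euclidean_space \<Rightarrow> real"
  assumes "open U" "\<And>x. x \<notin> U \<Longrightarrow> h x = 0" and [measurable]: "h \<in> borel_measurable borel"
  shows "(\<integral>x. h x \<partial>lebesgue_on U) = (\<integral>x. h x \<partial>lborel)"
proof -
  have "(\<integral>x. h x \<partial>lebesgue_on U) = (\<integral>x. indicator U x *\<^sub>R h x \<partial>lebesgue)"
    using assms(1) by (subst integral_restrict_space) (auto simp: borel_open)
  also have "(\<lambda>x. indicator U x *\<^sub>R h x) = h" using assms(2) by (auto simp: indicator_def fun_eq_iff)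
  finally show ?thesis by (simp add: integral_completion)
qed

lemma finite_measure_lebesgue_on_open:
  "open U \<Longrightarrow> bounded U \<Longrightarrow> finite_measure (lebesgue_on U)"
  by (intro finite_measure_lebesgue_on lmeasurable_open)

lemma bounded_range_zero_outside:
  fixes h :: "'a::euclidean_space \<Rightarrow> 'b::real_normed_vector"
  assumes "continuous_on UNIV h" "bounded U" "\<And>x. x \<notin> U \<Longrightarrow> h x = 0"
  obtains K where "K > 0" "\<And>x. norm (h x) \<le> K"
proof -
  have "compact (h ` closure U)"
    using assms by (intro compact_continuous_image) (auto intro: continuous_on_subset simp: compact_closure)
  then obtain K where K: "\<And>x. x \<in> closure U \<Longrightarrow> norm (h x) \<le> K"
    using bounded_iff[of "h ` closure U"] compact_imp_bounded by (metis image_eqI)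
  have "norm (h x) \<le> max K 1" for x
    using K[of x] assms(3)[of x] closure_subset[of U] by (cases "x \<in> U") auto
  then show thesis using that[of "max K 1"] by simp
qed

lemma test_fun_bounded:
  assumes "bounded U" "test_fun U \<phi>"
  obtains K where "K > 0" "\<And>x. \<bar>\<phi> x\<bar> \<le> K"
  using bounded_range_zero_outside[OF test_fun_continuous[OF assms(2)] assms(1) test_fun_zero_outside[OF assms(2)]]
  by auto

lemma test_fun_grad_bounded:
  assumes "bounded U" "test_fun U \<phi>"
  obtains K where "K > 0" "\<And>x. norm (grad \<phi> x) \<le> K"
  using bounded_range_zero_outside[OF test_fun_continuous_grad[OF assms(2)] assms(1) grad_zero_outside[OF assms(2)]]
  by auto

lemma test_fun_borel:
  assumes "test_fun U \<phi>"
  shows "\<phi> \<in> borel_measurable borel" "grad \<phi> \<in> borel_measurable borel"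
  using C1c_measurable[OF test_fun_C1c[OF assms]] .

lemma test_fun_measurable:
  assumes "test_fun U \<phi>"
  shows "\<phi> \<in> borel_measurable (lebesgue_on U)" "grad \<phi> \<in> borel_measurable (lebesgue_on U)"
  using test_fun_borel[OF assms] by (auto intro: borel_measurable_lebesgue_on_borel)

lemma L2_of_bounded:
  assumes "finite_measure M" "f \<in> borel_measurable M" "\<And>x. norm (f x) \<le> K"
  shows "L2 M f"
proof -
  interpret finite_measure M by fact
  have "L2 M (\<lambda>x. 1::real)" by (simp add: L2_def)
  then show ?thesis by (rule L2_bound[where K = K]) (use assms in auto)
qed

lemma test_fun_L2:
  assumes "open U" "bounded U" "test_fun U \<phi>"
  shows "L2 (lebesgue_on U) \<phi>" "L2 (lebesgue_on U) (grad \<phi>)"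
proof -
  note fin = finite_measure_lebesgue_on_open[OF assms(1,2)]
  obtain K where "\<And>x. \<bar>\<phi> x\<bar> \<le> K" using test_fun_bounded[OF assms(2,3)] by blast
  then show "L2 (lebesgue_on U) \<phi>"
    using test_fun_measurable[OF assms(3)] by (intro L2_of_bounded[OF fin, where K = K]) auto
  obtain K where "\<And>x. norm (grad \<phi> x) \<le> K" using test_fun_grad_bounded[OF assms(2,3)] by blast
  then show "L2 (lebesgue_on U) (grad \<phi>)"
    using test_fun_measurable[OF assms(3)] by (intro L2_of_bounded[OF fin, where K = K]) auto
qed

section \<open>Dirichlet energy, Poincare and Sobolev inequalities on \<open>U\<close>\<close>

definition energy :: "(real^'n::finite) set \<Rightarrow> (real^'n \<Rightarrow> real) \<Rightarrow> real" where
  "energy U \<phi> = (\<integral>x. (norm (grad \<phi> x))\<^sup>2 \<partial>lebesgue_on U)"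

lemma energy_nonneg: "energy U \<phi> \<ge> 0"
  by (simp add: energy_def)

lemma nn_integral_grad_eq_energy:
  assumes "open U" "bounded U" "test_fun U \<phi>"
  shows "(\<integral>\<^sup>+x. ennreal ((norm (grad \<phi> x))\<^sup>2) \<partial>lborel) = ennreal (energy U \<phi>)"
proof -
  have "(\<integral>\<^sup>+x. ennreal ((norm (grad \<phi> x))\<^sup>2) \<partial>lborel) = (\<integral>\<^sup>+x. ennreal ((norm (grad \<phi> x))\<^sup>2) \<partial>lebesgue_on U)"
    using assms by (intro nn_integral_lebesgue_on_eq_lborel[symmetric]) (auto simp: grad_zero_outside)
  also have "\<dots> = ennreal (energy U \<phi>)"
    unfolding energy_def using test_fun_L2[OF assms] by (intro nn_integral_eq_integral) (auto simp: L2_def)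
  finally show ?thesis .
qed

text \<open>Translating \<^term>\<open>U\<close> off itself makes \<^term>\<open>\<phi> (x + y)\<close> vanish where \<^term>\<open>\<phi> x\<close> does not.\<close>

lemma Poincare:
  fixes U :: "(real^'n::finite) set"
  assumes "open U" "bounded U"
  obtains K where "K > 0" "\<And>\<phi>. test_fun U \<phi> \<Longrightarrow> (\<integral>x. (\<phi> x)\<^sup>2 \<partial>lebesgue_on U) \<le> K * energy U \<phi>"
proof -
  obtain \<rho> where \<rho>: "\<rho> > 0" "\<And>x. x \<in> U \<Longrightarrow> norm x \<le> \<rho>" using assms(2) by (auto simp: bounded_pos)
  obtain i :: 'n where True by blast
  define y :: "real^'n" where "y = (2 * \<rho> + 1) *\<^sub>R axis i 1"
  have y: "norm y = 2 * \<rho> + 1" using \<rho> by (simp add: y_def norm_axis_1)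
  have "(\<integral>x. (\<phi> x)\<^sup>2 \<partial>lebesgue_on U) \<le> (2 * \<rho> + 1)\<^sup>2 * energy U \<phi>" if \<phi>: "test_fun U \<phi>" for \<phi>
  proof -
    have out: "\<phi> (x + y) = 0" if "\<phi> x \<noteq> 0" for x
    proof -
      have "x \<in> U" using that test_fun_zero_outside[OF \<phi>] by blast
      then have "norm (x + y) > \<rho>" using \<rho>(2)[of x] norm_triangle_ineq4[of "x + y" x] y \<rho>(1) by simp
      then have "x + y \<notin> U" using \<rho>(2) by fastforce
      then show ?thesis by (rule test_fun_zero_outside[OF \<phi>])
    qed
    have "ennreal (\<integral>x. (\<phi> x)\<^sup>2 \<partial>lebesgue_on U) = (\<integral>\<^sup>+x. ennreal ((\<phi> x)\<^sup>2) \<partial>lebesgue_on U)"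
      using test_fun_L2[OF assms \<phi>] by (intro nn_integral_eq_integral[symmetric]) (auto simp: L2_def)
    also have "\<dots> = (\<integral>\<^sup>+x. ennreal ((\<phi> x)\<^sup>2) \<partial>lborel)"
      using \<phi> by (intro nn_integral_lebesgue_on_eq_lborel assms) (auto simp: test_fun_zero_outside)
    also have "\<dots> \<le> (\<integral>\<^sup>+x. ennreal ((\<phi> (x + y) - \<phi> x)\<^sup>2) \<partial>lborel)"
      using out by (intro nn_integral_mono ennreal_leI) (metis diff_0 order_refl power2_minus power_zero_numeral zero_le_power2)
    also have "\<dots> \<le> ennreal ((norm y)\<^sup>2) * (\<integral>\<^sup>+x. ennreal ((norm (grad \<phi> x))\<^sup>2) \<partial>lborel)"
      by (rule nn_integral_translate_diff_le[OF test_fun_C1c[OF \<phi>]])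
    also have "\<dots> = ennreal ((2 * \<rho> + 1)\<^sup>2 * energy U \<phi>)"
      unfolding nn_integral_grad_eq_energy[OF assms \<phi>] y
      by (simp add: ennreal_mult[symmetric] energy_nonneg)
    finally show ?thesis by (simp add: ennreal_le_iff energy_nonneg)
  qed
  then show thesis using \<rho>(1) that[of "(2 * \<rho> + 1)\<^sup>2"] by simp
qed

text \<open>Test functions vanish off \<open>U\<close>, so the whole-space inequality transfers. The
  constant is obtained before \<open>U\<close> is chosen, as the uniformity of the final gradient
  bound requires.\<close>

lemma Sobolev_test_fun:
  assumes dim: "CARD('n::finite) \<ge> 3"
  obtains C where "C > 0" "\<And>(U :: (real^'n) set) \<phi>. open U \<Longrightarrow> bounded U \<Longrightarrow> test_fun U \<phi> \<Longrightarrow>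
     integrable (lebesgue_on U) (\<lambda>x. \<bar>\<phi> x\<bar> powr (2 * real CARD('n) / (real CARD('n) - 2))) \<and>
     (\<integral>x. \<bar>\<phi> x\<bar> powr (2 * real CARD('n) / (real CARD('n) - 2)) \<partial>lebesgue_on U)
       \<le> C * energy U \<phi> powr (real CARD('n) / (real CARD('n) - 2))"
proof -
  define p where "p = 2 * real CARD('n) / (real CARD('n) - 2)"
  have dim': "DIM(real^'n) = CARD('n)" by simp
  obtain C where C: "C > 0" "\<And>(w::real^'n \<Rightarrow> real) G n. C1c w G \<Longrightarrow> n \<ge> 0 \<Longrightarrow>
      (\<integral>\<^sup>+x. ennreal ((norm (G x))\<^sup>2) \<partial>lborel) \<le> ennreal n \<Longrightarrow>
      (\<integral>\<^sup>+x. ennreal (\<bar>w x\<bar> powr p) \<partial>lborel) \<le> ennreal (C * n powr (real CARD('n) / (real CARD('n) - 2)))"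
    using Sobolev[where 'a = "real^'n"] dim unfolding dim' p_def by metis
  have "integrable (lebesgue_on U) (\<lambda>x. \<bar>\<phi> x\<bar> powr p) \<and>
     (\<integral>x. \<bar>\<phi> x\<bar> powr p \<partial>lebesgue_on U) \<le> C * energy U \<phi> powr (real CARD('n) / (real CARD('n) - 2))"
    if U: "open U" "bounded U" and \<phi>: "test_fun U \<phi>" for U :: "(real^'n) set" and \<phi>
  proof -
    have [measurable]: "\<phi> \<in> borel_measurable (lebesgue_on U)" using test_fun_measurable[OF \<phi>] by simp
    have "(\<integral>\<^sup>+x. ennreal (\<bar>\<phi> x\<bar> powr p) \<partial>lebesgue_on U) = (\<integral>\<^sup>+x. ennreal (\<bar>\<phi> x\<bar> powr p) \<partial>lborel)"
      using \<phi> by (intro nn_integral_lebesgue_on_eq_lborel U) (auto simp: test_fun_zero_outside)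
    also have "\<dots> \<le> ennreal (C * energy U \<phi> powr (real CARD('n) / (real CARD('n) - 2)))"
      by (intro C(2)[OF test_fun_C1c[OF \<phi>]]) (auto simp: nn_integral_grad_eq_energy[OF U \<phi>] energy_nonneg)
    finally have le: "(\<integral>\<^sup>+x. ennreal (\<bar>\<phi> x\<bar> powr p) \<partial>lebesgue_on U)
       \<le> ennreal (C * energy U \<phi> powr (real CARD('n) / (real CARD('n) - 2)))" .
    have I: "integrable (lebesgue_on U) (\<lambda>x. \<bar>\<phi> x\<bar> powr p)"
      using order_le_less_trans[OF le] by (intro integrableI_bounded) auto
    have "ennreal (\<integral>x. \<bar>\<phi> x\<bar> powr p \<partial>lebesgue_on U) \<le> ennreal (C * energy U \<phi> powr (real CARD('n) / (real CARD('n) - 2)))"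
      using le nn_integral_eq_integral[OF I] by simp
    then show ?thesis using I C(1) by (simp add: ennreal_le_iff)
  qed
  then show thesis using that[OF C(1)] unfolding p_def by blast
qed

lemma weak_Sobolev_test_fun:
  assumes dim: "CARD('n::finite) \<ge> 3"
  obtains C where "C > 0" "\<And>(U :: (real^'n) set) \<phi> t. open U \<Longrightarrow> bounded U \<Longrightarrow> test_fun U \<phi> \<Longrightarrow> t > 0 \<Longrightarrow>
     emeasure (lebesgue_on U) {x \<in> U. \<bar>\<phi> x\<bar> \<ge> t} \<le> ennreal (C * (energy U \<phi> / t\<^sup>2) powr (real CARD('n) / (real CARD('n) - 2)))"
proof -
  have dim': "DIM(real^'n) = CARD('n)" by simp
  obtain C where C: "C > 0" "\<And>(w::real^'n \<Rightarrow> real) G n t. C1c w G \<Longrightarrow> n \<ge> 0 \<Longrightarrow> t > 0 \<Longrightarrow>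
      (\<integral>\<^sup>+x. ennreal ((norm (G x))\<^sup>2) \<partial>lborel) \<le> ennreal n \<Longrightarrow>
      emeasure lborel {x. \<bar>w x\<bar> \<ge> t} \<le> ennreal (C * (n / t\<^sup>2) powr (real CARD('n) / (real CARD('n) - 2)))"
    using weak_Sobolev_measure[where 'a = "real^'n"] dim unfolding dim' by metis
  have "emeasure (lebesgue_on U) {x \<in> U. \<bar>\<phi> x\<bar> \<ge> t} \<le> ennreal (C * (energy U \<phi> / t\<^sup>2) powr (real CARD('n) / (real CARD('n) - 2)))"
    if U: "open U" "bounded U" and \<phi>: "test_fun U \<phi>" and t: "t > 0" for U :: "(real^'n) set" and \<phi> t
  proof -
    have [measurable]: "\<phi> \<in> borel_measurable borel" using test_fun_borel[OF \<phi>] by simp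
    have "{x \<in> U. \<bar>\<phi> x\<bar> \<ge> t} = {x. \<bar>\<phi> x\<bar> \<ge> t}" using test_fun_zero_outside[OF \<phi>] t by force
    moreover have "emeasure (lebesgue_on U) {x \<in> U. \<bar>\<phi> x\<bar> \<ge> t} = emeasure lebesgue {x \<in> U. \<bar>\<phi> x\<bar> \<ge> t}"
      using U by (intro emeasure_restrict_space) (auto simp: borel_open)
    moreover have "emeasure lebesgue {x. \<bar>\<phi> x\<bar> \<ge> t} = emeasure lborel {x. \<bar>\<phi> x\<bar> \<ge> t}"
      by simp
    moreover have "emeasure lborel {x. \<bar>\<phi> x\<bar> \<ge> t} \<le> ennreal (C * (energy U \<phi> / t\<^sup>2) powr (real CARD('n) / (real CARD('n) - 2)))"
      by (intro C(2)[OF test_fun_C1c[OF \<phi>]]) (auto simp: nn_integral_grad_eq_energy[OF U \<phi>] energy_nonneg t)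
    ultimately show ?thesis by simp
  qed
  then show thesis using that[OF C(1)] by blast
qed

section \<open>Integration by parts\<close>

lemma integral_lborel_translate:
  fixes h :: "'a::euclidean_space \<Rightarrow> real"
  assumes [measurable]: "h \<in> borel_measurable borel"
  shows "(\<integral>x. h (x + z) \<partial>lborel) = (\<integral>x. h x \<partial>lborel)"
proof -
  have "(\<integral>x. h x \<partial>lborel) = (\<integral>x. h x \<partial>distr lborel borel ((+) z))"
    by (simp add: lborel_distr_plus)
  also have "\<dots> = (\<integral>x. h (z + x) \<partial>lborel)"
    by (subst integral_distr) auto
  finally show ?thesis by (simp add: add.commute)
qed

text \<open>The integral of the difference quotients of \<^term>\<open>\<phi>\<close> vanishes by translation invariance.\<close>

lemma integral_grad_eq_0:
  fixes U :: "(real^'n::finite) set"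
  assumes U: "open U" "bounded U" and \<phi>: "test_fun U \<phi>"
  shows "(\<integral>x. grad \<phi> x \<bullet> v \<partial>lebesgue_on U) = 0"
proof -
  note [measurable] = test_fun_borel[OF \<phi>]
  obtain K where K: "K > 0" "\<And>x. norm (grad \<phi> x) \<le> K" using test_fun_grad_bounded[OF U(2) \<phi>] by blast
  obtain \<rho> where \<rho>: "\<rho> > 0" "\<And>x. x \<in> U \<Longrightarrow> norm x \<le> \<rho>" using U(2) by (auto simp: bounded_pos)
  define h where "h k = 1 / real (Suc k)" for k
  have h: "h k > 0" "h k \<le> 1" for k by (auto simp: h_def)
  have h0: "h \<longlonglongrightarrow> 0" unfolding h_def using lim_1_over_n LIMSEQ_Suc by blast
  define q where "q k x = (\<phi> (x + h k *\<^sub>R v) - \<phi> x) / h k" for k x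
  have [measurable]: "q k \<in> borel_measurable borel" for k unfolding q_def by measurable
  have lip: "\<bar>\<phi> x - \<phi> y\<bar> \<le> K * norm (x - y)" for x y
  proof -
    have "onorm (\<lambda>h. grad \<phi> z \<bullet> h) \<le> K" for z
    proof (rule onorm_le)
      fix w
      have "norm (grad \<phi> z \<bullet> w) \<le> norm (grad \<phi> z) * norm w" by (simp add: Cauchy_Schwarz_ineq2)
      also have "\<dots> \<le> K * norm w" using K by (intro mult_right_mono) auto
      finally show "norm (grad \<phi> z \<bullet> w) \<le> K * norm w" .
    qed
    then show ?thesis
      using differentiable_bound[of UNIV \<phi> "\<lambda>z h. grad \<phi> z \<bullet> h" K x y] test_fun_has_derivative[OF \<phi>] by simp
  qed
  \<comment> \<open>The dominating function: difference quotients are bounded by the Lipschitz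
    constant times \<open>norm v\<close>, and as the step sizes are at most 1 they vanish outside
    this ball.\<close>
  let ?b = "\<lambda>x::real^'n. K * norm v * indicator (cball 0 (\<rho> + norm v)) x"
  have "(\<lambda>k. \<integral>x. q k x \<partial>lborel) \<longlonglongrightarrow> (\<integral>x. grad \<phi> x \<bullet> v \<partial>lborel)"
  proof (rule integral_dominated_convergence[where w = ?b])
    show "integrable lborel ?b"
      using emeasure_lborel_cball_finite[of "0::real^'n" "\<rho> + norm v"] by (intro integrable_mult_right) (simp add: integrable_indicator_iff)
    show "AE x in lborel. (\<lambda>k. q k x) \<longlonglongrightarrow> grad \<phi> x \<bullet> v"
    proof (intro always_eventually allI)
      fix x
      have "((\<lambda>s. \<phi> (x + s *\<^sub>R v)) has_derivative (\<lambda>h. grad \<phi> (x + 0 *\<^sub>R v) \<bullet> (h *\<^sub>R v))) (at 0)"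
        by (rule has_derivative_compose[OF _ test_fun_has_derivative[OF \<phi>]]) (auto intro!: derivative_eq_intros)
      then have "((\<lambda>s. \<phi> (x + s *\<^sub>R v)) has_real_derivative (grad \<phi> x \<bullet> v)) (at 0)"
        by (simp add: has_field_derivative_def mult_commute_abs)
      then have "((\<lambda>s. (\<phi> (x + s *\<^sub>R v) - \<phi> x) / s) \<longlongrightarrow> grad \<phi> x \<bullet> v) (at 0)" by (simp add: DERIV_def)
      moreover have "filterlim h (at 0) sequentially"
        using h0 h(1) unfolding filterlim_at by (auto intro!: always_eventually less_imp_neq[symmetric])
      ultimately show "(\<lambda>k. q k x) \<longlonglongrightarrow> grad \<phi> x \<bullet> v"
        unfolding q_def by (rule filterlim_compose)
    qed
    show "AE x in lborel. norm (q k x) \<le> ?b x" for k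
    proof (intro always_eventually allI)
      fix x
      show "norm (q k x) \<le> ?b x"
      proof (cases "x \<in> cball 0 (\<rho> + norm v)")
        case True
        have "\<bar>\<phi> (x + h k *\<^sub>R v) - \<phi> x\<bar> \<le> K * (h k * norm v)" using lip[of "x + h k *\<^sub>R v" x] h[of k] by simp
        then show ?thesis using True h[of k] by (simp add: q_def field_simps)
      next
        case False
        then have nx: "norm x > \<rho> + norm v" by simp
        then have "x \<notin> U" using \<rho>(2)[of x] norm_ge_zero[of v] by linarith
        moreover have "x + h k *\<^sub>R v \<notin> U"
        proof
          assume "x + h k *\<^sub>R v \<in> U"
          then have "norm (x + h k *\<^sub>R v) \<le> \<rho>" by (rule \<rho>(2))
          moreover have "norm x \<le> norm (x + h k *\<^sub>R v) + norm (h k *\<^sub>R v)"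
            using norm_triangle_ineq4[of "x + h k *\<^sub>R v" "h k *\<^sub>R v"] by simp
          moreover have "norm (h k *\<^sub>R v) \<le> norm v" using h[of k] by (simp add: mult_left_le_one_le)
          ultimately show False using nx by linarith
        qed
        ultimately show ?thesis using test_fun_zero_outside[OF \<phi>] False by (simp add: q_def)
      qed
    qed
  qed measurable
  moreover have "(\<integral>x. q k x \<partial>lborel) = 0" for k
  proof -
    have int\<phi>: "integrable lborel \<phi>"
    proof -
      obtain B where B: "\<And>x. \<bar>\<phi> x\<bar> \<le> B" using test_fun_bounded[OF U(2) \<phi>] by blast
      show ?thesis
      proof (rule Bochner_Integration.integrable_bound[where f = "\<lambda>x. B * indicator (cball (0::real^'n) \<rho>) x"])
        show "integrable lborel (\<lambda>x. B * indicator (cball (0::real^'n) \<rho>) x)"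
          using emeasure_lborel_cball_finite[of "0::real^'n" \<rho>] by (intro integrable_mult_right) (simp add: integrable_indicator_iff)
        have "norm (\<phi> x) \<le> norm (B * indicator (cball (0::real^'n) \<rho>) x)" for x
          using B[of x] \<rho>(2)[of x] test_fun_zero_outside[OF \<phi>, of x]
          by (cases "x \<in> U") (auto simp: indicator_def)
        then show "AE x in lborel. norm (\<phi> x) \<le> norm (B * indicator (cball (0::real^'n) \<rho>) x)" by simp
      qed simp
    qed
    have int2: "integrable lborel (\<lambda>x. \<phi> (x + h k *\<^sub>R v))"
    proof -
      have "integrable (distr lborel borel ((+) (h k *\<^sub>R v))) \<phi>" using int\<phi> by (simp add: lborel_distr_plus)
      then have "integrable lborel (\<lambda>x. \<phi> (h k *\<^sub>R v + x))" by (subst (asm) integrable_distr_eq) auto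
      then show ?thesis by (simp add: add.commute)
    qed
    have "(\<integral>x. q k x \<partial>lborel) = ((\<integral>x. \<phi> (x + h k *\<^sub>R v) \<partial>lborel) - (\<integral>x. \<phi> x \<partial>lborel)) / h k"
      unfolding q_def using int\<phi> int2 by simp
    then show ?thesis by (simp add: integral_lborel_translate)
  qed
  ultimately have "(\<integral>x. grad \<phi> x \<bullet> v \<partial>lborel) = 0" by (simp add: LIMSEQ_const_iff)
  then show ?thesis
    by (subst integral_lebesgue_on_eq_lborel[OF U(1)]) (auto simp: grad_zero_outside[OF \<phi>])
qed

text \<open>The product of two test functions is a test function, and the integral of its
  directional derivative is zero.\<close>

lemma integration_by_parts:
  fixes U :: "(real^'n::finite) set"
  assumes U: "open U" "bounded U" and \<phi>: "test_fun U \<phi>" and \<psi>: "test_fun U \<psi>"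
  shows "(\<integral>x. \<phi> x * (grad \<psi> x \<bullet> v) \<partial>lebesgue_on U) = - (\<integral>x. (grad \<phi> x \<bullet> v) * \<psi> x \<partial>lebesgue_on U)"
proof -
  have L2v: "L2 (lebesgue_on U) (\<lambda>x. grad w x \<bullet> v)" if "test_fun U w" for w
  proof (rule L2_bound[OF test_fun_L2(2)[OF U that]])
    have [measurable]: "grad w \<in> borel_measurable (lebesgue_on U)" using test_fun_measurable[OF that] by simp
    show "(\<lambda>x. grad w x \<bullet> v) \<in> borel_measurable (lebesgue_on U)" by measurable
    show "AE x in lebesgue_on U. norm (grad w x \<bullet> v) \<le> norm v * norm (grad w x)"
      using Cauchy_Schwarz_ineq2[of v] by (simp add: inner_commute[of _ v])
  qed
  have I: "integrable (lebesgue_on U) (\<lambda>x. \<phi> x * (grad \<psi> x \<bullet> v))"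
      "integrable (lebesgue_on U) (\<lambda>x. (grad \<phi> x \<bullet> v) * \<psi> x)"
    using L2_inner_integrable[OF test_fun_L2(1)[OF U \<phi>] L2v[OF \<psi>]]
      L2_inner_integrable[OF L2v[OF \<phi>] test_fun_L2(1)[OF U \<psi>]] by simp_all
  have "0 = (\<integral>x. grad (\<lambda>x. \<phi> x * \<psi> x) x \<bullet> v \<partial>lebesgue_on U)"
    using integral_grad_eq_0[OF U test_fun_mult[OF \<phi> \<psi>]] by simp
  also have "\<dots> = (\<integral>x. \<phi> x * (grad \<psi> x \<bullet> v) + (grad \<phi> x \<bullet> v) * \<psi> x \<partial>lebesgue_on U)"
    by (simp add: grad_mult[OF \<phi> \<psi>] inner_add_left mult.commute)
  finally show ?thesis using I by simp
qed

section \<open>Existence of weak solutions\<close>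

lemma L2_Pair:
  assumes f: "L2 M f" and g: "L2 M g"
  shows "L2 M (\<lambda>x. (f x, g x))"
proof -
  have [measurable]: "f \<in> borel_measurable M" "g \<in> borel_measurable M" using f g by (auto simp: L2_def)
  have "(\<lambda>x. (f x, g x)) \<in> borel_measurable M" by (rule borel_measurable_Pair) measurable
  moreover have "(norm (f x, g x))\<^sup>2 = (norm (f x))\<^sup>2 + (norm (g x))\<^sup>2" for x by (simp add: norm_Pair)
  ultimately show ?thesis using f g by (simp add: L2_def)
qed

lemma L2_fst:
  fixes h :: "'a \<Rightarrow> 'b::euclidean_space \<times> 'c::euclidean_space"
  assumes h: "L2 M h"
  shows "L2 M (\<lambda>x. fst (h x))"
proof (rule L2_bound[OF h, where K = 1])
  have "h \<in> borel_measurable M" using h by (simp add: L2_def)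
  moreover have "(fst :: 'b \<times> 'c \<Rightarrow> _) \<in> borel_measurable borel"
    using borel_measurable_continuous_onI[OF continuous_on_fst[OF continuous_on_id]] by simp
  ultimately show "(\<lambda>x. fst (h x)) \<in> borel_measurable M" by (rule measurable_compose)
  show "AE x in M. norm (fst (h x)) \<le> 1 * norm (h x)"
  proof (intro always_eventually allI)
    fix x
    show "norm (fst (h x)) \<le> 1 * norm (h x)" using norm_fst_le[of "fst (h x)" "snd (h x)"] by simp
  qed
qed

lemma L2_snd:
  fixes h :: "'a \<Rightarrow> 'b::euclidean_space \<times> 'c::euclidean_space"
  assumes h: "L2 M h"
  shows "L2 M (\<lambda>x. snd (h x))"
proof (rule L2_bound[OF h, where K = 1])
  have "h \<in> borel_measurable M" using h by (simp add: L2_def)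
  moreover have "(snd :: 'b \<times> 'c \<Rightarrow> _) \<in> borel_measurable borel"
    using borel_measurable_continuous_onI[OF continuous_on_snd[OF continuous_on_id]] by simp
  ultimately show "(\<lambda>x. snd (h x)) \<in> borel_measurable M" by (rule measurable_compose)
  show "AE x in M. norm (snd (h x)) \<le> 1 * norm (h x)"
  proof (intro always_eventually allI)
    fix x
    show "norm (snd (h x)) \<le> 1 * norm (h x)" using norm_snd_le[of "snd (h x)" "fst (h x)"] by simp
  qed
qed

lemma Lp_2_iff_L2: "Lp U 2 v \<longleftrightarrow> L2 (lebesgue_on U) v"
  by (simp add: Lp_def L2_def powr_numeral)

lemma L2vec_iff_L2: "L2vec U G \<longleftrightarrow> L2 (lebesgue_on U) G"
  by (simp add: L2vec_def L2_def)

lemma integral_norm_square_tendsto_0: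
  assumes "\<And>k. L2 M (f k)" "\<And>k. L2 M (g k)" "\<And>k x. norm (g k x) \<le> norm (f k x)"
    and "(\<lambda>k. \<integral>x. (norm (f k x))\<^sup>2 \<partial>M) \<longlonglongrightarrow> 0"
  shows "(\<lambda>k. \<integral>x. (norm (g k x))\<^sup>2 \<partial>M) \<longlonglongrightarrow> 0"
proof (rule Lim_null_comparison[OF _ assms(4)], intro always_eventually allI)
  fix k
  have "(\<integral>x. (norm (g k x))\<^sup>2 \<partial>M) \<le> (\<integral>x. (norm (f k x))\<^sup>2 \<partial>M)"
    using assms(1)[of k] assms(2)[of k] assms(3)[of k]
    by (intro integral_mono power_mono) (auto simp: L2_def)
  then show "norm (\<integral>x. (norm (g k x))\<^sup>2 \<partial>M) \<le> (\<integral>x. (norm (f k x))\<^sup>2 \<partial>M)" by simp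
qed

lemma norm_vector_matrix_mult_le:
  fixes w :: "real^'n::finite" and a :: "real^'n^'n"
  assumes "\<And>i j. \<bar>a $ i $ j\<bar> \<le> K"
  shows "norm (w v* a) \<le> real CARD('n) * (real CARD('n) * K) * norm w"
proof -
  have "\<bar>(w v* a) $ j\<bar> \<le> real CARD('n) * K * norm w" for j
  proof -
    have "\<bar>(w v* a) $ j\<bar> \<le> (\<Sum>i\<in>UNIV. \<bar>w $ i * a $ i $ j\<bar>)"
      by (simp add: vector_matrix_mult_def sum_abs)
    also have "\<dots> \<le> (\<Sum>i\<in>(UNIV::'n set). norm w * K)"
      unfolding abs_mult by (intro sum_mono mult_mono assms component_le_norm_cart) auto
    finally show ?thesis by (simp add: mult_ac)
  qed
  then have "(\<Sum>j\<in>UNIV. \<bar>(w v* a) $ j\<bar>) \<le> (\<Sum>j\<in>(UNIV::'n set). real CARD('n) * K * norm w)"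
    by (intro sum_mono)
  then show ?thesis using norm_le_l1_cart[of "w v* a"] by (simp add: mult_ac)
qed

lemma L2_vector_matrix_mult:
  fixes w :: "'a \<Rightarrow> real^'n::finite" and a :: "'a \<Rightarrow> real^'n^'n"
  assumes w: "L2 M w" and a[measurable]: "\<And>i j. (\<lambda>x. a x $ i $ j) \<in> borel_measurable M"
    and bd: "AE x in M. \<forall>i j. \<bar>a x $ i $ j\<bar> \<le> K"
  shows "L2 M (\<lambda>x. w x v* a x)"
proof (rule L2_bound[OF w])
  have [measurable]: "w \<in> borel_measurable M" using w by (simp add: L2_def)
  have [measurable]: "(\<lambda>x. w x $ i) \<in> borel_measurable M" for i
  proof -
    have "(\<lambda>x. w x \<bullet> axis i 1) \<in> borel_measurable M" by measurable
    then show ?thesis by (simp add: inner_axis)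
  qed
  have "(\<lambda>x. \<Sum>j\<in>UNIV. (\<Sum>i\<in>UNIV. w x $ i * a x $ i $ j) *\<^sub>R (axis j 1 :: real^'n)) \<in> borel_measurable M"
    by measurable
  moreover have "(\<Sum>j\<in>UNIV. (\<Sum>i\<in>UNIV. w x $ i * a x $ i $ j) *\<^sub>R (axis j 1 :: real^'n)) = w x v* a x" for x
    using basis_expansion[of "w x v* a x"] by (simp add: vector_matrix_mult_def scalar_mult_eq_scaleR)
  ultimately show "(\<lambda>x. w x v* a x) \<in> borel_measurable M" by simp
  show "AE x in M. norm (w x v* a x) \<le> real CARD('n) * (real CARD('n) * K) * norm (w x)"
    using bd by eventually_elim (auto intro!: norm_vector_matrix_mult_le)
qed

section \<open>The equation as a bilinear form on test functions\<close>

locale elliptic =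
  fixes U :: "(real^'n::finite) set" and lam K :: real and A :: "real^'n \<Rightarrow> real^'n^'n"
    and B :: "real^'n \<Rightarrow> real^'n" and c :: "real^'n \<Rightarrow> real"
  assumes coeff: "coeff_assms U lam K A B c"
begin

abbreviation MU where "MU \<equiv> lebesgue_on U"

lemma open_U: "open U" and bounded_U: "bounded U" and lam_pos: "lam > 0"
  and A_measurable: "(\<lambda>x. A x $ i $ j) \<in> borel_measurable MU"
  and ellipticity: "AE x in MU. \<forall>\<xi>. (A x *v \<xi>) \<bullet> \<xi> \<ge> lam * (norm \<xi>)\<^sup>2"
  and A_bounded: "AE x in MU. \<forall>i j. \<bar>A x $ i $ j\<bar> \<le> K"
  and B_L2: "L2 MU B"
  and B_div: "test_fun U \<phi> \<Longrightarrow> (\<And>x. \<phi> x \<ge> 0) \<Longrightarrow> (\<integral>x. B x \<bullet> grad \<phi> x \<partial>MU) \<ge> 0"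
  and c_integrable: "integrable MU c" and c_nonneg: "AE x in MU. c x \<ge> 0"
  using coeff unfolding coeff_assms_def L2vec_iff_L2 by auto

lemma finite_MU: "finite_measure MU"
  by (rule finite_measure_lebesgue_on_open[OF open_U bounded_U])

lemmas test_L2 = test_fun_L2[OF open_U bounded_U]

text \<open>The square root moves the merely integrable \<open>c\<close> into \<open>L^2\<close>.
  The absolute value makes the square equal to \<open>\<bar>c\<bar>\<close> at every point, while
  \<open>c \<ge> 0\<close> holds only almost everywhere.\<close>

definition e :: "real^'n \<Rightarrow> real" where "e x = sqrt \<bar>c x\<bar>"

lemma e_mult_self: "e x * e x = \<bar>c x\<bar>"
  by (simp add: e_def)

lemma e_L2: "L2 MU e"
proof -
  have [measurable]: "c \<in> borel_measurable MU" using c_integrable by auto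
  have "e \<in> borel_measurable MU" unfolding e_def[abs_def] by measurable
  moreover have "(norm (e x))\<^sup>2 = \<bar>c x\<bar>" for x by (simp add: e_def)
  ultimately show ?thesis using c_integrable by (simp add: L2_def)
qed

lemma test_scaleR_L2:
  assumes "test_fun U \<phi>" "L2 MU f"
  shows "L2 MU (\<lambda>x. \<phi> x *\<^sub>R f x)"
proof -
  obtain C where C: "\<And>x. \<bar>\<phi> x\<bar> \<le> C" using test_fun_bounded[OF bounded_U assms(1)] by blast
  have [measurable]: "\<phi> \<in> borel_measurable MU" "f \<in> borel_measurable MU"
    using test_fun_measurable[OF assms(1)] assms(2) by (auto simp: L2_def)
  show ?thesis
  proof (rule L2_bound[OF assms(2), where K = C])
    show "(\<lambda>x. \<phi> x *\<^sub>R f x) \<in> borel_measurable MU" by measurable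
    show "AE x in MU. norm (\<phi> x *\<^sub>R f x) \<le> C * norm (f x)" using C by (simp add: mult_right_mono)
  qed
qed

lemma test_pderiv_L2:
  assumes \<phi>: "test_fun U \<phi>" shows "L2 MU (pderiv i \<phi>)"
proof -
  have [measurable]: "grad \<phi> \<in> borel_measurable MU" by (rule test_fun_measurable(2)[OF \<phi>])
  have "(\<lambda>x. grad \<phi> x \<bullet> axis i 1) \<in> borel_measurable MU" by measurable
  moreover have "(\<lambda>x. grad \<phi> x \<bullet> axis i 1) = pderiv i \<phi>" by (simp add: grad_axis)
  moreover have "\<bar>pderiv i \<phi> x\<bar> \<le> norm (grad \<phi> x)" for x
    using component_le_norm_cart[of "grad \<phi> x" i] by (simp add: grad_def)
  ultimately show ?thesis
    by (intro L2_bound[OF test_L2(2)[OF \<phi>], where K = 1]) auto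
qed

lemma test_axis_L2:
  assumes \<phi>: "test_fun U \<phi>" shows "L2 MU (\<lambda>x. \<phi> x *\<^sub>R (axis i 1 :: real^'n))"
proof (rule test_scaleR_L2[OF \<phi>])
  interpret finite_measure MU by (rule finite_MU)
  show "L2 MU (\<lambda>x. axis i 1 :: real^'n)" by (simp add: L2_def)
qed

lemma e_test_L2: "test_fun U \<phi> \<Longrightarrow> L2 MU (\<lambda>x. e x * \<phi> x)"
  using test_scaleR_L2[OF _ e_L2, of \<phi>] by (simp add: mult.commute)

lemma A_L2: "L2 MU w \<Longrightarrow> L2 MU (\<lambda>x. w x v* A x)"
  by (rule L2_vector_matrix_mult[OF _ A_measurable A_bounded])

lemma A_mult_L2:
  assumes "L2 MU w" shows "L2 MU (\<lambda>x. A x *v w x)"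
proof -
  have "AE x in MU. \<forall>i j. \<bar>transpose (A x) $ i $ j\<bar> \<le> K"
    using A_bounded by eventually_elim (simp add: transpose_def)
  then have "L2 MU (\<lambda>x. w x v* transpose (A x))"
    using A_measurable by (intro L2_vector_matrix_mult[OF assms]) (auto simp: transpose_def)
  then show ?thesis by simp
qed

text \<open>Both the energy inner product and the bilinear form of the equation become \<open>L\<^sup>2\<close> inner products of
  the augmented gradient \<open>(\<phi>, \<nabla>\<phi>, \<surd>c \<phi>)\<close>: the form is its product with \<open>(0, \<psi> B + A\<^sup>T \<nabla>\<psi>, \<surd>c \<psi>)\<close>.\<close>

definition Z :: "(real^'n \<Rightarrow> real) \<Rightarrow> real^'n \<Rightarrow> real \<times> (real^'n) \<times> real" where
  "Z \<phi> x = (\<phi> x, grad \<phi> x, e x * \<phi> x)"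

definition S :: "(real^'n \<Rightarrow> real) \<Rightarrow> real^'n \<Rightarrow> real \<times> (real^'n) \<times> real" where
  "S \<phi> x = (0, \<phi> x *\<^sub>R B x + grad \<phi> x v* A x, e x * \<phi> x)"

lemma Z_L2: "test_fun U \<phi> \<Longrightarrow> L2 MU (Z \<phi>)"
  unfolding Z_def[abs_def] by (intro L2_Pair test_L2 e_test_L2)

lemma S_L2:
  assumes \<phi>: "test_fun U \<phi>" shows "L2 MU (S \<phi>)"
proof -
  have "L2 MU (\<lambda>x. 0::real)" by (simp add: L2_def)
  from L2_Pair[OF this L2_Pair[OF L2_add[OF test_scaleR_L2[OF \<phi> B_L2] A_L2[OF test_L2(2)[OF \<phi>]]] e_test_L2[OF \<phi>]]]
  show ?thesis by (simp add: S_def[abs_def])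
qed

lemma Z_add: "test_fun U f \<Longrightarrow> test_fun U g \<Longrightarrow> Z (\<lambda>x. f x + g x) x = Z f x + Z g x"
  by (simp add: Z_def grad_add algebra_simps)

lemma Z_scl: "test_fun U f \<Longrightarrow> Z (\<lambda>x. r * f x) x = r *\<^sub>R Z f x"
  by (simp add: Z_def grad_cmult algebra_simps)

lemma vector_matrix_mult_add: "(v + w) v* a = v v* a + w v* (a :: real^'n^'n)"
  by (simp add: vector_matrix_mult_def vec_eq_iff algebra_simps sum.distrib)

lemma vector_matrix_mult_scaleR: "(r *\<^sub>R v) v* a = r *\<^sub>R (v v* (a :: real^'n^'n))"
  by (simp add: vector_matrix_mult_def vec_eq_iff sum_distrib_left mult.assoc)

lemma S_add: "test_fun U f \<Longrightarrow> test_fun U g \<Longrightarrow> S (\<lambda>x. f x + g x) x = S f x + S g x"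
  by (simp add: S_def grad_add vector_matrix_mult_add algebra_simps)

lemma S_scl: "test_fun U f \<Longrightarrow> S (\<lambda>x. r * f x) x = r *\<^sub>R S f x"
  by (simp add: S_def grad_cmult vector_matrix_mult_scaleR algebra_simps)

text \<open>The third component is a separate \<open>L^2\<close> function \<open>z\<close>, since in
  the limit of test functions it is identified with \<open>e u\<close> only almost everywhere. Its
  square-integrability turns the potential term into an \<open>L^2\<close> product.\<close>

lemma weak_form_eq:
  assumes u: "L2 MU u" and G: "L2 MU G" and z: "L2 MU z" and zu: "AE x in MU. z x = e x * u x"
    and \<phi>: "test_fun U \<phi>"
  shows "(\<integral>x. (u x, G x, z x) \<bullet> S \<phi> x \<partial>MU)
    = (\<integral>x. (A x *v G x) \<bullet> grad \<phi> x \<partial>MU) + (\<integral>x. (B x \<bullet> G x) * \<phi> x \<partial>MU) + (\<integral>x. c x * u x * \<phi> x \<partial>MU)"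
    and "integrable MU (\<lambda>x. (A x *v G x) \<bullet> grad \<phi> x)"
proof -
  have [measurable]: "u \<in> borel_measurable MU" "z \<in> borel_measurable MU" "\<phi> \<in> borel_measurable MU"
      "c \<in> borel_measurable MU" "e \<in> borel_measurable MU"
    using u z e_L2 test_fun_measurable[OF \<phi>] c_integrable by (auto simp: L2_def)
  have A_eq: "G x \<bullet> (grad \<phi> x v* A x) = (A x *v G x) \<bullet> grad \<phi> x" for x
    by (metis dot_lmul_matrix inner_commute)
  have I1: "integrable MU (\<lambda>x. (A x *v G x) \<bullet> grad \<phi> x)"
    using L2_inner_integrable[OF G A_L2[OF test_L2(2)[OF \<phi>]]] by (simp add: A_eq)
  have B_eq: "G x \<bullet> (\<phi> x *\<^sub>R B x) = (B x \<bullet> G x) * \<phi> x" for x by (simp add: inner_commute mult.commute)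
  have I2: "integrable MU (\<lambda>x. (B x \<bullet> G x) * \<phi> x)"
    using L2_inner_integrable[OF G test_scaleR_L2[OF \<phi> B_L2]] unfolding B_eq .
  have I3: "integrable MU (\<lambda>x. z x * (e x * \<phi> x))"
    using L2_inner_integrable[OF z e_test_L2[OF \<phi>]] by simp
  have "(\<integral>x. z x * (e x * \<phi> x) \<partial>MU) = (\<integral>x. c x * u x * \<phi> x \<partial>MU)"
  proof (rule integral_cong_AE)
    show "AE x in MU. z x * (e x * \<phi> x) = c x * u x * \<phi> x"
      using zu c_nonneg
    proof eventually_elim
      case (elim x)
      have "z x * (e x * \<phi> x) = (e x * e x) * (u x * \<phi> x)" using elim by simp
      then show ?case using elim by (simp add: e_mult_self)
    qed
  qed measurable
  moreover have "(u x, G x, z x) \<bullet> S \<phi> x = ((B x \<bullet> G x) * \<phi> x + (A x *v G x) \<bullet> grad \<phi> x) + z x * (e x * \<phi> x)" for x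
    by (simp only: S_def inner_Pair inner_add_right A_eq B_eq) simp
  ultimately show "(\<integral>x. (u x, G x, z x) \<bullet> S \<phi> x \<partial>MU)
    = (\<integral>x. (A x *v G x) \<bullet> grad \<phi> x \<partial>MU) + (\<integral>x. (B x \<bullet> G x) * \<phi> x \<partial>MU) + (\<integral>x. c x * u x * \<phi> x \<partial>MU)"
    using I1 I2 I3 by simp
  show "integrable MU (\<lambda>x. (A x *v G x) \<bullet> grad \<phi> x)" by fact
qed

text \<open>Taking \<open>snd\<close> drops the value of the function and keeps the gradient and the
  weighted value, which are the parts that coercivity controls; the value is recovered by the
  Poincare inequality.\<close>

definition b :: "(real^'n \<Rightarrow> real) \<Rightarrow> (real^'n \<Rightarrow> real) \<Rightarrow> real" where
  "b \<phi> \<psi> = (\<integral>x. snd (Z \<phi> x) \<bullet> snd (Z \<psi> x) \<partial>MU)"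

lemma b_integrable: "test_fun U \<phi> \<Longrightarrow> test_fun U \<psi> \<Longrightarrow> integrable MU (\<lambda>x. snd (Z \<phi> x) \<bullet> snd (Z \<psi> x))"
  by (intro L2_inner_integrable L2_snd Z_L2)

lemma b_self:
  assumes "test_fun U \<phi>"
  shows "b \<phi> \<phi> = energy U \<phi> + (\<integral>x. (e x * \<phi> x)\<^sup>2 \<partial>MU)"
proof -
  have "snd (Z \<phi> x) \<bullet> snd (Z \<phi> x) = (norm (grad \<phi> x))\<^sup>2 + (e x * \<phi> x)\<^sup>2" for x
    by (simp add: Z_def inner_prod_def power2_norm_eq_inner) (simp add: power2_eq_square)
  then show ?thesis
    using test_L2(2)[OF assms] e_test_L2[OF assms] by (simp add: b_def energy_def L2_def)
qed

lemma energy_le_b: "test_fun U \<phi> \<Longrightarrow> energy U \<phi> \<le> b \<phi> \<phi>"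
  by (simp add: b_self)

sublocale test: inner_form "{\<phi>. test_fun U \<phi>}" "\<lambda>f g x. f x + g x" "\<lambda>r f x. r * f x" b
proof
  fix f g h :: "real^'n \<Rightarrow> real" and r :: real
  show "{\<phi>. test_fun U \<phi>} \<noteq> {}" using test_fun_zero by blast
  assume f: "f \<in> {\<phi>. test_fun U \<phi>}"
  show "(\<lambda>x. r * f x) \<in> {\<phi>. test_fun U \<phi>}" using f test_fun_cmult by simp
  show "0 \<le> b f f" by (simp add: b_def)
  assume g: "g \<in> {\<phi>. test_fun U \<phi>}"
  show "b (\<lambda>x. r * f x) g = r * b f g" using f by (simp add: b_def Z_scl)
  show "(\<lambda>x. f x + g x) \<in> {\<phi>. test_fun U \<phi>}" using f g test_fun_add by simp
  show "b f g = b g f" by (simp add: b_def inner_commute)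
  assume h: "h \<in> {\<phi>. test_fun U \<phi>}"
  show "b (\<lambda>x. f x + g x) h = b f h + b g h"
    using f g h b_integrable by (simp add: b_def Z_add inner_add_left)
qed

text \<open>Ellipticity controls the gradient part of \<open>b\<close> with factor
  \<open>lam\<close>, the potential term is its other part with factor 1, and the drift term is
  nonnegative; hence the constant \<open>min lam 1\<close>.\<close>

lemma coercive:
  assumes \<phi>: "test_fun U \<phi>"
  shows "min lam 1 * b \<phi> \<phi> \<le> (\<integral>x. Z \<phi> x \<bullet> S \<phi> x \<partial>MU)"
proof -
  note form = weak_form_eq[OF test_L2[OF \<phi>] e_test_L2[OF \<phi>] AE_I2[OF refl] \<phi>]
  have 1: "lam * energy U \<phi> \<le> (\<integral>x. (A x *v grad \<phi> x) \<bullet> grad \<phi> x \<partial>MU)"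
  proof -
    have "(\<integral>x. lam * (norm (grad \<phi> x))\<^sup>2 \<partial>MU) \<le> (\<integral>x. (A x *v grad \<phi> x) \<bullet> grad \<phi> x \<partial>MU)"
    proof (rule integral_mono_AE)
      show "integrable MU (\<lambda>x. lam * (norm (grad \<phi> x))\<^sup>2)" using test_L2(2)[OF \<phi>] by (simp add: L2_def)
      show "AE x in MU. lam * (norm (grad \<phi> x))\<^sup>2 \<le> (A x *v grad \<phi> x) \<bullet> grad \<phi> x"
        using ellipticity by eventually_elim blast
    qed (rule form)
    then show ?thesis by (simp add: energy_def)
  qed
  have 2: "(\<integral>x. (B x \<bullet> grad \<phi> x) * \<phi> x \<partial>MU) \<ge> 0"
  proof -
    have "0 \<le> (\<integral>x. B x \<bullet> grad (\<lambda>x. \<phi> x * \<phi> x) x \<partial>MU)"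
      by (intro B_div test_fun_mult \<phi>) simp
    also have "\<dots> = (\<integral>x. 2 * ((B x \<bullet> grad \<phi> x) * \<phi> x) \<partial>MU)"
      by (rule Bochner_Integration.integral_cong[OF refl])
        (simp only: grad_mult[OF \<phi> \<phi>] inner_add_right inner_scaleR_right, simp)
    finally show ?thesis by simp
  qed
  have 3: "(\<integral>x. c x * \<phi> x * \<phi> x \<partial>MU) = (\<integral>x. (e x * \<phi> x)\<^sup>2 \<partial>MU)"
  proof (rule integral_cong_AE)
    have [measurable]: "\<phi> \<in> borel_measurable MU" "c \<in> borel_measurable MU" "e \<in> borel_measurable MU"
      using e_L2 test_fun_measurable[OF \<phi>] c_integrable by (auto simp: L2_def)
    show "(\<lambda>x. c x * \<phi> x * \<phi> x) \<in> borel_measurable MU" "(\<lambda>x. (e x * \<phi> x)\<^sup>2) \<in> borel_measurable MU" by measurable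
    show "AE x in MU. c x * \<phi> x * \<phi> x = (e x * \<phi> x)\<^sup>2"
      using c_nonneg
    proof eventually_elim
      case (elim x)
      have "(e x * \<phi> x)\<^sup>2 = (e x * e x) * (\<phi> x * \<phi> x)" by (simp add: power2_eq_square)
      then show ?case using elim by (simp add: e_mult_self)
    qed
  qed
  have "min lam 1 * b \<phi> \<phi> = min lam 1 * energy U \<phi> + min lam 1 * (\<integral>x. (e x * \<phi> x)\<^sup>2 \<partial>MU)"
    by (simp add: b_self[OF \<phi>] algebra_simps)
  also have "\<dots> \<le> lam * energy U \<phi> + 1 * (\<integral>x. (e x * \<phi> x)\<^sup>2 \<partial>MU)"
    by (intro add_mono mult_right_mono) (auto simp: energy_nonneg)
  also have "\<dots> \<le> (\<integral>x. (\<phi> x, grad \<phi> x, e x * \<phi> x) \<bullet> S \<phi> x \<partial>MU)"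
    unfolding form(1) using 1 2 3 by simp
  finally show ?thesis by (simp add: Z_def)
qed

text \<open>Sequences that are Cauchy for \<open>b\<close> are Cauchy in \<open>L^2\<close> for the
  full triples, hence converge to some \<open>h\<close>. As the form is an \<open>L^2\<close>
  product with the fixed function \<open>S \<phi>\<close>, the equation passes to the limit. The
  data enter only through integrability against test functions and a bound by the energy.\<close>

theorem existence:
  assumes f: "\<And>\<phi>. test_fun U \<phi> \<Longrightarrow> integrable MU (\<lambda>x. f x * \<phi> x)"
    and Cf: "\<And>\<phi>. test_fun U \<phi> \<Longrightarrow> (\<integral>x. f x * \<phi> x \<partial>MU)\<^sup>2 \<le> Cf * energy U \<phi>" "Cf \<ge> 0"
  shows "\<exists>u G. weak_sol U A B c f u G \<and> (\<integral>x. (norm (G x))\<^sup>2 \<partial>MU) \<le> 4 * Cf / (min lam 1)\<^sup>2"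
proof -
  define \<alpha> where "\<alpha> = min lam 1"
  have \<alpha>: "\<alpha> > 0" using lam_pos by (simp add: \<alpha>_def)
  define a where "a \<psi> \<phi> = (\<integral>x. Z \<psi> x \<bullet> S \<phi> x \<partial>MU)" for \<psi> \<phi>
  define L where "L \<phi> = (\<integral>x. f x * \<phi> x \<partial>MU)" for \<phi>
  have a_int: "integrable MU (\<lambda>x. Z \<psi> x \<bullet> S \<phi> x)" if "test_fun U \<psi>" "test_fun U \<phi>" for \<psi> \<phi>
    using that by (intro L2_inner_integrable Z_L2 S_L2)
  have "\<exists>X. (\<forall>k. X k \<in> {\<phi>. test_fun U \<phi>}) \<and> test.cauchy2 X \<and> (\<forall>y\<in>{\<phi>. test_fun U \<phi>}. (\<lambda>k. a (X k) y) \<longlonglongrightarrow> L y) \<and>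
     (\<forall>k. b (X k) (X k) \<le> 4 * Cf / \<alpha>\<^sup>2 + 3 / real (Suc k))"
  proof (rule test.Lions_sequence)
    show "test.linear_form (\<lambda>y. a y \<phi>)" if "\<phi> \<in> {\<phi>. test_fun U \<phi>}" for \<phi>
      using that a_int by (auto simp: test.linear_form_def a_def Z_add Z_scl inner_add_left)
    show "test.linear_form (a \<phi>)" if "\<phi> \<in> {\<phi>. test_fun U \<phi>}" for \<phi>
      using that a_int by (auto simp: test.linear_form_def a_def S_add S_scl inner_add_right)
    show "test.linear_form L"
      using f by (auto simp: test.linear_form_def L_def algebra_simps)
    show "\<exists>C\<ge>0. \<forall>y\<in>{\<phi>. test_fun U \<phi>}. (a y \<phi>)\<^sup>2 \<le> C * b y y" if "\<phi> \<in> {\<phi>. test_fun U \<phi>}" for \<phi>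
    \<comment> \<open>The first component of \<open>S \<phi>\<close> is zero, so the product with
      \<open>Z \<psi>\<close> involves only the components measured by \<open>b\<close>, and
      Cauchy-Schwarz gives this constant.\<close>
    proof (intro exI[of _ "\<integral>x. (norm (snd (S \<phi> x)))\<^sup>2 \<partial>MU"] conjI ballI)
      fix \<psi> assume "\<psi> \<in> {\<phi>. test_fun U \<phi>}"
      then have \<psi>: "test_fun U \<psi>" by simp
      have \<phi>: "test_fun U \<phi>" using that by simp
      have "Z \<psi> x \<bullet> S \<phi> x = snd (Z \<psi> x) \<bullet> snd (S \<phi> x)" for x
        by (simp add: S_def inner_prod_def)
      then have "(a \<psi> \<phi>)\<^sup>2 \<le> (\<integral>x. (norm (snd (Z \<psi> x)))\<^sup>2 \<partial>MU) * (\<integral>x. (norm (snd (S \<phi> x)))\<^sup>2 \<partial>MU)"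
        unfolding a_def using L2_inner_Cauchy_Schwarz[OF L2_snd[OF Z_L2[OF \<psi>]] L2_snd[OF S_L2[OF \<phi>]]] by simp
      also have "(\<integral>x. (norm (snd (Z \<psi> x)))\<^sup>2 \<partial>MU) = b \<psi> \<psi>" by (simp add: b_def power2_norm_eq_inner)
      finally show "(a \<psi> \<phi>)\<^sup>2 \<le> (\<integral>x. (norm (snd (S \<phi> x)))\<^sup>2 \<partial>MU) * b \<psi> \<psi>" by (simp add: mult.commute)
    qed simp
    show "\<alpha> * b \<phi> \<phi> \<le> a \<phi> \<phi>" if "\<phi> \<in> {\<phi>. test_fun U \<phi>}" for \<phi>
      using coercive that by (simp add: \<alpha>_def a_def)
    show "(L \<phi>)\<^sup>2 \<le> Cf * b \<phi> \<phi>" if "\<phi> \<in> {\<phi>. test_fun U \<phi>}" for \<phi>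
    proof -
      have \<phi>: "test_fun U \<phi>" using that by simp
      show ?thesis
        using Cf(1)[OF \<phi>] mult_left_mono[OF energy_le_b[OF \<phi>] Cf(2)] unfolding L_def by linarith
    qed
  qed (use \<alpha> Cf in auto)
  then obtain X where X: "\<And>k. test_fun U (X k)" and cau: "test.cauchy2 X"
    and aX: "\<And>\<phi>. test_fun U \<phi> \<Longrightarrow> (\<lambda>k. a (X k) \<phi>) \<longlonglongrightarrow> L \<phi>"
    and bX: "\<And>k. b (X k) (X k) \<le> 4 * Cf / \<alpha>\<^sup>2 + 3 / real (Suc k)" by auto
  obtain P where P: "P > 0" "\<And>\<phi>. test_fun U \<phi> \<Longrightarrow> (\<integral>x. (\<phi> x)\<^sup>2 \<partial>MU) \<le> P * energy U \<phi>"
    using Poincare[OF open_U bounded_U] by blast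
  \<comment> \<open>The Poincare constant \<open>P\<close> accounts for the values, the 1 for the
    two components contained in \<open>b\<close>.\<close>
  have Zle: "(\<integral>x. (norm (Z (X i) x - Z (X j) x))\<^sup>2 \<partial>MU) \<le> (P + 1) * test.dist2 (X i) (X j)" for i j
  proof -
    let ?D = "\<lambda>x. X i x + (-1) * X j x"
    have D: "test_fun U ?D" using test_fun_add[OF X test_fun_cmult[OF X]] .
    have ZD: "Z (X i) x - Z (X j) x = Z ?D x" for x
      using Z_add[OF X[of i] test_fun_cmult[OF X[of j], of "-1"]] Z_scl[OF X[of j], of "-1"] by simp
    have dD: "test.dist2 (X i) (X j) = b ?D ?D" using X by (simp add: test.dist2_eq)
    have nZ: "(norm (Z ?D x))\<^sup>2 = (?D x)\<^sup>2 + snd (Z ?D x) \<bullet> snd (Z ?D x)" for x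
      unfolding power2_norm_eq_inner Z_def by (simp add: inner_prod_def power2_eq_square)
    have intD: "integrable MU (\<lambda>x. (?D x)\<^sup>2)"
      using test_L2(1)[OF D] by (simp add: L2_def)
    have "(\<integral>x. (norm (Z (X i) x - Z (X j) x))\<^sup>2 \<partial>MU) = (\<integral>x. (?D x)\<^sup>2 \<partial>MU) + b ?D ?D"
      unfolding ZD nZ b_def by (rule Bochner_Integration.integral_add[OF intD b_integrable[OF D D]])
    also have "\<dots> \<le> P * b ?D ?D + b ?D ?D"
      using P(2)[OF D] mult_left_mono[OF energy_le_b[OF D], of P] P(1) by linarith
    finally show ?thesis unfolding dD by (simp add: algebra_simps)
  qed
  have "\<exists>N. \<forall>i\<ge>N. \<forall>j\<ge>N. (\<integral>x. (norm (Z (X i) x - Z (X j) x))\<^sup>2 \<partial>MU) < s" if "s > 0" for s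
  proof -
    have "s / (P + 1) > 0" using that P by simp
    then obtain N where N: "\<And>i j. i \<ge> N \<Longrightarrow> j \<ge> N \<Longrightarrow> test.dist2 (X i) (X j) < s / (P + 1)"
      using cau unfolding test.cauchy2_def by blast
    have "(\<integral>x. (norm (Z (X i) x - Z (X j) x))\<^sup>2 \<partial>MU) < s" if "i \<ge> N" "j \<ge> N" for i j
    proof -
      have "(P + 1) * test.dist2 (X i) (X j) < (P + 1) * (s / (P + 1))"
        using N[OF that] P(1) by (intro mult_strict_left_mono) auto
      then show ?thesis using Zle[of i j] P(1) by simp
    qed
    then show ?thesis by blast
  qed
  then obtain h where h: "L2 MU h" "(\<lambda>k. \<integral>x. (norm (Z (X k) x - h x))\<^sup>2 \<partial>MU) \<longlonglongrightarrow> 0"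
    using L2_complete[of MU "\<lambda>k. Z (X k)", OF finite_MU Z_L2[OF X]] by blast
  define u where "u x = fst (h x)" for x
  define G where "G x = fst (snd (h x))" for x
  define z where "z x = snd (snd (h x))" for x
  have h_eq: "h x = (u x, G x, z x)" for x by (simp add: u_def G_def z_def)
  have u: "L2 MU u" and G: "L2 MU G" and z: "L2 MU z"
    unfolding u_def[abs_def] G_def[abs_def] z_def[abs_def] by (intro L2_fst L2_snd h)+
  have Zh: "L2 MU (\<lambda>x. Z (X k) x - h x)" for k by (intro L2_diff Z_L2 X h)
  have Xu: "(\<lambda>k. \<integral>x. (norm (X k x - u x))\<^sup>2 \<partial>MU) \<longlonglongrightarrow> 0"
  proof (rule integral_norm_square_tendsto_0[OF Zh _ _ h(2)])
    show "L2 MU (\<lambda>x. X k x - u x)" for k by (intro L2_diff test_L2 X u)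
    show "norm (X k x - u x) \<le> norm (Z (X k) x - h x)" for k x
      using norm_fst_le[of "X k x - u x" "(grad (X k) x - G x, e x * X k x - z x)"] by (simp add: Z_def h_eq)
  qed
  have XG: "(\<lambda>k. \<integral>x. (norm (grad (X k) x - G x))\<^sup>2 \<partial>MU) \<longlonglongrightarrow> 0"
  proof (rule integral_norm_square_tendsto_0[OF Zh _ _ h(2)])
    show "L2 MU (\<lambda>x. grad (X k) x - G x)" for k by (intro L2_diff test_L2 X G)
    show "norm (grad (X k) x - G x) \<le> norm (Z (X k) x - h x)" for k x
      using norm_snd_le[of "(grad (X k) x - G x, e x * X k x - z x)" "X k x - u x"]
        norm_fst_le[of "grad (X k) x - G x" "e x * X k x - z x"] by (simp add: Z_def h_eq)
  qed
  \<comment> \<open>Along an almost everywhere convergent subsequence the relation between the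
    components of \<open>Z\<close> is preserved pointwise.\<close>
  have zu: "AE x in MU. z x = e x * u x"
  proof -
    obtain r :: "nat \<Rightarrow> nat" where "AE x in MU. (\<lambda>k. Z (X (r k)) x) \<longlonglongrightarrow> h x"
      using L2_AE_subseq[of MU "\<lambda>k. Z (X k)", OF Z_L2[OF X] h] by blast
    then show ?thesis
    proof eventually_elim
      case (elim x)
      have "(\<lambda>k. X (r k) x) \<longlonglongrightarrow> u x" using tendsto_fst[OF elim] by (simp add: Z_def u_def)
      then have "(\<lambda>k. e x * X (r k) x) \<longlonglongrightarrow> e x * u x" by (intro tendsto_intros)
      moreover have "(\<lambda>k. e x * X (r k) x) \<longlonglongrightarrow> z x"
        using tendsto_snd[OF tendsto_snd[OF elim]] by (simp add: Z_def z_def)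
      ultimately show ?case using LIMSEQ_unique by blast
    qed
  qed
  have H: "H012 U u G"
    unfolding H012_def W12_def Lp_2_iff_L2 L2vec_iff_L2
  proof (intro conjI u G exI[of _ X] allI X)
    show "weak_grad U u G"
      unfolding weak_grad_def
    proof (intro allI impI)
      fix \<phi> i assume \<phi>: "test_fun U \<phi>"
      have l1: "(\<lambda>k. \<integral>x. X k x * pderiv i \<phi> x \<partial>MU) \<longlonglongrightarrow> (\<integral>x. u x * pderiv i \<phi> x \<partial>MU)"
        using L2_tendsto_inner[of MU "\<lambda>k. X k", OF test_L2(1)[OF X] u Xu test_pderiv_L2[OF \<phi>]] by simp
      have "(\<lambda>k. \<integral>x. grad (X k) x \<bullet> (\<phi> x *\<^sub>R axis i 1) \<partial>MU) \<longlonglongrightarrow> (\<integral>x. G x \<bullet> (\<phi> x *\<^sub>R axis i 1) \<partial>MU)"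
        by (rule L2_tendsto_inner[OF test_L2(2)[OF X] G XG test_axis_L2[OF \<phi>]])
      then have l2: "(\<lambda>k. - (\<integral>x. grad (X k) x \<bullet> (\<phi> x *\<^sub>R axis i 1) \<partial>MU)) \<longlonglongrightarrow> - (\<integral>x. G x $ i * \<phi> x \<partial>MU)"
        by (intro tendsto_minus) (simp add: inner_axis mult.commute)
      have "(\<integral>x. X k x * pderiv i \<phi> x \<partial>MU) = - (\<integral>x. grad (X k) x \<bullet> (\<phi> x *\<^sub>R axis i 1) \<partial>MU)" for k
        using integration_by_parts[OF open_U bounded_U X \<phi>, of k "axis i 1"] by (simp add: grad_axis mult.commute)
      then show "(\<integral>x. u x * pderiv i \<phi> x \<partial>MU) = - (\<integral>x. G x $ i * \<phi> x \<partial>MU)"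
        using l1 l2 LIMSEQ_unique by simp
    qed
    show "(\<lambda>k. W12_dist U (X k) u G) \<longlonglongrightarrow> 0"
    proof -
      have "(\<lambda>k. sqrt ((\<integral>x. (norm (X k x - u x))\<^sup>2 \<partial>MU) + (\<integral>x. (norm (grad (X k) x - G x))\<^sup>2 \<partial>MU))) \<longlonglongrightarrow> sqrt (0 + 0)"
        by (intro tendsto_intros Xu XG)
      then show ?thesis by (simp add: W12_dist_def)
    qed
  qed
  have cu: "integrable MU (\<lambda>x. c x * u x)"
  proof -
    have [measurable]: "u \<in> borel_measurable MU" "c \<in> borel_measurable MU" using u c_integrable by (auto simp: L2_def)
    have "integrable MU (\<lambda>x. e x * z x)" using L2_inner_integrable[OF e_L2 z] by simp
    moreover have "AE x in MU. e x * z x = c x * u x"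
      using zu c_nonneg
    proof eventually_elim
      case (elim x)
      have "e x * z x = (e x * e x) * u x" using elim by simp
      then show ?case using elim by (simp add: e_mult_self)
    qed
    moreover have "(\<lambda>x. c x * u x) \<in> borel_measurable MU" by measurable
    ultimately show ?thesis using integrable_cong_AE_imp by blast
  qed
  have eqn: "(\<integral>x. (A x *v G x) \<bullet> grad \<phi> x \<partial>MU) + (\<integral>x. (B x \<bullet> G x) * \<phi> x \<partial>MU) + (\<integral>x. c x * u x * \<phi> x \<partial>MU)
      = (\<integral>x. f x * \<phi> x \<partial>MU)" if \<phi>: "test_fun U \<phi>" for \<phi>
  proof -
    have "(\<lambda>k. a (X k) \<phi>) \<longlonglongrightarrow> (\<integral>x. h x \<bullet> S \<phi> x \<partial>MU)"
      unfolding a_def by (rule L2_tendsto_inner[OF Z_L2[OF X] h S_L2[OF \<phi>]])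
    then have "(\<integral>x. h x \<bullet> S \<phi> x \<partial>MU) = L \<phi>" using aX[OF \<phi>] LIMSEQ_unique by blast
    then show ?thesis unfolding L_def h_eq weak_form_eq(1)[OF u G z zu \<phi>] .
  qed
  have Gle: "(\<integral>x. (norm (G x))\<^sup>2 \<partial>MU) \<le> 4 * Cf / \<alpha>\<^sup>2"
  proof -
    let ?g = "\<integral>x. (norm (G x))\<^sup>2 \<partial>MU"
    have lim: "(\<lambda>k. \<integral>x. grad (X k) x \<bullet> G x \<partial>MU) \<longlonglongrightarrow> (\<integral>x. G x \<bullet> G x \<partial>MU)"
      by (rule L2_tendsto_inner[OF test_L2(2)[OF X] G XG G])
    have gg: "(\<integral>x. G x \<bullet> G x \<partial>MU) = ?g" by (simp add: power2_norm_eq_inner)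
    \<comment> \<open>Pairing the approximating gradients with the fixed limit \<open>G\<close> and
      applying Cauchy-Schwarz transfers their bound to \<open>G\<close> after division by
      \<open>?g\<close>.\<close>
    have "?g\<^sup>2 \<le> (4 * Cf / \<alpha>\<^sup>2 + 0) * ?g"
    proof (rule LIMSEQ_le)
      show "(\<lambda>k. (\<integral>x. grad (X k) x \<bullet> G x \<partial>MU)\<^sup>2) \<longlonglongrightarrow> ?g\<^sup>2"
        using tendsto_power[OF lim, of 2] by (simp only: gg)
      have "(\<lambda>k. 3 * (1 / real (Suc k))) \<longlonglongrightarrow> 3 * 0"
        by (intro tendsto_intros LIMSEQ_Suc[OF lim_1_over_n])
      then have "(\<lambda>k. 3 / real (Suc k)) \<longlonglongrightarrow> 0" by simp
      then show "(\<lambda>k. (4 * Cf / \<alpha>\<^sup>2 + 3 / real (Suc k)) * ?g) \<longlonglongrightarrow> (4 * Cf / \<alpha>\<^sup>2 + 0) * ?g"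
        by (intro tendsto_intros)
      show "\<exists>N. \<forall>k\<ge>N. (\<integral>x. grad (X k) x \<bullet> G x \<partial>MU)\<^sup>2 \<le> (4 * Cf / \<alpha>\<^sup>2 + 3 / real (Suc k)) * ?g"
      proof (intro exI[of _ 0] allI impI)
        fix k
        have "(\<integral>x. grad (X k) x \<bullet> G x \<partial>MU)\<^sup>2 \<le> energy U (X k) * ?g"
          unfolding energy_def by (rule L2_inner_Cauchy_Schwarz[OF test_L2(2)[OF X] G])
        also have "\<dots> \<le> (4 * Cf / \<alpha>\<^sup>2 + 3 / real (Suc k)) * ?g"
          using order_trans[OF energy_le_b[OF X] bX, of k] by (intro mult_right_mono) auto
        finally show "(\<integral>x. grad (X k) x \<bullet> G x \<partial>MU)\<^sup>2 \<le> (4 * Cf / \<alpha>\<^sup>2 + 3 / real (Suc k)) * ?g" .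
      qed
    qed
    then have "?g * ?g \<le> (4 * Cf / \<alpha>\<^sup>2) * ?g" by (simp add: power2_eq_square)
    moreover have "?g \<ge> 0" "4 * Cf / \<alpha>\<^sup>2 \<ge> 0" using Cf(2) by auto
    ultimately show ?thesis using mult_right_le_imp_le[of ?g ?g "4 * Cf / \<alpha>\<^sup>2"] by linarith
  qed
  show ?thesis
    using H cu eqn Gle unfolding weak_sol_def \<alpha>_def by blast
qed

end

section \<open>Smooth truncations and Stampacchia's lemma\<close>

text \<open>With \<open>y = 1/x\<close>, the derivative of \<open>p(y) exp(-y)\<close> with respect
  to \<open>x\<close> is \<open>y^2 (p(y) - p'(y)) exp(-y)\<close>.\<close>

primrec expinv_poly :: "nat \<Rightarrow> real poly" where
  "expinv_poly 0 = 1"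
| "expinv_poly (Suc j) = [:0, 0, 1:] * (expinv_poly j - Polynomial.pderiv (expinv_poly j))"

text \<open>\<open>expinv j\<close> is the \<^term>\<open>j\<close>-th derivative of \<open>expinv 0\<close>, i.e. of \<open>exp (- 1 / x)\<close> extended by zero.\<close>

definition expinv :: "nat \<Rightarrow> real \<Rightarrow> real" where
  "expinv j x = (if x > 0 then poly (expinv_poly j) (inverse x) * exp (- inverse x) else 0)"

lemma poly_mult_exp_neg_tendsto_0: "((\<lambda>y::real. poly q y * exp (- y)) \<longlongrightarrow> 0) at_top"
proof -
  have "((\<lambda>y. \<Sum>i\<le>degree q. coeff q i * (y ^ i / exp y)) \<longlongrightarrow> (\<Sum>i\<le>degree q. coeff q i * 0)) at_top"
    by (intro tendsto_intros tendsto_power_div_exp_0)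
  moreover have "poly q y * exp (- y) = (\<Sum>i\<le>degree q. coeff q i * (y ^ i / exp y))" for y
    by (simp add: poly_altdef sum_distrib_right exp_minus divide_inverse mult.assoc)
  ultimately show ?thesis by simp
qed

lemma DERIV_expinv: "(expinv j has_real_derivative expinv (Suc j) x) (at x)"
proof -
  consider "x > 0" | "x < 0" | "x = 0" by linarith
  then show ?thesis
  proof cases
    case 1
    let ?p = "expinv_poly j"
    have inv: "(inverse has_real_derivative - (inverse x * inverse x)) (at x)"
      using 1 DERIV_inverse[of x UNIV] by (simp add: power2_eq_square)
    have "((\<lambda>x. poly ?p (inverse x) * exp (- inverse x)) has_real_derivative
        poly (Polynomial.pderiv ?p) (inverse x) * (- (inverse x * inverse x)) * exp (- inverse x)
        + exp (- inverse x) * (inverse x * inverse x) * poly ?p (inverse x)) (at x)"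
      by (rule DERIV_mult DERIV_chain2[OF poly_DERIV inv] DERIV_cong[OF DERIV_chain2[OF DERIV_exp DERIV_minus[OF inv]]] | simp)+
    then have "((\<lambda>x. poly ?p (inverse x) * exp (- inverse x)) has_real_derivative expinv (Suc j) x) (at x)"
      by (rule DERIV_cong) (use 1 in \<open>simp add: expinv_def algebra_simps\<close>)
    then show ?thesis
      by (rule has_field_derivative_transform_within_open[of _ _ _ "{0<..}"]) (use 1 in \<open>auto simp: expinv_def\<close>)
  next
    case 2
    have "((\<lambda>x::real. 0) has_real_derivative expinv (Suc j) x) (at x)" using 2 by (simp add: expinv_def)
    then show ?thesis
      by (rule has_field_derivative_transform_within_open[of _ _ _ "{..<0}"]) (use 2 in \<open>auto simp: expinv_def\<close>)
  next
    case 3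
    \<comment> \<open>Division by \<open>h\<close> multiplies the polynomial in \<open>1/h\<close>
      by its variable, which is the \<open>pCons 0\<close>; the exponential still dominates.\<close>
    have "((\<lambda>h. expinv j h / h) \<longlongrightarrow> 0) (at_right 0)"
    proof -
      have "((\<lambda>h. poly (pCons 0 (expinv_poly j)) (inverse h) * exp (- inverse h)) \<longlongrightarrow> 0) (at_right 0)"
        by (rule filterlim_compose[OF poly_mult_exp_neg_tendsto_0 filterlim_inverse_at_top_right])
      moreover have "\<forall>\<^sub>F h in at_right 0. poly (pCons 0 (expinv_poly j)) (inverse h) * exp (- inverse h) = expinv j h / h"
        unfolding eventually_at_filter by (rule always_eventually) (auto simp: expinv_def divide_inverse)
      ultimately show ?thesis by (rule Lim_transform_eventually)
    qed
    moreover have "((\<lambda>h. expinv j h / h) \<longlongrightarrow> 0) (at_left 0)"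
    proof (rule Lim_transform_eventually[OF tendsto_const])
      show "\<forall>\<^sub>F h in at_left 0. 0 = expinv j h / h"
        unfolding eventually_at_filter by (rule always_eventually) (auto simp: expinv_def)
    qed
    ultimately have "((\<lambda>h. expinv j h / h) \<longlongrightarrow> 0) (at 0)" by (simp add: filterlim_split_at)
    then show ?thesis using 3 by (simp add: DERIV_def expinv_def)
  qed
qed

lemma expinv_nonpos: "x \<le> 0 \<Longrightarrow> expinv j x = 0"
  by (simp add: expinv_def)

lemma expinv_0_pos: "x > 0 \<Longrightarrow> expinv 0 x = exp (- inverse x)"
  by (simp add: expinv_def)

lemma expinv_0_bounds: "0 \<le> expinv 0 x" "expinv 0 x \<le> 1"
  by (auto simp: expinv_def)

lemma expinv_1_bounds: "0 \<le> expinv 1 x" "expinv 1 x \<le> 2"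
proof -
  have *: "expinv 1 x = inverse x * inverse x * exp (- inverse x)" if "x > 0"
    using that by (simp add: expinv_def)
  show "0 \<le> expinv 1 x" using * by (cases "x > 0") (auto simp: expinv_def)
  have "y * y * exp (- y) \<le> 2" if "y \<ge> 0" for y :: real
  proof -
    have "y * y \<le> 2 * exp y" using exp_lower_Taylor_quadratic[OF that] that by (simp add: power2_eq_square)
    then show ?thesis by (simp add: exp_minus field_simps)
  qed
  then show "expinv 1 x \<le> 2" using * by (cases "x > 0") (auto simp: expinv_def)
qed

text \<open>A nonnegative primitive that vanishes on the negative axis is needed because the sign
  condition on \<open>B\<close> can be used only against nonnegative test functions, here the
  primitive of the truncation applied to a test function.\<close>

lemma expinv_antiderivative:
  obtains \<Psi> where "\<And>x. (\<Psi> has_real_derivative expinv 0 x) (at x)" "\<And>x. x \<le> 0 \<Longrightarrow> \<Psi> x = 0" "\<And>x. \<Psi> x \<ge> 0"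
proof -
  have "isCont (expinv 0) x" for x using DERIV_expinv DERIV_isCont by blast
  then obtain F where F: "\<And>x. (F has_vector_derivative expinv 0 x) (at x)"
    using einterval_antiderivative[of "-\<infinity>" "\<infinity>" "expinv 0"] by auto
  define \<Psi> where "\<Psi> x = F x - F 0" for x
  have D: "(\<Psi> has_real_derivative expinv 0 x) (at x)" for x
    unfolding \<Psi>_def using F[of x] by (auto intro!: derivative_eq_intros simp: has_real_derivative_iff_has_vector_derivative)
  have neg: "\<Psi> x = 0" if "x \<le> 0" for x
  proof (cases "x = 0")
    case False
    then have "x < 0" using that by simp
    from MVT2[OF this D] obtain z where "z < 0" "\<Psi> 0 - \<Psi> x = (0 - x) * expinv 0 z" by blast
    then show ?thesis by (simp add: expinv_nonpos \<Psi>_def)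
  qed (simp add: \<Psi>_def)
  have "\<Psi> x \<ge> 0" for x
  proof (cases "x > 0")
    case True
    from MVT2[OF this D] obtain z where "\<Psi> x - \<Psi> 0 = (x - 0) * expinv 0 z" by blast
    then show ?thesis using True expinv_0_bounds(1)[of z] by (simp add: \<Psi>_def)
  qed (simp add: neg)
  with D neg show thesis using that by blast
qed

text \<open>The smooth substitute for the truncation \<open>s \<mapsto> min (max (s - k) 0) \<delta>\<close>: it is \<^term>\<open>E 1\<close>, with
  primitive \<^term>\<open>E 0\<close> and derivative \<^term>\<open>E 2\<close>.\<close>

lemma smooth_truncation:
  fixes k \<delta> :: real
  assumes k: "k \<ge> 0" and \<delta>: "\<delta> > 0"
  obtains E :: "nat \<Rightarrow> real \<Rightarrow> real" where
    "\<And>j s. (E j has_real_derivative E (Suc j) s) (at s)" "E 0 0 = 0" "E 1 0 = 0" "\<And>s. E 0 s \<ge> 0"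
    "\<And>s. 0 \<le> E 1 s" "\<And>s. E 1 s \<le> \<delta>" "\<And>s. s \<le> k \<Longrightarrow> E 1 s = 0"
    "\<And>s. 0 \<le> E 2 s" "\<And>s. E 2 s \<le> 2" "\<And>s. s > k + \<delta> \<Longrightarrow> E 1 s > \<delta> * exp (-1)"
proof -
  obtain \<Psi> where \<Psi>: "\<And>x. (\<Psi> has_real_derivative expinv 0 x) (at x)" "\<And>x. x \<le> 0 \<Longrightarrow> \<Psi> x = 0" "\<And>x. \<Psi> x \<ge> 0"
    using expinv_antiderivative by blast
  \<comment> \<open>The scaling gives \<open>E 1\<close> values in \<open>[0, \<delta>]\<close> and
    a slope \<open>E 2\<close> between 0 and 2 whatever \<open>\<delta>\<close> is. The constant
    \<open>exp (-1)\<close> in the lower bound is the value of \<open>expinv 0\<close> at 1.\<close>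
  define E where "E j s = (case j of 0 \<Rightarrow> \<delta>\<^sup>2 * \<Psi> ((s - k) / \<delta>) | Suc i \<Rightarrow> \<delta> * expinv i ((s - k) / \<delta>) / \<delta> ^ i)" for j s
  have lin: "((\<lambda>s. (s - k) / \<delta>) has_real_derivative 1 / \<delta>) (at s)" for s
    using \<delta> by (auto intro!: derivative_eq_intros)
  have E0: "E 0 = (\<lambda>s. \<delta>\<^sup>2 * \<Psi> ((s - k) / \<delta>))" and ES: "E (Suc i) = (\<lambda>s. \<delta> * expinv i ((s - k) / \<delta>) / \<delta> ^ i)" for i
    by (auto simp: E_def)
  have 1: "E 1 s = \<delta> * expinv 0 ((s - k) / \<delta>)" and 2: "E 2 s = expinv 1 ((s - k) / \<delta>)" for s
    using \<delta> by (simp_all add: E_def numeral_2_eq_2)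
  show thesis
  proof (rule that[of E])
    show "(E j has_real_derivative E (Suc j) s) (at s)" for j s
    proof (cases j)
      case 0
      show ?thesis unfolding 0 E0 ES
        by (rule DERIV_cong[OF DERIV_cmult[OF DERIV_chain2[OF \<Psi>(1) lin]]]) (use \<delta> in \<open>simp add: power2_eq_square\<close>)
    next
      case (Suc i)
      show ?thesis unfolding Suc ES
        by (rule DERIV_cong[OF DERIV_cdivide[OF DERIV_cmult[OF DERIV_chain2[OF DERIV_expinv lin]]]]) (use \<delta> in simp)
    qed
    have "(0 - k) / \<delta> \<le> 0" using k \<delta> by simp
    then show "E 0 0 = 0" "E 1 0 = 0" unfolding E0 1 by (simp_all add: \<Psi>(2) expinv_nonpos)
    show "E 0 s \<ge> 0" for s using \<Psi>(3) by (simp add: E0)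
    show "0 \<le> E 1 s" "E 1 s \<le> \<delta>" for s unfolding 1 using expinv_0_bounds[of "(s - k) / \<delta>"] \<delta> by (simp_all add: mult_left_le)
    show "E 1 s = 0" if "s \<le> k" for s
    proof -
      have "(s - k) / \<delta> \<le> 0" using that \<delta> by (simp add: divide_nonpos_pos)
      then show ?thesis unfolding 1 by (simp add: expinv_nonpos)
    qed
    show "0 \<le> E 2 s" "E 2 s \<le> 2" for s unfolding 2 using expinv_1_bounds[of "(s - k) / \<delta>"] by simp_all
    show "E 1 s > \<delta> * exp (-1)" if "s > k + \<delta>" for s
    proof -
      have y: "(s - k) / \<delta> > 1" using that \<delta> by (simp add: field_simps)
      then have "inverse ((s - k) / \<delta>) < 1" by (rule inverse_less_1_iff[THEN iffD2, OF disjI2])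
      then have "exp (-1) < exp (- inverse ((s - k) / \<delta>))" by simp
      then show ?thesis unfolding 1 using y \<delta> by (simp add: expinv_0_pos)
    qed
  qed
qed

text \<open>Along the levels \<open>H (1 - 2^(-n))\<close> the gaps shrink geometrically and
  \<open>a\<close> decays at least like \<open>2^(-n \<mu>)\<close>: the superlinear exponent
  \<open>\<beta>\<close> outweighs the growth of the factor in the gap once \<open>H\<close> is
  large enough. Monotonicity transfers the decay to \<open>H\<close>.\<close>

lemma Stampacchia:
  fixes a :: "real \<Rightarrow> real"
  assumes nonneg: "\<And>s. a s \<ge> 0" and mono: "\<And>s t. s \<le> t \<Longrightarrow> a t \<le> a s"
    and step: "\<And>k \<delta>. k \<ge> 0 \<Longrightarrow> \<delta> > 0 \<Longrightarrow> a (k + \<delta>) \<le> D * \<delta> powr (- \<gamma>) * a k powr \<beta>"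
    and \<beta>: "\<beta> > 1" and \<gamma>: "\<gamma> > 0" and D: "D \<ge> 0" and V: "V > 0" "a 0 \<le> V"
    and H: "H > 0" "D * V powr (\<beta> - 1) * 2 powr (\<gamma> + \<gamma> / (\<beta> - 1)) \<le> H powr \<gamma>"
  shows "a H = 0"
proof -
  \<comment> \<open>The rate that reproduces itself: in the induction step the exponents of 2 add up
    to \<open>- (n + 1) \<mu>\<close> precisely because
    \<open>\<gamma> = \<mu> (\<beta> - 1)\<close>.\<close>
  define \<mu> where "\<mu> = \<gamma> / (\<beta> - 1)"
  have \<mu>: "\<mu> > 0" using \<beta> \<gamma> by (simp add: \<mu>_def)
  have \<gamma>_eq: "\<gamma> = \<mu> * (\<beta> - 1)" using \<beta> by (simp add: \<mu>_def)
  define k where "k n = H * (1 - 2 powr (- real n))" for n :: nat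
  have k0: "k n \<ge> 0" for n
  proof -
    have "(2::real) powr (- real n) \<le> 2 powr 0" by (intro powr_mono) auto
    then show ?thesis using H by (simp add: k_def)
  qed
  have kS: "k (Suc n) = k n + H * 2 powr (- real (Suc n))" for n
  proof -
    have "(2::real) powr (- real n) = 2 * 2 powr (- real (Suc n))"
      by (simp add: powr_add[symmetric] powr_mult_base)
    then show ?thesis by (simp add: k_def algebra_simps)
  qed
  have bound: "a (k n) \<le> V * 2 powr (- real n * \<mu>)" for n
  proof (induction n)
    case 0
    then show ?case using V(2) by (simp add: k_def)
  next
    case (Suc n)
    let ?\<delta> = "H * 2 powr (- real (Suc n))"
    have "a (k (Suc n)) \<le> D * ?\<delta> powr (- \<gamma>) * a (k n) powr \<beta>"
      unfolding kS using k0 H by (intro step) auto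
    also have "\<dots> \<le> D * ?\<delta> powr (- \<gamma>) * (V * 2 powr (- real n * \<mu>)) powr \<beta>"
      using Suc nonneg D \<beta> by (intro mult_left_mono powr_mono2) auto
    also have "\<dots> = (D * V powr (\<beta> - 1) * H powr (- \<gamma>)) * V * 2 powr (real (Suc n) * \<gamma> - real n * \<mu> * \<beta>)"
    proof -
      have "?\<delta> powr (- \<gamma>) = H powr (- \<gamma>) * 2 powr (real (Suc n) * \<gamma>)"
      proof -
        have "?\<delta> powr (- \<gamma>) = H powr (- \<gamma>) * (2 powr (- real (Suc n))) powr (- \<gamma>)"
          by (rule powr_mult)
        also have "(2 powr (- real (Suc n))) powr (- \<gamma>) = (2::real) powr (real (Suc n) * \<gamma>)"
          unfolding powr_powr by (simp only: minus_mult_minus)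
        finally show ?thesis .
      qed
      moreover have "(V * 2 powr (- real n * \<mu>)) powr \<beta> = V powr \<beta> * 2 powr (- real n * \<mu> * \<beta>)"
        using V by (simp add: powr_mult powr_powr)
      moreover have "V powr \<beta> = V powr (\<beta> - 1) * V"
        using V by (simp add: powr_diff)
      moreover have "2 powr (real (Suc n) * \<gamma>) * 2 powr (- real n * \<mu> * \<beta>) = (2::real) powr (real (Suc n) * \<gamma> - real n * \<mu> * \<beta>)"
        by (simp add: powr_add[symmetric])
      ultimately show ?thesis by (simp only: mult_ac)
    qed
    also have "\<dots> \<le> 2 powr (- (\<gamma> + \<mu>)) * V * 2 powr (real (Suc n) * \<gamma> - real n * \<mu> * \<beta>)"
    proof -
      have "D * V powr (\<beta> - 1) * H powr (- \<gamma>) \<le> 2 powr (- (\<gamma> + \<mu>))"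
      proof -
        have "(D * V powr (\<beta> - 1)) * 2 powr (\<gamma> + \<mu>) \<le> H powr \<gamma>" using H(2) by (simp add: \<mu>_def)
        then have "D * V powr (\<beta> - 1) / H powr \<gamma> \<le> 1 / 2 powr (\<gamma> + \<mu>)" using H(1) by (simp add: field_simps)
        moreover have "H powr (- \<gamma>) = 1 / H powr \<gamma>" "2 powr (- (\<gamma> + \<mu>)) = 1 / (2::real) powr (\<gamma> + \<mu>)"
          by (simp_all only: powr_minus inverse_eq_divide)
        ultimately show ?thesis by simp
      qed
      then show ?thesis using V by (intro mult_right_mono) auto
    qed
    also have "\<dots> = V * (2 powr (- (\<gamma> + \<mu>)) * 2 powr (real (Suc n) * \<gamma> - real n * \<mu> * \<beta>))" by simp
    also have "2 powr (- (\<gamma> + \<mu>)) * 2 powr (real (Suc n) * \<gamma> - real n * \<mu> * \<beta>) = (2::real) powr (- real (Suc n) * \<mu>)"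
      unfolding powr_add[symmetric] by (rule arg_cong[of _ _ "\<lambda>x. 2 powr x"]) (simp add: \<gamma>_eq algebra_simps)
    finally show ?case .
  qed
  have "a H \<le> V * 2 powr (- real n * \<mu>)" for n
  proof -
    have "k n \<le> H" using H by (simp add: k_def)
    then show ?thesis using mono bound order_trans by blast
  qed
  moreover have "(\<lambda>n. V * 2 powr (- real n * \<mu>)) \<longlonglongrightarrow> V * 0"
  proof (intro tendsto_intros)
    have "(\<lambda>n. (2 powr (- \<mu>)) ^ n) \<longlonglongrightarrow> 0"
    proof (rule LIMSEQ_realpow_zero)
      have "(2::real) powr (- \<mu>) < 2 powr 0" using \<mu> by (intro powr_less_mono) auto
      then show "(2::real) powr (- \<mu>) < 1" by simp
    qed simp
    moreover have "(2 powr (- \<mu>)) ^ n = (2::real) powr (- real n * \<mu>)" for n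
      by (simp add: powr_powr[symmetric] powr_realpow[symmetric] powr_powr mult.commute)
    ultimately show "(\<lambda>n. (2::real) powr (- real n * \<mu>)) \<longlonglongrightarrow> 0" by simp
  qed
  ultimately have "a H \<le> 0" using LIMSEQ_le_const[of "\<lambda>n. V * 2 powr (- real n * \<mu>)" 0 "a H"] by auto
  then show ?thesis using nonneg[of H] by simp
qed

section \<open>Testing with truncations of the solution\<close>

lemma H012_L2:
  assumes "H012 U u G" shows "L2 (lebesgue_on U) u" "L2 (lebesgue_on U) G"
  using assms by (auto simp: H012_def W12_def Lp_2_iff_L2 L2vec_iff_L2)

lemma H012_sequence:
  assumes "H012 U u G"
  obtains X where "\<And>k. test_fun U (X k)" "(\<lambda>k. \<integral>x. (norm (X k x - u x))\<^sup>2 \<partial>lebesgue_on U) \<longlonglongrightarrow> 0"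
    "(\<lambda>k. \<integral>x. (norm (grad (X k) x - G x))\<^sup>2 \<partial>lebesgue_on U) \<longlonglongrightarrow> 0"
proof -
  obtain X where X: "\<And>k. test_fun U (X k)" and lim: "(\<lambda>k. W12_dist U (X k) u G) \<longlonglongrightarrow> 0"
    using assms by (auto simp: H012_def)
  let ?p = "\<lambda>k. \<integral>x. (norm (X k x - u x))\<^sup>2 \<partial>lebesgue_on U"
  let ?q = "\<lambda>k. \<integral>x. (norm (grad (X k) x - G x))\<^sup>2 \<partial>lebesgue_on U"
  have "(\<lambda>k. (W12_dist U (X k) u G)\<^sup>2) \<longlonglongrightarrow> 0" using lim by simp
  moreover have "(W12_dist U (X k) u G)\<^sup>2 = ?p k + ?q k" for k
    by (simp add: W12_dist_def real_sqrt_pow2)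
  ultimately have sum: "(\<lambda>k. ?p k + ?q k) \<longlonglongrightarrow> 0" by simp
  have "?p \<longlonglongrightarrow> 0" by (rule Lim_null_comparison[OF _ sum]) simp
  moreover have "?q \<longlonglongrightarrow> 0" by (rule Lim_null_comparison[OF _ sum]) simp
  ultimately show thesis using that X by blast
qed

lemma H012_AE_sequence:
  fixes U :: "(real^'n::finite) set"
  assumes U: "open U" "bounded U" and H: "H012 U u G"
  obtains Y where "\<And>k. test_fun U (Y k)" "AE x in lebesgue_on U. (\<lambda>k. Y k x) \<longlonglongrightarrow> u x"
    "(\<lambda>k. \<integral>x. (norm (grad (Y k) x - G x))\<^sup>2 \<partial>lebesgue_on U) \<longlonglongrightarrow> 0"
proof -
  obtain X where X: "\<And>k. test_fun U (X k)" "(\<lambda>k. \<integral>x. (norm (X k x - u x))\<^sup>2 \<partial>lebesgue_on U) \<longlonglongrightarrow> 0"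
    and q: "(\<lambda>k. \<integral>x. (norm (grad (X k) x - G x))\<^sup>2 \<partial>lebesgue_on U) \<longlonglongrightarrow> 0"
    using H012_sequence[OF H] by blast
  obtain r :: "nat \<Rightarrow> nat" where r: "strict_mono r" "AE x in lebesgue_on U. (\<lambda>k. X (r k) x) \<longlonglongrightarrow> u x"
    using L2_AE_subseq[of "lebesgue_on U" X, OF test_fun_L2(1)[OF U X(1)] H012_L2(1)[OF H] X(2)] by blast
  have "(\<lambda>k. \<integral>x. (norm (grad (X (r k)) x - G x))\<^sup>2 \<partial>lebesgue_on U) \<longlonglongrightarrow> 0"
    using LIMSEQ_subseq_LIMSEQ[OF q r(1)] by (simp add: o_def)
  then show thesis using that[of "\<lambda>k. X (r k)"] X(1) r(2) by blast
qed

section \<open>Limits of integrals with a bounded continuous factor of the solution\<close>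

context
  fixes U :: "(real^'n::finite) set" and u G Y and h :: "real \<Rightarrow> real" and C :: real
  assumes U: "open U" "bounded U" and u: "u \<in> borel_measurable (lebesgue_on U)" and G: "L2 (lebesgue_on U) G"
    and Y: "\<And>k. test_fun U (Y k)" and AEY: "AE x in lebesgue_on U. (\<lambda>k. Y k x) \<longlonglongrightarrow> u x"
    and YG: "(\<lambda>k. \<integral>x. (norm (grad (Y k) x - G x))\<^sup>2 \<partial>lebesgue_on U) \<longlonglongrightarrow> 0"
    and h: "continuous_on UNIV h" and hC: "\<And>s. \<bar>h s\<bar> \<le> C"
begin

private lemma meas[measurable]:
  "u \<in> borel_measurable (lebesgue_on U)" "G \<in> borel_measurable (lebesgue_on U)"
  "Y k \<in> borel_measurable (lebesgue_on U)" "grad (Y k) \<in> borel_measurable (lebesgue_on U)"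
  "h \<in> borel_measurable borel"
  using u G test_fun_measurable[OF Y] borel_measurable_continuous_onI[OF h] by (auto simp: L2_def)

lemma integrable_bounded_mult:
  assumes "integrable (lebesgue_on U) w" and [measurable]: "v \<in> borel_measurable (lebesgue_on U)"
  shows "integrable (lebesgue_on U) (\<lambda>x. w x * h (v x))"
proof (rule Bochner_Integration.integrable_bound)
  show "integrable (lebesgue_on U) (\<lambda>x. C * \<bar>w x\<bar>)" using assms by simp
  have [measurable]: "w \<in> borel_measurable (lebesgue_on U)" using assms by auto
  show "(\<lambda>x. w x * h (v x)) \<in> borel_measurable (lebesgue_on U)" by measurable
  have "\<bar>w x * h (v x)\<bar> \<le> C * \<bar>w x\<bar>" for x
    using mult_left_mono[OF hC[of "v x"], of "\<bar>w x\<bar>"] by (simp add: abs_mult mult.commute)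
  then show "AE x in lebesgue_on U. norm (w x * h (v x)) \<le> norm (C * \<bar>w x\<bar>)"
    by (intro always_eventually allI) (metis abs_ge_self order_trans real_norm_def)
qed

lemma tendsto_integral_bounded_mult:
  assumes w: "integrable (lebesgue_on U) w"
  shows "(\<lambda>k. \<integral>x. w x * h (Y k x) \<partial>lebesgue_on U) \<longlonglongrightarrow> (\<integral>x. w x * h (u x) \<partial>lebesgue_on U)"
proof (rule integral_dominated_convergence[where w = "\<lambda>x. C * \<bar>w x\<bar>"])
  have [measurable]: "w \<in> borel_measurable (lebesgue_on U)" using w by auto
  show "(\<lambda>x. w x * h (u x)) \<in> borel_measurable (lebesgue_on U)"
    "\<And>k. (\<lambda>x. w x * h (Y k x)) \<in> borel_measurable (lebesgue_on U)" by measurable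
  show "integrable (lebesgue_on U) (\<lambda>x. C * \<bar>w x\<bar>)" using w by simp
  show "AE x in lebesgue_on U. (\<lambda>k. w x * h (Y k x)) \<longlonglongrightarrow> w x * h (u x)"
    using AEY
  proof eventually_elim
    case (elim x)
    have "isCont h (u x)" using h by (simp add: continuous_on_eq_continuous_at)
    from isCont_tendsto_compose[OF this elim] show ?case by (intro tendsto_intros)
  qed
  show "AE x in lebesgue_on U. norm (w x * h (Y k x)) \<le> C * \<bar>w x\<bar>" for k
  proof (intro always_eventually allI)
    fix x
    show "norm (w x * h (Y k x)) \<le> C * \<bar>w x\<bar>"
      using mult_left_mono[OF hC[of "Y k x"], of "\<bar>w x\<bar>"] by (simp add: abs_mult mult.commute)
  qed
qed

text \<open>Replacing the approximating gradient by its limit costs at most \<open>C\<close> times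
  an \<open>L^2\<close> pairing that tends to zero; what remains has a fixed integrable weight and
  converges by domination.\<close>

lemma tendsto_integral_inner_grad:
  assumes W: "L2 (lebesgue_on U) W"
  shows "(\<lambda>k. \<integral>x. (W x \<bullet> grad (Y k) x) * h (Y k x) \<partial>lebesgue_on U) \<longlonglongrightarrow> (\<integral>x. (W x \<bullet> G x) * h (u x) \<partial>lebesgue_on U)"
proof -
  have D: "L2 (lebesgue_on U) (\<lambda>x. grad (Y k) x - G x)" for k
    by (intro L2_diff G test_fun_L2(2)[OF U Y])
  note I1 = integrable_bounded_mult[OF L2_inner_integrable[OF W D] meas(3)]
  note I2 = integrable_bounded_mult[OF L2_inner_integrable[OF W G] meas(3)]
  have "(\<lambda>k. \<integral>x. (W x \<bullet> (grad (Y k) x - G x)) * h (Y k x) \<partial>lebesgue_on U) \<longlonglongrightarrow> 0"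
  proof (rule Lim_null_comparison)
    show "(\<lambda>k. C * (\<integral>x. norm (grad (Y k) x - G x) * norm (W x) \<partial>lebesgue_on U)) \<longlonglongrightarrow> 0"
      using tendsto_mult_right_zero[OF L2_tendsto_norm_mult[OF D YG W]] by simp
    show "\<forall>\<^sub>F k in sequentially. norm (\<integral>x. (W x \<bullet> (grad (Y k) x - G x)) * h (Y k x) \<partial>lebesgue_on U)
       \<le> C * (\<integral>x. norm (grad (Y k) x - G x) * norm (W x) \<partial>lebesgue_on U)"
    proof (intro always_eventually allI)
      fix k
      have "norm (\<integral>x. (W x \<bullet> (grad (Y k) x - G x)) * h (Y k x) \<partial>lebesgue_on U)
        \<le> (\<integral>x. norm ((W x \<bullet> (grad (Y k) x - G x)) * h (Y k x)) \<partial>lebesgue_on U)"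
        by (rule integral_norm_bound)
      also have "\<dots> \<le> (\<integral>x. C * (norm (grad (Y k) x - G x) * norm (W x)) \<partial>lebesgue_on U)"
      proof (rule integral_mono)
        show "integrable (lebesgue_on U) (\<lambda>x. norm ((W x \<bullet> (grad (Y k) x - G x)) * h (Y k x)))"
          by (intro integrable_norm I1)
        show "integrable (lebesgue_on U) (\<lambda>x. C * (norm (grad (Y k) x - G x) * norm (W x)))"
          by (intro integrable_mult_right L2_norm_mult_integrable D W)
        fix x
        have "\<bar>W x \<bullet> (grad (Y k) x - G x)\<bar> * \<bar>h (Y k x)\<bar> \<le> (norm (W x) * norm (grad (Y k) x - G x)) * C"
          by (intro mult_mono Cauchy_Schwarz_ineq2 hC) auto
        then show "norm ((W x \<bullet> (grad (Y k) x - G x)) * h (Y k x)) \<le> C * (norm (grad (Y k) x - G x) * norm (W x))"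
          by (simp add: abs_mult mult_ac)
      qed
      finally show "norm (\<integral>x. (W x \<bullet> (grad (Y k) x - G x)) * h (Y k x) \<partial>lebesgue_on U)
         \<le> C * (\<integral>x. norm (grad (Y k) x - G x) * norm (W x) \<partial>lebesgue_on U)" by simp
    qed
  qed
  from tendsto_add[OF this tendsto_integral_bounded_mult[OF L2_inner_integrable[OF W G]]]
  have "(\<lambda>k. (\<integral>x. (W x \<bullet> (grad (Y k) x - G x)) * h (Y k x) \<partial>lebesgue_on U) + (\<integral>x. (W x \<bullet> G x) * h (Y k x) \<partial>lebesgue_on U))
     \<longlonglongrightarrow> (\<integral>x. (W x \<bullet> G x) * h (u x) \<partial>lebesgue_on U)" by simp
  moreover have "(\<integral>x. (W x \<bullet> (grad (Y k) x - G x)) * h (Y k x) \<partial>lebesgue_on U) + (\<integral>x. (W x \<bullet> G x) * h (Y k x) \<partial>lebesgue_on U)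
     = (\<integral>x. (W x \<bullet> grad (Y k) x) * h (Y k x) \<partial>lebesgue_on U)" for k
    unfolding Bochner_Integration.integral_add[OF I1 I2, symmetric]
    by (simp add: inner_diff_right algebra_simps)
  ultimately show ?thesis by simp
qed

text \<open>The square is expanded around \<open>G\<close>, so that each term has a known limit. In
  this way truncated energies converge without first placing the truncation of \<open>u\<close> in
  the Sobolev space.\<close>

lemma tendsto_integral_grad_square:
  "(\<lambda>k. \<integral>x. (norm (grad (Y k) x))\<^sup>2 * h (Y k x) \<partial>lebesgue_on U) \<longlonglongrightarrow> (\<integral>x. (norm (G x))\<^sup>2 * h (u x) \<partial>lebesgue_on U)"
proof -
  have D: "L2 (lebesgue_on U) (\<lambda>x. grad (Y k) x - G x)" for k
    by (intro L2_diff G test_fun_L2(2)[OF U Y])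
  have D2: "integrable (lebesgue_on U) (\<lambda>x. (norm (grad (Y k) x - G x))\<^sup>2)" for k using D by (simp add: L2_def)
  have G2: "integrable (lebesgue_on U) (\<lambda>x. (norm (G x))\<^sup>2)" using G by (simp add: L2_def)
  note I1 = integrable_bounded_mult[OF D2 meas(3)]
  note I2 = integrable_bounded_mult[OF L2_inner_integrable[OF G test_fun_L2(2)[OF U Y]] meas(3)]
  note I3 = integrable_bounded_mult[OF G2 meas(3)]
  have 1: "(\<lambda>k. \<integral>x. (norm (grad (Y k) x - G x))\<^sup>2 * h (Y k x) \<partial>lebesgue_on U) \<longlonglongrightarrow> 0"
  proof (rule Lim_null_comparison)
    show "(\<lambda>k. C * (\<integral>x. (norm (grad (Y k) x - G x))\<^sup>2 \<partial>lebesgue_on U)) \<longlonglongrightarrow> 0"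
      using tendsto_mult_right_zero[OF YG] by simp
    show "\<forall>\<^sub>F k in sequentially. norm (\<integral>x. (norm (grad (Y k) x - G x))\<^sup>2 * h (Y k x) \<partial>lebesgue_on U)
       \<le> C * (\<integral>x. (norm (grad (Y k) x - G x))\<^sup>2 \<partial>lebesgue_on U)"
    proof (intro always_eventually allI)
      fix k
      have "norm (\<integral>x. (norm (grad (Y k) x - G x))\<^sup>2 * h (Y k x) \<partial>lebesgue_on U)
        \<le> (\<integral>x. norm ((norm (grad (Y k) x - G x))\<^sup>2 * h (Y k x)) \<partial>lebesgue_on U)"
        by (rule integral_norm_bound)
      also have "\<dots> \<le> (\<integral>x. C * (norm (grad (Y k) x - G x))\<^sup>2 \<partial>lebesgue_on U)"
      proof (rule integral_mono)
        fix x
        have "(norm (grad (Y k) x - G x))\<^sup>2 * \<bar>h (Y k x)\<bar> \<le> (norm (grad (Y k) x - G x))\<^sup>2 * C"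
          by (intro mult_left_mono hC) auto
        then show "norm ((norm (grad (Y k) x - G x))\<^sup>2 * h (Y k x)) \<le> C * (norm (grad (Y k) x - G x))\<^sup>2"
          by (simp add: abs_mult mult.commute)
      qed (intro integrable_norm I1 integrable_mult_right D2)+
      finally show "norm (\<integral>x. (norm (grad (Y k) x - G x))\<^sup>2 * h (Y k x) \<partial>lebesgue_on U)
         \<le> C * (\<integral>x. (norm (grad (Y k) x - G x))\<^sup>2 \<partial>lebesgue_on U)" by simp
    qed
  qed
  have "(\<lambda>k. (\<integral>x. (norm (grad (Y k) x - G x))\<^sup>2 * h (Y k x) \<partial>lebesgue_on U)
      + 2 * (\<integral>x. (G x \<bullet> grad (Y k) x) * h (Y k x) \<partial>lebesgue_on U) - (\<integral>x. (norm (G x))\<^sup>2 * h (Y k x) \<partial>lebesgue_on U))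
    \<longlonglongrightarrow> 0 + 2 * (\<integral>x. (G x \<bullet> G x) * h (u x) \<partial>lebesgue_on U) - (\<integral>x. (norm (G x))\<^sup>2 * h (u x) \<partial>lebesgue_on U)"
    by (intro tendsto_intros 1 tendsto_integral_inner_grad G tendsto_integral_bounded_mult G2)
  moreover have "(\<integral>x. (norm (grad (Y k) x - G x))\<^sup>2 * h (Y k x) \<partial>lebesgue_on U)
      + 2 * (\<integral>x. (G x \<bullet> grad (Y k) x) * h (Y k x) \<partial>lebesgue_on U) - (\<integral>x. (norm (G x))\<^sup>2 * h (Y k x) \<partial>lebesgue_on U)
    = (\<integral>x. (norm (grad (Y k) x))\<^sup>2 * h (Y k x) \<partial>lebesgue_on U)" for k
  proof -
    have eq: "(norm (grad (Y k) x))\<^sup>2 * h (Y k x) = (norm (grad (Y k) x - G x))\<^sup>2 * h (Y k x)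
       + 2 * ((G x \<bullet> grad (Y k) x) * h (Y k x)) - (norm (G x))\<^sup>2 * h (Y k x)" for x
      by (simp add: power2_norm_eq_inner inner_diff inner_commute algebra_simps)
    show ?thesis unfolding eq using I1 I2 I3 by simp
  qed
  ultimately show ?thesis by (simp add: power2_norm_eq_inner)
qed

end

section \<open>Energy and superlevel estimates for weak solutions\<close>

context elliptic
begin

text \<open>When \<open>E 1 (Y k)\<close> is inserted as test function, \<open>G\<close> and
  \<open>u\<close> stay fixed in the equation. Thus the lower-order terms and the data have fixed
  integrable weights, and only the elliptic term needs the convergence of gradients.\<close>

lemma truncation_energy:
  assumes sol: "weak_sol U A B c f u G" and f: "integrable MU f"
    and E: "\<And>j s. (E j has_real_derivative E (Suc j) s) (at s)" and E00: "E 0 0 = 0" and E10: "E 1 0 = 0"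
    and E0: "\<And>s. E 0 s \<ge> 0" and E1: "\<And>s. 0 \<le> E 1 s" "\<And>s. E 1 s \<le> \<delta>" "\<And>s. s \<le> 0 \<Longrightarrow> E 1 s = 0"
    and E2: "\<And>s. 0 \<le> E 2 s" "\<And>s. E 2 s \<le> C"
  shows "lam * (\<integral>x. (norm (G x))\<^sup>2 * E 2 (u x) \<partial>MU) \<le> (\<integral>x. f x * E 1 (u x) \<partial>MU)"
proof -
  have H: "H012 U u G" and cu: "integrable MU (\<lambda>x. c x * u x)"
    and eqn: "\<And>\<phi>. test_fun U \<phi> \<Longrightarrow> (\<integral>x. (A x *v G x) \<bullet> grad \<phi> x \<partial>MU) + (\<integral>x. (B x \<bullet> G x) * \<phi> x \<partial>MU)
      + (\<integral>x. c x * u x * \<phi> x \<partial>MU) = (\<integral>x. f x * \<phi> x \<partial>MU)"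
    using sol by (auto simp: weak_sol_def)
  have u: "L2 MU u" and G: "L2 MU G" using H012_L2[OF H] by auto
  have um: "u \<in> borel_measurable MU" using u by (simp add: L2_def)
  obtain Y where Y: "\<And>k. test_fun U (Y k)" "AE x in MU. (\<lambda>k. Y k x) \<longlonglongrightarrow> u x"
    "(\<lambda>k. \<integral>x. (norm (grad (Y k) x - G x))\<^sup>2 \<partial>MU) \<longlonglongrightarrow> 0"
    using H012_AE_sequence[OF open_U bounded_U H] by blast
  have cont: "continuous_on UNIV (E j)" for j
    using E by (meson DERIV_continuous continuous_at_imp_continuous_on)
  have E1b: "\<bar>E 1 s\<bar> \<le> \<delta>" for s using E1 by simp
  have E2b: "\<bar>E 2 s\<bar> \<le> C" for s using E2 by simp
  note ctx1 = open_U bounded_U um G Y(1) Y(2) Y(3) cont[of 1] E1b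
  note ctx2 = open_U bounded_U um G Y(1) Y(2) Y(3) cont[of 2] E2b
  have D1: "(E 1 has_real_derivative E 2 s) (at s)" for s using E[of 1] by (simp add: numeral_2_eq_2)
  have D0: "(E 0 has_real_derivative E 1 s) (at s)" for s using E[of 0] by simp
  have T1: "test_fun U (\<lambda>x. E 1 (Y k x))" for k
    using test_fun_compose[OF Y(1), of "\<lambda>j. E (Suc j)"] E E10 by simp
  have g1: "grad (\<lambda>x. E 1 (Y k x)) x = E 2 (Y k x) *\<^sub>R grad (Y k) x" for k x
    by (rule grad_compose[OF Y(1) D1])
  have T0: "test_fun U (\<lambda>x. E 0 (Y k x))" for k
    using test_fun_compose[OF Y(1), of E] E E00 by blast
  have g0: "grad (\<lambda>x. E 0 (Y k x)) x = E 1 (Y k x) *\<^sub>R grad (Y k) x" for k x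
    by (rule grad_compose[OF Y(1) D0])
  have AG: "L2 MU (\<lambda>x. A x *v G x)" by (rule A_mult_L2[OF G])
  have BG: "integrable MU (\<lambda>x. B x \<bullet> G x)" by (rule L2_inner_integrable[OF B_L2 G])
  have "(\<lambda>k. (\<integral>x. ((A x *v G x) \<bullet> grad (Y k) x) * E 2 (Y k x) \<partial>MU) + (\<integral>x. (B x \<bullet> G x) * E 1 (Y k x) \<partial>MU)
      + (\<integral>x. c x * u x * E 1 (Y k x) \<partial>MU))
    \<longlonglongrightarrow> (\<integral>x. ((A x *v G x) \<bullet> G x) * E 2 (u x) \<partial>MU) + (\<integral>x. (B x \<bullet> G x) * E 1 (u x) \<partial>MU)
      + (\<integral>x. c x * u x * E 1 (u x) \<partial>MU)"
    by (intro tendsto_add tendsto_integral_inner_grad[OF ctx2 AG] tendsto_integral_bounded_mult[OF ctx1 BG]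
        tendsto_integral_bounded_mult[OF ctx1 cu])
  moreover have "(\<integral>x. ((A x *v G x) \<bullet> grad (Y k) x) * E 2 (Y k x) \<partial>MU) + (\<integral>x. (B x \<bullet> G x) * E 1 (Y k x) \<partial>MU)
      + (\<integral>x. c x * u x * E 1 (Y k x) \<partial>MU) = (\<integral>x. f x * E 1 (Y k x) \<partial>MU)" for k
    using eqn[OF T1[of k]] unfolding g1 inner_scaleR_right by (simp add: mult.commute)
  moreover have "(\<lambda>k. \<integral>x. f x * E 1 (Y k x) \<partial>MU) \<longlonglongrightarrow> (\<integral>x. f x * E 1 (u x) \<partial>MU)"
    by (rule tendsto_integral_bounded_mult[OF ctx1 f])
  ultimately have limit: "(\<integral>x. ((A x *v G x) \<bullet> G x) * E 2 (u x) \<partial>MU) + (\<integral>x. (B x \<bullet> G x) * E 1 (u x) \<partial>MU)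
      + (\<integral>x. c x * u x * E 1 (u x) \<partial>MU) = (\<integral>x. f x * E 1 (u x) \<partial>MU)"
    using LIMSEQ_unique by auto
  \<comment> \<open>Here the gradient is approximated as well: with \<open>grad (Y k)\<close> in
    place of \<open>G\<close> the integrand is \<open>B\<close> paired with the gradient of the
    nonnegative test function \<open>E 0 (Y k)\<close>.\<close>
  have drift: "(\<integral>x. (B x \<bullet> G x) * E 1 (u x) \<partial>MU) \<ge> 0"
  proof (rule LIMSEQ_le_const[OF tendsto_integral_inner_grad[OF ctx1 B_L2]], intro exI allI impI)
    fix k
    have "0 \<le> (\<integral>x. B x \<bullet> grad (\<lambda>x. E 0 (Y k x)) x \<partial>MU)" by (rule B_div[OF T0 E0])
    then show "0 \<le> (\<integral>x. (B x \<bullet> grad (Y k) x) * E 1 (Y k x) \<partial>MU)"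
      unfolding g0 inner_scaleR_right by (simp add: mult.commute)
  qed
  \<comment> \<open>\<open>E 1\<close> vanishes at nonpositive arguments and is nonnegative at the
    others, so \<open>u * E 1 u\<close> has no negative values.\<close>
  have potential: "(\<integral>x. c x * u x * E 1 (u x) \<partial>MU) \<ge> 0"
  proof (rule integral_nonneg_AE)
    show "AE x in MU. 0 \<le> c x * u x * E 1 (u x)"
      using c_nonneg
    proof eventually_elim
      case (elim x)
      then show ?case using E1(1)[of "u x"] E1(3)[of "u x"] by (cases "u x \<le> 0") auto
    qed
  qed
  have G2: "integrable MU (\<lambda>x. (norm (G x))\<^sup>2)" using G by (simp add: L2_def)
  have "lam * (\<integral>x. (norm (G x))\<^sup>2 * E 2 (u x) \<partial>MU) = (\<integral>x. lam * ((norm (G x))\<^sup>2 * E 2 (u x)) \<partial>MU)" by simp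
  also have "\<dots> \<le> (\<integral>x. ((A x *v G x) \<bullet> G x) * E 2 (u x) \<partial>MU)"
  proof (rule integral_mono_AE)
    show "integrable MU (\<lambda>x. lam * ((norm (G x))\<^sup>2 * E 2 (u x)))"
      by (intro integrable_mult_right integrable_bounded_mult[OF ctx2 G2 um])
    show "integrable MU (\<lambda>x. ((A x *v G x) \<bullet> G x) * E 2 (u x))"
      by (rule integrable_bounded_mult[OF ctx2 L2_inner_integrable[OF AG G] um])
    show "AE x in MU. lam * ((norm (G x))\<^sup>2 * E 2 (u x)) \<le> ((A x *v G x) \<bullet> G x) * E 2 (u x)"
      using ellipticity
    proof eventually_elim
      case (elim x)
      then have "lam * (norm (G x))\<^sup>2 * E 2 (u x) \<le> ((A x *v G x) \<bullet> G x) * E 2 (u x)"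
        by (intro mult_right_mono E2) blast
      then show ?case by (simp add: mult.assoc)
    qed
  qed
  finally show ?thesis using limit drift potential by linarith
qed

text \<open>The weak-type inequality is applied to the test functions \<open>E 1 (Y j)\<close> and
  carried to \<open>u\<close> by Fatou's lemma. On the right the data are integrated only over the
  lower superlevel set, because \<open>E 1\<close> vanishes below \<open>k\<close>; this is what
  makes an iteration possible.\<close>

lemma superlevel_measure_le:
  assumes S: "\<And>\<phi> t. test_fun U \<phi> \<Longrightarrow> t > 0 \<Longrightarrow>
     emeasure MU {x \<in> U. \<bar>\<phi> x\<bar> \<ge> t} \<le> ennreal (C * (energy U \<phi> / t\<^sup>2) powr \<kappa>)" and C: "C > 0" and \<kappa>: "\<kappa> > 0"
    and sol: "weak_sol U A B c f u G" and f: "integrable MU f" and k: "k \<ge> 0" and \<delta>: "\<delta> > 0"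
  shows "emeasure MU {x \<in> U. u x > k + \<delta>}
    \<le> ennreal (C * (2 * exp 2 / lam * (\<integral>x. \<bar>f x\<bar> * indicator {x \<in> U. u x > k} x \<partial>MU) / \<delta>) powr \<kappa>)"
proof -
  obtain E :: "nat \<Rightarrow> real \<Rightarrow> real" where
    E: "\<And>j s. (E j has_real_derivative E (Suc j) s) (at s)" and E00: "E 0 0 = 0" and E10: "E 1 0 = 0" and E0: "\<And>s. E 0 s \<ge> 0"
    and E1: "\<And>s. 0 \<le> E 1 s" "\<And>s. E 1 s \<le> \<delta>" "\<And>s. s \<le> k \<Longrightarrow> E 1 s = 0"
    and E2: "\<And>s. 0 \<le> E 2 s" "\<And>s. E 2 s \<le> 2" and E1k: "\<And>s. s > k + \<delta> \<Longrightarrow> E 1 s > \<delta> * exp (-1)"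
    using smooth_truncation[OF k \<delta>] by metis
  have H: "H012 U u G" using sol by (auto simp: weak_sol_def)
  have u: "L2 MU u" and G: "L2 MU G" using H012_L2[OF H] by auto
  have um[measurable]: "u \<in> borel_measurable MU" using u by (simp add: L2_def)
  obtain Y where Y: "\<And>k. test_fun U (Y k)" "AE x in MU. (\<lambda>k. Y k x) \<longlonglongrightarrow> u x"
    "(\<lambda>k. \<integral>x. (norm (grad (Y k) x - G x))\<^sup>2 \<partial>MU) \<longlonglongrightarrow> 0"
    using H012_AE_sequence[OF open_U bounded_U H] by blast
  have cont: "continuous_on UNIV (E j)" for j
    using E by (meson DERIV_continuous continuous_at_imp_continuous_on)
  have E2b: "\<bar>E 2 s\<bar> \<le> 2" and E1b: "\<bar>E 1 s\<bar> \<le> \<delta>" for s using E2 E1 by simp_all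
  note ctx1 = open_U bounded_U um G Y(1) Y(2) Y(3) cont[of 1] E1b
  note ctx2 = open_U bounded_U um G Y(1) Y(2) Y(3) cont[of 2] E2b
  have D1: "(E 1 has_real_derivative E 2 s) (at s)" for s using E[of 1] by (simp add: numeral_2_eq_2)
  have T1: "test_fun U (\<lambda>x. E 1 (Y k x))" for k
    using test_fun_compose[OF Y(1), of "\<lambda>j. E (Suc j)"] E E10 by simp
  have g1: "grad (\<lambda>x. E 1 (Y k x)) x = E 2 (Y k x) *\<^sub>R grad (Y k) x" for k x
    by (rule grad_compose[OF Y(1) D1])
  define t where "t = \<delta> * exp (-1)"
  have t: "t > 0" using \<delta> by (simp add: t_def)
  \<comment> \<open>As \<open>0 \<le> E 2 \<le> 2\<close>, its square is at most
    \<open>2 * E 2\<close>. The energy of the truncation is thus bounded by an integral linear in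
    \<open>E 2\<close>, the quantity that \<open>truncation_energy\<close> estimates in the
    limit.\<close>
  define n where "n j = 2 * (\<integral>x. (norm (grad (Y j) x))\<^sup>2 * E 2 (Y j x) \<partial>MU)" for j
  have n0: "n j \<ge> 0" for j using E2 by (simp add: n_def integral_nonneg_AE)
  have energy_le: "energy U (\<lambda>x. E 1 (Y j x)) \<le> n j" for j
  proof -
    have g2: "integrable MU (\<lambda>x. (norm (grad (Y j) x))\<^sup>2)" using test_L2(2)[OF Y(1)] by (simp add: L2_def)
    have Ym: "Y j \<in> borel_measurable MU" using test_fun_measurable[OF Y(1)] by simp
    have "energy U (\<lambda>x. E 1 (Y j x)) \<le> (\<integral>x. 2 * ((norm (grad (Y j) x))\<^sup>2 * E 2 (Y j x)) \<partial>MU)"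
      unfolding energy_def
    proof (rule integral_mono)
      show "integrable MU (\<lambda>x. (norm (grad (\<lambda>x. E 1 (Y j x)) x))\<^sup>2)" using test_L2(2)[OF T1] by (simp add: L2_def)
      show "integrable MU (\<lambda>x. 2 * ((norm (grad (Y j) x))\<^sup>2 * E 2 (Y j x)))"
        by (intro integrable_mult_right integrable_bounded_mult[OF ctx2 g2 Ym])
      fix x
      have "(norm (grad (\<lambda>x. E 1 (Y j x)) x))\<^sup>2 = E 2 (Y j x) * ((norm (grad (Y j) x))\<^sup>2 * E 2 (Y j x))"
        unfolding g1 using E2(1) by (simp add: power_mult_distrib power2_eq_square)
      also have "\<dots> \<le> 2 * ((norm (grad (Y j) x))\<^sup>2 * E 2 (Y j x))"
        by (intro mult_right_mono E2 mult_nonneg_nonneg) auto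
      finally show "(norm (grad (\<lambda>x. E 1 (Y j x)) x))\<^sup>2 \<le> 2 * ((norm (grad (Y j) x))\<^sup>2 * E 2 (Y j x))" .
    qed
    then show ?thesis by (simp add: n_def)
  qed
  define n' where "n' = 2 * (\<integral>x. (norm (G x))\<^sup>2 * E 2 (u x) \<partial>MU)"
  have lim_n: "n \<longlonglongrightarrow> n'"
    unfolding n_def[abs_def] n'_def by (intro tendsto_mult_left tendsto_integral_grad_square[OF ctx2])
  have n'0: "n' \<ge> 0" using E2 by (simp add: n'_def integral_nonneg_AE)
  let ?I = "\<integral>x. \<bar>f x\<bar> * indicator {x \<in> U. u x > k} x \<partial>MU"
  have [measurable]: "{x \<in> U. u x > s} \<in> sets MU" for s
  proof -
    have "{x \<in> space MU. u x > s} \<in> sets MU" by measurable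
    then show ?thesis by (simp add: space_restrict_space)
  qed
  have I0: "?I \<ge> 0" by (intro integral_nonneg_AE) simp
  have n'_le: "n' \<le> 2 / lam * (\<delta> * ?I)"
  proof -
    have "lam * (\<integral>x. (norm (G x))\<^sup>2 * E 2 (u x) \<partial>MU) \<le> (\<integral>x. f x * E 1 (u x) \<partial>MU)"
      by (rule truncation_energy[OF sol f E E00 E10 E0 E1(1) E1(2) _ E2]) (use E1(3) k in simp)
    also have "\<dots> \<le> (\<integral>x. \<delta> * (\<bar>f x\<bar> * indicator {x \<in> U. u x > k} x) \<partial>MU)"
    proof (rule integral_mono)
      show "integrable MU (\<lambda>x. f x * E 1 (u x))" by (rule integrable_bounded_mult[OF ctx1 f um])
      show "integrable MU (\<lambda>x. \<delta> * (\<bar>f x\<bar> * indicator {x \<in> U. u x > k} x))"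
        using f by (intro integrable_mult_right integrable_real_mult_indicator integrable_abs) measurable
      fix x assume "x \<in> space MU"
      then have "x \<in> U" by (simp add: space_restrict_space)
      have "f x * E 1 (u x) \<le> \<bar>f x\<bar> * E 1 (u x)" using E1(1) by (intro mult_right_mono) auto
      also have "\<dots> \<le> \<delta> * (\<bar>f x\<bar> * indicator {x \<in> U. u x > k} x)"
        using E1(2)[of "u x"] E1(3)[of "u x"] \<open>x \<in> U\<close>
        by (cases "u x > k") (auto simp: mult.commute[of \<delta>] mult_left_mono)
      finally show "f x * E 1 (u x) \<le> \<delta> * (\<bar>f x\<bar> * indicator {x \<in> U. u x > k} x)" .
    qed
    finally have "lam * (n' / 2) \<le> \<delta> * ?I" by (simp add: n'_def)
    then show ?thesis using lam_pos by (simp add: field_simps)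
  qed
  have "emeasure MU {x \<in> U. u x > k + \<delta>} = (\<integral>\<^sup>+x. indicator {x \<in> U. u x > k + \<delta>} x \<partial>MU)"
    by simp
  also have "\<dots> \<le> (\<integral>\<^sup>+x. liminf (\<lambda>j. indicator {x \<in> U. \<bar>E 1 (Y j x)\<bar> \<ge> t} x) \<partial>MU)"
  proof (rule nn_integral_mono_AE)
    show "AE x in MU. indicator {x \<in> U. u x > k + \<delta>} x \<le> liminf (\<lambda>j. indicator {x \<in> U. \<bar>E 1 (Y j x)\<bar> \<ge> t} x :: ennreal)"
      using Y(2)
    proof eventually_elim
      case (elim x)
      show ?case
      proof (cases "x \<in> U \<and> u x > k + \<delta>")
        case True
        have "isCont (E 1) (u x)" using cont by (simp add: continuous_on_eq_continuous_at)
        from isCont_tendsto_compose[OF this elim] have "(\<lambda>j. E 1 (Y j x)) \<longlonglongrightarrow> E 1 (u x)" .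
        \<comment> \<open>The strict inequality is an open condition, so it persists for
          \<open>Y j x\<close> with large \<open>j\<close>.\<close>
        moreover have "t < E 1 (u x)" using E1k True by (simp add: t_def)
        ultimately have "\<forall>\<^sub>F j in sequentially. t < E 1 (Y j x)" by (rule order_tendstoD)
        then have "\<forall>\<^sub>F j in sequentially. (1::ennreal) \<le> indicator {x \<in> U. \<bar>E 1 (Y j x)\<bar> \<ge> t} x"
          by eventually_elim (use True in auto)
        then have "1 \<le> liminf (\<lambda>j. indicator {x \<in> U. \<bar>E 1 (Y j x)\<bar> \<ge> t} x :: ennreal)"
          by (rule Liminf_bounded)
        then show ?thesis using True by simp
      qed simp
    qed
  qed
  also have "\<dots> \<le> liminf (\<lambda>j. \<integral>\<^sup>+x. indicator {x \<in> U. \<bar>E 1 (Y j x)\<bar> \<ge> t} x \<partial>MU)"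
  proof (rule nn_integral_liminf)
    fix j
    have [measurable]: "(\<lambda>x. E 1 (Y j x)) \<in> borel_measurable MU" by (rule test_fun_measurable(1)[OF T1])
    have "{x \<in> space MU. \<bar>E 1 (Y j x)\<bar> \<ge> t} \<in> sets MU" by measurable
    then show "indicator {x \<in> U. \<bar>E 1 (Y j x)\<bar> \<ge> t} \<in> borel_measurable MU"
      by (simp add: space_restrict_space)
  qed
  also have "\<dots> \<le> liminf (\<lambda>j. ennreal (C * (n j / t\<^sup>2) powr \<kappa>))"
  proof (rule Liminf_mono, intro always_eventually allI)
    fix j
    have m: "(\<lambda>x. E 1 (Y j x)) \<in> borel_measurable MU" by (rule test_fun_measurable(1)[OF T1])
    have "{x \<in> space MU. \<bar>E 1 (Y j x)\<bar> \<ge> t} \<in> sets MU" using m by measurable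
    then have "{x \<in> U. \<bar>E 1 (Y j x)\<bar> \<ge> t} \<in> sets MU" by (simp add: space_restrict_space)
    then have "(\<integral>\<^sup>+x. indicator {x \<in> U. \<bar>E 1 (Y j x)\<bar> \<ge> t} x \<partial>MU) = emeasure MU {x \<in> U. \<bar>E 1 (Y j x)\<bar> \<ge> t}"
      by (rule nn_integral_indicator)
    also have "\<dots> \<le> ennreal (C * (energy U (\<lambda>x. E 1 (Y j x)) / t\<^sup>2) powr \<kappa>)" by (rule S[OF T1 t])
    also have "\<dots> \<le> ennreal (C * (n j / t\<^sup>2) powr \<kappa>)"
      using energy_le[of j] energy_nonneg[of U] C \<kappa> t
      by (intro ennreal_leI mult_left_mono powr_mono2 divide_right_mono) auto
    finally show "(\<integral>\<^sup>+x. indicator {x \<in> U. \<bar>E 1 (Y j x)\<bar> \<ge> t} x \<partial>MU) \<le> ennreal (C * (n j / t\<^sup>2) powr \<kappa>)" .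
  qed
  also have "\<dots> = ennreal (C * (n' / t\<^sup>2) powr \<kappa>)"
  proof (rule lim_imp_Liminf[OF sequentially_bot])
    have "(\<lambda>j. (n j / t\<^sup>2) powr \<kappa>) \<longlonglongrightarrow> (n' / t\<^sup>2) powr \<kappa>"
      using n0 \<kappa> t lim_n by (intro tendsto_powr' tendsto_divide tendsto_const) auto
    then show "(\<lambda>j. ennreal (C * (n j / t\<^sup>2) powr \<kappa>)) \<longlonglongrightarrow> ennreal (C * (n' / t\<^sup>2) powr \<kappa>)"
      by (intro tendsto_ennrealI tendsto_mult_left)
  qed
  \<comment> \<open>The bound \<open>E 1 \<le> \<delta>\<close> cancels one of the two powers of
    \<open>\<delta>\<close> in \<open>t^2\<close>, and \<open>exp 2\<close> is the inverse square of
    \<open>exp (-1)\<close>.\<close>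
  also have "\<dots> \<le> ennreal (C * (2 * exp 2 / lam * ?I / \<delta>) powr \<kappa>)"
  proof -
    have "n' / t\<^sup>2 \<le> 2 / lam * (\<delta> * ?I) / t\<^sup>2" using n'_le by (intro divide_right_mono) auto
    also have "\<dots> = 2 * exp 2 / lam * ?I / \<delta>"
    proof -
      have "t\<^sup>2 = \<delta> * \<delta> / exp 2"
        by (simp add: t_def power2_eq_square exp_minus field_simps) (simp add: mult_exp_exp)
      then show ?thesis using \<delta> by simp
    qed
    finally have "n' / t\<^sup>2 \<le> 2 * exp 2 / lam * ?I / \<delta>" .
    then show ?thesis using C \<kappa> n'0 by (intro ennreal_leI mult_left_mono powr_mono2) auto
  qed
  finally show ?thesis .
qed

end

section \<open>Uniqueness and boundedness\<close>

lemma Lp_mono: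
  assumes "open U" "bounded U" "Lp U q f" "0 < p" "p \<le> q"
  shows "Lp U p f"
  unfolding Lp_def
proof
  interpret finite_measure "lebesgue_on U" by (rule finite_measure_lebesgue_on_open[OF assms(1,2)])
  show m[measurable]: "f \<in> borel_measurable (lebesgue_on U)" using assms(3) by (simp add: Lp_def)
  show "integrable (lebesgue_on U) (\<lambda>x. \<bar>f x\<bar> powr p)"
  proof (rule Bochner_Integration.integrable_bound)
    show "integrable (lebesgue_on U) (\<lambda>x. 1 + \<bar>f x\<bar> powr q)" using assms(3) by (simp add: Lp_def)
    have "\<bar>f x\<bar> powr p \<le> 1 + \<bar>f x\<bar> powr q" for x
    proof (cases "\<bar>f x\<bar> \<le> 1")
      case True
      then have "\<bar>f x\<bar> powr p \<le> 1 powr p" using assms(4) by (intro powr_mono2) auto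
      moreover have "\<bar>f x\<bar> powr q \<ge> 0" by simp
      ultimately show ?thesis by (simp only: powr_one_eq_one)
    next
      case False
      then have "\<bar>f x\<bar> powr p \<le> \<bar>f x\<bar> powr q" using assms(5) by (intro powr_mono) auto
      then show ?thesis by simp
    qed
    then show "AE x in lebesgue_on U. norm (\<bar>f x\<bar> powr p) \<le> norm (1 + \<bar>f x\<bar> powr q)"
      by simp
  qed measurable
qed

lemma Lp_integrable:
  assumes "open U" "bounded U" "Lp U q f" "1 \<le> q"
  shows "integrable (lebesgue_on U) f"
proof -
  have "Lp U 1 f" using assms by (intro Lp_mono[OF assms(1-3)]) auto
  then have m: "f \<in> borel_measurable (lebesgue_on U)" and i: "integrable (lebesgue_on U) (\<lambda>x. \<bar>f x\<bar>)"
    by (auto simp: Lp_def)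
  show ?thesis using i integrable_abs_cancel[OF _ m] by blast
qed

section \<open>Linear combinations of weak solutions\<close>

context elliptic
begin

lemma test_mult_integrable:
  assumes "integrable MU w" "test_fun U \<phi>"
  shows "integrable MU (\<lambda>x. w x * \<phi> x)"
proof -
  obtain C where C: "\<And>x. \<bar>\<phi> x\<bar> \<le> C" using test_fun_bounded[OF bounded_U assms(2)] by blast
  have [measurable]: "\<phi> \<in> borel_measurable MU" "w \<in> borel_measurable MU"
    using test_fun_measurable[OF assms(2)] assms(1) by auto
  show ?thesis
  proof (rule Bochner_Integration.integrable_bound)
    show "integrable MU (\<lambda>x. C * \<bar>w x\<bar>)" using assms(1) by simp
    show "AE x in MU. norm (w x * \<phi> x) \<le> norm (C * \<bar>w x\<bar>)"
    proof (intro always_eventually allI)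
      fix x
      have "\<bar>w x * \<phi> x\<bar> \<le> C * \<bar>w x\<bar>"
        using mult_left_mono[OF C[of x], of "\<bar>w x\<bar>"] by (simp add: abs_mult mult.commute)
      also have "\<dots> \<le> \<bar>C * \<bar>w x\<bar>\<bar>" by simp
      finally show "norm (w x * \<phi> x) \<le> norm (C * \<bar>w x\<bar>)" by simp
    qed
  qed measurable
qed

lemma integral_norm_square_lincomb_tendsto_0:
  fixes F F' :: "nat \<Rightarrow> real^'n \<Rightarrow> 'b::euclidean_space"
  assumes F: "\<And>k. L2 MU (F k)" "(\<lambda>k. \<integral>x. (norm (F k x))\<^sup>2 \<partial>MU) \<longlonglongrightarrow> 0"
    and F': "\<And>k. L2 MU (F' k)" "(\<lambda>k. \<integral>x. (norm (F' k x))\<^sup>2 \<partial>MU) \<longlonglongrightarrow> 0"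
  shows "(\<lambda>k. \<integral>x. (norm (s *\<^sub>R F k x + t *\<^sub>R F' k x))\<^sup>2 \<partial>MU) \<longlonglongrightarrow> 0"
proof (rule Lim_null_comparison)
  have "(\<lambda>k. 2 * s\<^sup>2 * (\<integral>x. (norm (F k x))\<^sup>2 \<partial>MU) + 2 * t\<^sup>2 * (\<integral>x. (norm (F' k x))\<^sup>2 \<partial>MU)) \<longlonglongrightarrow> 2 * s\<^sup>2 * 0 + 2 * t\<^sup>2 * 0"
    by (intro tendsto_intros F F')
  then show "(\<lambda>k. 2 * s\<^sup>2 * (\<integral>x. (norm (F k x))\<^sup>2 \<partial>MU) + 2 * t\<^sup>2 * (\<integral>x. (norm (F' k x))\<^sup>2 \<partial>MU)) \<longlonglongrightarrow> 0" by simp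
  show "\<forall>\<^sub>F k in sequentially. norm (\<integral>x. (norm (s *\<^sub>R F k x + t *\<^sub>R F' k x))\<^sup>2 \<partial>MU)
     \<le> 2 * s\<^sup>2 * (\<integral>x. (norm (F k x))\<^sup>2 \<partial>MU) + 2 * t\<^sup>2 * (\<integral>x. (norm (F' k x))\<^sup>2 \<partial>MU)"
  proof (intro always_eventually allI)
    fix k
    have i: "integrable MU (\<lambda>x. (norm (F k x))\<^sup>2)" "integrable MU (\<lambda>x. (norm (F' k x))\<^sup>2)"
      using F(1) F'(1) by (auto simp: L2_def)
    have "L2 MU (\<lambda>x. s *\<^sub>R F k x + t *\<^sub>R F' k x)" by (intro L2_add L2_scaleR F F')
    then have i2: "integrable MU (\<lambda>x. (norm (s *\<^sub>R F k x + t *\<^sub>R F' k x))\<^sup>2)" by (simp add: L2_def)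
    have "(\<integral>x. (norm (s *\<^sub>R F k x + t *\<^sub>R F' k x))\<^sup>2 \<partial>MU)
       \<le> (\<integral>x. 2 * s\<^sup>2 * (norm (F k x))\<^sup>2 + 2 * t\<^sup>2 * (norm (F' k x))\<^sup>2 \<partial>MU)"
    proof (rule integral_mono[OF i2])
      show "integrable MU (\<lambda>x. 2 * s\<^sup>2 * (norm (F k x))\<^sup>2 + 2 * t\<^sup>2 * (norm (F' k x))\<^sup>2)" using i by simp
      fix x
      have "(norm (s *\<^sub>R F k x + t *\<^sub>R F' k x))\<^sup>2 \<le> (norm (s *\<^sub>R F k x) + norm (t *\<^sub>R F' k x))\<^sup>2"
        by (intro power_mono norm_triangle_ineq) auto
      also have "\<dots> \<le> 2 * (norm (s *\<^sub>R F k x))\<^sup>2 + 2 * (norm (t *\<^sub>R F' k x))\<^sup>2"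
        using sum_squares_bound[of "norm (s *\<^sub>R F k x)" "norm (t *\<^sub>R F' k x)"] by (simp add: power2_sum)
      finally show "(norm (s *\<^sub>R F k x + t *\<^sub>R F' k x))\<^sup>2 \<le> 2 * s\<^sup>2 * (norm (F k x))\<^sup>2 + 2 * t\<^sup>2 * (norm (F' k x))\<^sup>2"
        by (simp add: power_mult_distrib)
    qed
    also have "\<dots> = 2 * s\<^sup>2 * (\<integral>x. (norm (F k x))\<^sup>2 \<partial>MU) + 2 * t\<^sup>2 * (\<integral>x. (norm (F' k x))\<^sup>2 \<partial>MU)"
      using i by simp
    finally show "norm (\<integral>x. (norm (s *\<^sub>R F k x + t *\<^sub>R F' k x))\<^sup>2 \<partial>MU)
     \<le> 2 * s\<^sup>2 * (\<integral>x. (norm (F k x))\<^sup>2 \<partial>MU) + 2 * t\<^sup>2 * (\<integral>x. (norm (F' k x))\<^sup>2 \<partial>MU)" by simp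
  qed
qed

lemma H012_lincomb:
  assumes H: "H012 U u G" and H': "H012 U u' G'"
  shows "H012 U (\<lambda>x. s * u x + t * u' x) (\<lambda>x. s *\<^sub>R G x + t *\<^sub>R G' x)"
proof -
  note L = H012_L2[OF H] H012_L2[OF H']
  obtain X where X: "\<And>k. test_fun U (X k)" "(\<lambda>k. \<integral>x. (norm (X k x - u x))\<^sup>2 \<partial>MU) \<longlonglongrightarrow> 0"
    "(\<lambda>k. \<integral>x. (norm (grad (X k) x - G x))\<^sup>2 \<partial>MU) \<longlonglongrightarrow> 0" using H012_sequence[OF H] by blast
  obtain X' where X': "\<And>k. test_fun U (X' k)" "(\<lambda>k. \<integral>x. (norm (X' k x - u' x))\<^sup>2 \<partial>MU) \<longlonglongrightarrow> 0"
    "(\<lambda>k. \<integral>x. (norm (grad (X' k) x - G' x))\<^sup>2 \<partial>MU) \<longlonglongrightarrow> 0" using H012_sequence[OF H'] by blast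
  let ?Z = "\<lambda>k x. s * X k x + t * X' k x"
  have wg: "weak_grad U u G" "weak_grad U u' G'" using H H' by (auto simp: H012_def W12_def)
  show ?thesis
    unfolding H012_def W12_def Lp_2_iff_L2 L2vec_iff_L2
  proof (intro conjI exI[of _ ?Z] allI)
    show "L2 MU (\<lambda>x. s * u x + t * u' x)"
      using L2_add[OF L2_scaleR[OF L(1)] L2_scaleR[OF L(3)]] by simp
    show "L2 MU (\<lambda>x. s *\<^sub>R G x + t *\<^sub>R G' x)" by (intro L2_add L2_scaleR L)
    show "weak_grad U (\<lambda>x. s * u x + t * u' x) (\<lambda>x. s *\<^sub>R G x + t *\<^sub>R G' x)"
      unfolding weak_grad_def
    proof (intro allI impI)
      fix \<phi> i assume \<phi>: "test_fun U \<phi>"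
      have i1: "integrable MU (\<lambda>x. v x * pderiv i \<phi> x)" if "L2 MU v" for v :: "real^'n \<Rightarrow> real"
        using L2_inner_integrable[OF that test_pderiv_L2[OF \<phi>]] by simp
      have i2: "integrable MU (\<lambda>x. F x $ i * \<phi> x)" if "L2 MU F" for F :: "real^'n \<Rightarrow> real^'n"
        using L2_inner_integrable[OF that test_axis_L2[OF \<phi>], of i] by (simp add: inner_axis mult.commute)
      have "(\<integral>x. (s * u x + t * u' x) * pderiv i \<phi> x \<partial>MU)
        = s * (\<integral>x. u x * pderiv i \<phi> x \<partial>MU) + t * (\<integral>x. u' x * pderiv i \<phi> x \<partial>MU)"
        using i1[OF L(1)] i1[OF L(3)] by (simp add: distrib_right mult.assoc)
      also have "\<dots> = - (s * (\<integral>x. G x $ i * \<phi> x \<partial>MU) + t * (\<integral>x. G' x $ i * \<phi> x \<partial>MU))"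
        using wg \<phi> unfolding weak_grad_def by simp
      also have "s * (\<integral>x. G x $ i * \<phi> x \<partial>MU) + t * (\<integral>x. G' x $ i * \<phi> x \<partial>MU)
        = (\<integral>x. (s *\<^sub>R G x + t *\<^sub>R G' x) $ i * \<phi> x \<partial>MU)"
        using i2[OF L(2)] i2[OF L(4)] by (simp add: distrib_right mult.assoc)
      finally show "(\<integral>x. (s * u x + t * u' x) * pderiv i \<phi> x \<partial>MU) = - (\<integral>x. (s *\<^sub>R G x + t *\<^sub>R G' x) $ i * \<phi> x \<partial>MU)" .
    qed
    show "test_fun U (?Z k)" for k by (intro test_fun_add test_fun_cmult X X')
    have "(\<lambda>k. \<integral>x. (norm (s *\<^sub>R (X k x - u x) + t *\<^sub>R (X' k x - u' x)))\<^sup>2 \<partial>MU) \<longlonglongrightarrow> 0"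
      using X(2) X'(2) by (intro integral_norm_square_lincomb_tendsto_0 L2_diff test_L2 X(1) X'(1) L)
    moreover have "s *\<^sub>R (X k x - u x) + t *\<^sub>R (X' k x - u' x) = ?Z k x - (s * u x + t * u' x)" for k x
      by (simp add: algebra_simps)
    ultimately have p: "(\<lambda>k. \<integral>x. (norm (?Z k x - (s * u x + t * u' x)))\<^sup>2 \<partial>MU) \<longlonglongrightarrow> 0" by simp
    have "(\<lambda>k. \<integral>x. (norm (s *\<^sub>R (grad (X k) x - G x) + t *\<^sub>R (grad (X' k) x - G' x)))\<^sup>2 \<partial>MU) \<longlonglongrightarrow> 0"
      using X(3) X'(3) by (intro integral_norm_square_lincomb_tendsto_0 L2_diff test_L2 X(1) X'(1) L)
    moreover have "s *\<^sub>R (grad (X k) x - G x) + t *\<^sub>R (grad (X' k) x - G' x) = grad (?Z k) x - (s *\<^sub>R G x + t *\<^sub>R G' x)" for k x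
      using grad_add[OF test_fun_cmult[OF X(1)] test_fun_cmult[OF X'(1)]] grad_cmult[OF X(1)] grad_cmult[OF X'(1)]
      by (simp add: algebra_simps)
    ultimately have q: "(\<lambda>k. \<integral>x. (norm (grad (?Z k) x - (s *\<^sub>R G x + t *\<^sub>R G' x)))\<^sup>2 \<partial>MU) \<longlonglongrightarrow> 0" by simp
    have "(\<lambda>k. sqrt ((\<integral>x. (norm (?Z k x - (s * u x + t * u' x)))\<^sup>2 \<partial>MU)
        + (\<integral>x. (norm (grad (?Z k) x - (s *\<^sub>R G x + t *\<^sub>R G' x)))\<^sup>2 \<partial>MU))) \<longlonglongrightarrow> sqrt (0 + 0)"
      by (intro tendsto_intros p q)
    then show "(\<lambda>k. W12_dist U (?Z k) (\<lambda>x. s * u x + t * u' x) (\<lambda>x. s *\<^sub>R G x + t *\<^sub>R G' x)) \<longlonglongrightarrow> 0"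
      by (simp add: W12_dist_def)
  qed
qed

text \<open>Serves for differences, which reduce uniqueness to zero data, and for negatives, which
  turn upper bounds into lower ones.\<close>

lemma weak_sol_lincomb:
  assumes sol: "weak_sol U A B c f u G" and sol': "weak_sol U A B c f' u' G'"
    and f: "integrable MU f" and f': "integrable MU f'"
  shows "weak_sol U A B c (\<lambda>x. s * f x + t * f' x) (\<lambda>x. s * u x + t * u' x) (\<lambda>x. s *\<^sub>R G x + t *\<^sub>R G' x)"
  unfolding weak_sol_def
proof (intro conjI allI impI)
  have H: "H012 U u G" "H012 U u' G'" and cu: "integrable MU (\<lambda>x. c x * u x)" "integrable MU (\<lambda>x. c x * u' x)"
    using sol sol' by (auto simp: weak_sol_def)
  show "H012 U (\<lambda>x. s * u x + t * u' x) (\<lambda>x. s *\<^sub>R G x + t *\<^sub>R G' x)" by (rule H012_lincomb[OF H])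
  have "integrable MU (\<lambda>x. s * (c x * u x) + t * (c x * u' x))" using cu by simp
  then show "integrable MU (\<lambda>x. c x * (s * u x + t * u' x))" by (simp add: algebra_simps)
  fix \<phi> assume \<phi>: "test_fun U \<phi>"
  note G = H012_L2(2)[OF H(1)] and G' = H012_L2(2)[OF H(2)]
  have a: "integrable MU (\<lambda>x. (A x *v F x) \<bullet> grad \<phi> x)" "integrable MU (\<lambda>x. (B x \<bullet> F x) * \<phi> x)"
    if "L2 MU F" for F
    using that by (auto intro!: L2_inner_integrable A_mult_L2 test_L2 \<phi> test_mult_integrable B_L2)
  have e: "(\<integral>x. (A x *v G x) \<bullet> grad \<phi> x \<partial>MU) + (\<integral>x. (B x \<bullet> G x) * \<phi> x \<partial>MU) + (\<integral>x. c x * u x * \<phi> x \<partial>MU) = (\<integral>x. f x * \<phi> x \<partial>MU)"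
    "(\<integral>x. (A x *v G' x) \<bullet> grad \<phi> x \<partial>MU) + (\<integral>x. (B x \<bullet> G' x) * \<phi> x \<partial>MU) + (\<integral>x. c x * u' x * \<phi> x \<partial>MU) = (\<integral>x. f' x * \<phi> x \<partial>MU)"
    using sol sol' \<phi> by (auto simp: weak_sol_def)
  have 1: "(\<integral>x. (A x *v (s *\<^sub>R G x + t *\<^sub>R G' x)) \<bullet> grad \<phi> x \<partial>MU)
      = s * (\<integral>x. (A x *v G x) \<bullet> grad \<phi> x \<partial>MU) + t * (\<integral>x. (A x *v G' x) \<bullet> grad \<phi> x \<partial>MU)"
    using a(1)[OF G] a(1)[OF G']
    by (simp add: matrix_vector_right_distrib matrix_vector_mult_scaleR inner_add_left)
  have 2: "(\<integral>x. (B x \<bullet> (s *\<^sub>R G x + t *\<^sub>R G' x)) * \<phi> x \<partial>MU)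
      = s * (\<integral>x. (B x \<bullet> G x) * \<phi> x \<partial>MU) + t * (\<integral>x. (B x \<bullet> G' x) * \<phi> x \<partial>MU)"
    using a(2)[OF G] a(2)[OF G'] by (simp add: inner_add_right distrib_right mult.assoc)
  have lin: "(\<integral>x. (s * v x + t * v' x) * \<phi> x \<partial>MU) = s * (\<integral>x. v x * \<phi> x \<partial>MU) + t * (\<integral>x. v' x * \<phi> x \<partial>MU)"
    if "integrable MU v" "integrable MU v'" for v v'
    using test_mult_integrable[OF that(1) \<phi>] test_mult_integrable[OF that(2) \<phi>]
    by (simp add: distrib_right mult.assoc)
  have "c x * (s * u x + t * u' x) = s * (c x * u x) + t * (c x * u' x)" for x by (simp add: algebra_simps)
  then have 3: "(\<integral>x. c x * (s * u x + t * u' x) * \<phi> x \<partial>MU) = s * (\<integral>x. c x * u x * \<phi> x \<partial>MU) + t * (\<integral>x. c x * u' x * \<phi> x \<partial>MU)"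
    using lin[OF cu] by simp
  show "(\<integral>x. (A x *v (s *\<^sub>R G x + t *\<^sub>R G' x)) \<bullet> grad \<phi> x \<partial>MU) + (\<integral>x. (B x \<bullet> (s *\<^sub>R G x + t *\<^sub>R G' x)) * \<phi> x \<partial>MU)
     + (\<integral>x. c x * (s * u x + t * u' x) * \<phi> x \<partial>MU) = (\<integral>x. (s * f x + t * f' x) * \<phi> x \<partial>MU)"
    unfolding 1 2 3 lin[OF f f'] e[symmetric] by (simp add: algebra_simps)
qed

lemma AE_le_of_superlevel:
  fixes u :: "real^'n \<Rightarrow> real" and T :: real
  assumes u: "u \<in> borel_measurable MU" and z: "\<And>s. s > T \<Longrightarrow> emeasure MU {x \<in> U. u x > s} = 0"
  shows "AE x in MU. u x \<le> T"
proof -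
  note [measurable] = u
  have "AE x in MU. u x \<le> T + 1 / real (Suc n)" for n
  proof (rule AE_I')
    have "{x \<in> space MU. u x > T + 1 / real (Suc n)} \<in> sets MU" by measurable
    then show "{x \<in> U. u x > T + 1 / real (Suc n)} \<in> null_sets MU"
      using z[of "T + 1 / real (Suc n)"] by (simp add: null_sets_def space_restrict_space)
    show "{x \<in> space MU. \<not> u x \<le> T + 1 / real (Suc n)} \<subseteq> {x \<in> U. u x > T + 1 / real (Suc n)}"
      by (auto simp: space_restrict_space)
  qed
  then have "AE x in MU. \<forall>n. u x \<le> T + 1 / real (Suc n)" by (simp add: AE_all_countable)
  then show ?thesis
  proof eventually_elim
    case (elim x)
    have "(\<lambda>n. T + 1 / real (Suc n)) \<longlonglongrightarrow> T + 0" by (intro tendsto_intros LIMSEQ_Suc[OF lim_1_over_n])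
    then have "u x \<le> T + 0" by (rule LIMSEQ_le_const) (use elim in blast)
    then show ?case by simp
  qed
qed

section \<open>Zero data and the one-sided supremum bound\<close>

context
  fixes C \<kappa> :: real
  assumes S: "\<And>\<phi> t. test_fun U \<phi> \<Longrightarrow> t > 0 \<Longrightarrow>
     emeasure MU {x \<in> U. \<bar>\<phi> x\<bar> \<ge> t} \<le> ennreal (C * (energy U \<phi> / t\<^sup>2) powr \<kappa>)"
    and C: "C > 0" and \<kappa>: "\<kappa> > 0"
begin

lemma weak_sol_zero_le:
  assumes sol: "weak_sol U A B c (\<lambda>_. 0) v G"
  shows "AE x in MU. v x \<le> 0"
proof (rule AE_le_of_superlevel)
  show "v \<in> borel_measurable MU" using sol H012_L2(1) by (auto simp: weak_sol_def L2_def)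
  fix s :: real assume "s > 0"
  from superlevel_measure_le[OF S C \<kappa> sol _ order_refl this]
  show "emeasure MU {x \<in> U. v x > s} = 0" by simp
qed

lemma weak_sol_zero_unique:
  assumes sol: "weak_sol U A B c (\<lambda>_. 0) v G"
  shows "AE x in MU. v x = 0"
proof -
  have "weak_sol U A B c (\<lambda>_. 0) (\<lambda>x. - v x) (\<lambda>x. - G x)"
    using weak_sol_lincomb[OF sol sol, of "-1" 0] by simp
  from weak_sol_zero_le[OF this] weak_sol_zero_le[OF sol] show ?thesis by eventually_elim simp
qed

lemma weak_sol_unique:
  assumes "weak_sol U A B c f u G" "weak_sol U A B c f u' G'" "integrable MU f"
  shows "AE x in MU. u' x = u x"
proof -
  have "weak_sol U A B c (\<lambda>_. 0) (\<lambda>x. u' x - u x) (\<lambda>x. G' x - G x)"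
    using weak_sol_lincomb[OF assms(2,1) assms(3,3), of 1 "-1"] by simp
  from weak_sol_zero_unique[OF this] show ?thesis by eventually_elim simp
qed

text \<open>Hoelder's inequality turns the superlevel estimate into the hypothesis of Stampacchia's
  lemma with exponent \<open>\<kappa> * (1 - 1 / q)\<close> for the measure; the constant is the
  height required there, made explicit.\<close>

lemma weak_sol_le:
  assumes sol: "weak_sol U A B c f u G" and f: "Lp U q f" and q: "q > 1" and \<beta>: "\<kappa> * (1 - 1 / q) > 1"
  shows "AE x in MU. u x \<le> 2 * exp 2 / lam * (C * (measure lebesgue U + 1) powr (\<kappa> * (1 - 1 / q) - 1)
     * 2 powr (\<kappa> + \<kappa> / (\<kappa> * (1 - 1 / q) - 1))) powr (1 / \<kappa>) * Lp_norm U q f"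
proof -
  interpret finite_measure MU by (rule finite_MU)
  define \<beta>' where "\<beta>' = \<kappa> * (1 - 1 / q)"
  define V where "V = measure lebesgue U + 1"
  define N where "N = Lp_norm U q f"
  define Q where "Q = 2 * exp 2 / lam * N"
  define R where "R = (C * V powr (\<beta>' - 1) * 2 powr (\<kappa> + \<kappa> / (\<beta>' - 1))) powr (1 / \<kappa>)"
  have V: "V > 0" by (simp add: V_def add_nonneg_pos)
  have N0: "N \<ge> 0" by (simp add: N_def Lp_norm_def)
  have Q0: "Q \<ge> 0" using N0 lam_pos by (simp add: Q_def)
  have um[measurable]: "u \<in> borel_measurable MU" using sol H012_L2(1) by (auto simp: weak_sol_def L2_def)
  have fm[measurable]: "f \<in> borel_measurable MU" and fq: "integrable MU (\<lambda>x. \<bar>f x\<bar> powr q)"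
    using f by (auto simp: Lp_def)
  have fi: "integrable MU f" using Lp_integrable[OF open_U bounded_U f] q by simp
  have sets[measurable]: "{x \<in> U. u x > s} \<in> sets MU" for s
  proof -
    have "{x \<in> space MU. u x > s} \<in> sets MU" by measurable
    then show ?thesis by (simp add: space_restrict_space)
  qed
  define a where "a s = measure MU {x \<in> U. u x > s}" for s
  \<comment> \<open>Strictly above \<open>Q * R\<close>, since this product is 0 when
    \<open>f\<close> vanishes whereas the iteration needs a positive height; the bound
    \<open>Q * R\<close> itself is reached by letting the level decrease.\<close>
  have "a H = 0" if H: "H > Q * R" for H
  proof (rule Stampacchia[where a = a and D = "C * Q powr \<kappa>" and \<gamma> = \<kappa> and \<beta> = \<beta>' and V = V])
    have H0: "H > 0" using H Q0 by (simp add: R_def) (meson le_less_trans mult_nonneg_nonneg powr_ge_zero)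
    show "H > 0" by fact
    show "a s \<ge> 0" for s by (simp add: a_def)
    show "a t \<le> a s" if "s \<le> t" for s t
      unfolding a_def using that by (intro finite_measure_mono sets) auto
    show "\<beta>' > 1" using \<beta> by (simp add: \<beta>'_def)
    show "\<kappa> > 0" by (rule \<kappa>)
    show "C * Q powr \<kappa> \<ge> 0" using C by simp
    show "V > 0" by (rule V)
    show "a 0 \<le> V"
    proof -
      have "a 0 \<le> measure MU (space MU)" unfolding a_def by (rule bounded_measure)
      also have "\<dots> = measure lebesgue U"
        using open_U by (simp add: space_restrict_space measure_restrict_space borel_open)
      finally show ?thesis by (simp add: V_def)
    qed
    show "C * Q powr \<kappa> * V powr (\<beta>' - 1) * 2 powr (\<kappa> + \<kappa> / (\<beta>' - 1)) \<le> H powr \<kappa>"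
    proof -
      have "R powr \<kappa> = C * V powr (\<beta>' - 1) * 2 powr (\<kappa> + \<kappa> / (\<beta>' - 1))"
        using \<kappa> C by (simp add: R_def powr_powr)
      then have "C * Q powr \<kappa> * V powr (\<beta>' - 1) * 2 powr (\<kappa> + \<kappa> / (\<beta>' - 1)) = (Q * R) powr \<kappa>"
        by (simp add: powr_mult mult_ac)
      also have "\<dots> \<le> H powr \<kappa>" using H Q0 \<kappa> by (intro powr_mono2) (auto simp: R_def)
      finally show ?thesis .
    qed
    fix k \<delta> :: real assume k: "k \<ge> 0" and \<delta>: "\<delta> > 0"
    let ?I = "\<integral>x. \<bar>f x\<bar> * indicator {x \<in> U. u x > k} x \<partial>MU"
    have I0: "?I \<ge> 0" by (intro integral_nonneg_AE) simp
    have Ile: "?I \<le> N * a k powr (1 - 1 / q)"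
    proof -
      define q' where "q' = q / (q - 1)"
      have q': "q' > 1" "1 / q + 1 / q' = 1" "1 / q' = 1 - 1 / q" using q by (auto simp: q'_def field_simps)
      have ind: "\<bar>indicator {x \<in> U. u x > k} x :: real\<bar> powr q' = indicator {x \<in> U. u x > k} x" for x
        by (simp add: indicator_def)
      have cap: "{x \<in> U. u x > k} \<inter> U = {x \<in> U. u x > k}" by auto
      have ii: "integrable MU (indicator {x \<in> U. u x > k} :: _ \<Rightarrow> real)"
        by (rule integrable_real_indicator[OF sets]) (simp add: less_top[symmetric])
      have "(\<integral>x. \<bar>f x * indicator {x \<in> U. u x > k} x\<bar> \<partial>MU)
         \<le> (\<integral>x. \<bar>f x\<bar> powr q \<partial>MU) powr (1 / q) * (\<integral>x. \<bar>indicator {x \<in> U. u x > k} x\<bar> powr q' \<partial>MU) powr (1 / q')"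
      proof (rule Hoelder_integral(2)[OF q q'(1,2) fm _ fq])
        show "integrable MU (\<lambda>x. \<bar>indicator {x \<in> U. u x > k} x :: real\<bar> powr q')" unfolding ind by (rule ii)
      qed measurable
      then show ?thesis
        unfolding ind q'(3) by (simp add: N_def Lp_norm_def a_def abs_mult cap)
    qed
    have "ennreal (a (k + \<delta>)) = emeasure MU {x \<in> U. u x > k + \<delta>}"
      by (simp add: a_def emeasure_eq_measure)
    also have "\<dots> \<le> ennreal (C * (2 * exp 2 / lam * ?I / \<delta>) powr \<kappa>)"
      by (rule superlevel_measure_le[OF S C \<kappa> sol fi k \<delta>])
    finally have "a (k + \<delta>) \<le> C * (2 * exp 2 / lam * ?I / \<delta>) powr \<kappa>"
      using C by (simp add: ennreal_le_iff)
    also have "\<dots> \<le> C * (Q * a k powr (1 - 1 / q) / \<delta>) powr \<kappa>"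
    proof -
      have "2 * exp 2 / lam * ?I \<le> 2 * exp 2 / lam * (N * a k powr (1 - 1 / q))"
        using Ile lam_pos by (intro mult_left_mono) auto
      then have "2 * exp 2 / lam * ?I / \<delta> \<le> Q * a k powr (1 - 1 / q) / \<delta>"
        using \<delta> by (intro divide_right_mono) (auto simp: Q_def mult.assoc)
      moreover have "0 \<le> 2 * exp 2 / lam * ?I / \<delta>" using I0 lam_pos \<delta> by simp
      ultimately show ?thesis using C \<kappa> by (intro mult_left_mono powr_mono2) auto
    qed
    also have "\<dots> = C * Q powr \<kappa> * \<delta> powr (- \<kappa>) * a k powr \<beta>'"
    proof -
      have "(Q * a k powr (1 - 1 / q) / \<delta>) powr \<kappa> = Q powr \<kappa> * (a k powr (1 - 1 / q)) powr \<kappa> / \<delta> powr \<kappa>"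
        using Q0 \<delta> by (simp add: powr_divide powr_mult)
      also have "(a k powr (1 - 1 / q)) powr \<kappa> = a k powr \<beta>'"
        by (simp only: powr_powr \<beta>'_def mult.commute)
      finally show ?thesis by (simp add: powr_minus divide_inverse mult_ac)
    qed
    finally show "a (k + \<delta>) \<le> C * Q powr \<kappa> * \<delta> powr (- \<kappa>) * a k powr \<beta>'" .
  qed
  then have "emeasure MU {x \<in> U. u x > s} = 0" if "s > Q * R" for s
    using that by (simp add: a_def emeasure_eq_measure)
  from AE_le_of_superlevel[OF um this] have "AE x in MU. u x \<le> Q * R" by simp
  then show ?thesis by (simp add: Q_def R_def N_def V_def \<beta>'_def mult_ac)
qed

end

end

section \<open>Choice of the exponents and of the uniform constants\<close>

theorem mainTheorem9:
  assumes dim: "CARD('n::finite) \<ge> 3"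
  shows
   "(\<forall>(U::(real^'n) set) lam M A B c v G.
       coeff_assms U lam M A B c \<and> weak_sol U A B c (\<lambda>_. 0) v G
       \<longrightarrow> (AE x in lebesgue_on U. v x = 0))
  \<and> (\<forall>lam>0. \<exists>C1>0. \<forall>p. real CARD('n) < p \<longrightarrow> (\<forall>V. \<exists>C2>0.
       \<forall>(U::(real^'n) set) M A B c f.
         coeff_assms U lam M A B c \<and> measure lebesgue U = V \<and>
         Lp U (p * real CARD('n) / (real CARD('n) + p)) f
         \<longrightarrow> (\<exists>u G. weak_sol U A B c f u G \<and>
               (\<forall>u' G'. weak_sol U A B c f u' G' \<longrightarrow> (AE x in lebesgue_on U. u' x = u x)) \<and>
               Linf U u \<and>
               L2vec_norm U G \<le> C1 * Lp_norm U (2 * real CARD('n) / (real CARD('n) + 2)) f \<and>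
               Linf_norm U u \<le> C2 * Lp_norm U (p * real CARD('n) / (real CARD('n) + p)) f)))"
proof -
  define d where "d = real CARD('n)"
  have d: "d \<ge> 3" using dim by (simp add: d_def)
  define \<kappa> where "\<kappa> = d / (d - 2)"
  have \<kappa>: "\<kappa> > 1" using d by (simp add: \<kappa>_def)
  obtain Cw where Cw: "Cw > 0" and weak: "\<And>(U :: (real^'n) set) \<phi> t. open U \<Longrightarrow> bounded U \<Longrightarrow> test_fun U \<phi> \<Longrightarrow> t > 0 \<Longrightarrow>
     emeasure (lebesgue_on U) {x \<in> U. \<bar>\<phi> x\<bar> \<ge> t} \<le> ennreal (Cw * (energy U \<phi> / t\<^sup>2) powr \<kappa>)"
    using weak_Sobolev_test_fun[OF dim, folded d_def, folded \<kappa>_def] by blast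
  obtain Cs where Cs: "Cs > 0" and strong: "\<And>(U :: (real^'n) set) \<phi>. open U \<Longrightarrow> bounded U \<Longrightarrow> test_fun U \<phi> \<Longrightarrow>
     integrable (lebesgue_on U) (\<lambda>x. \<bar>\<phi> x\<bar> powr (2 * d / (d - 2))) \<and>
     (\<integral>x. \<bar>\<phi> x\<bar> powr (2 * d / (d - 2)) \<partial>lebesgue_on U) \<le> Cs * energy U \<phi> powr \<kappa>"
    using Sobolev_test_fun[OF dim, folded d_def, folded \<kappa>_def] by blast
  have part1: "AE x in lebesgue_on U. v x = 0"
    if "coeff_assms U lam M A B c" "weak_sol U A B c (\<lambda>_. 0) v G" for U :: "(real^'n) set" and lam M A B c v G
  proof -
    interpret elliptic U lam M A B c by standard (rule that(1))
    show ?thesis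
      by (rule weak_sol_zero_unique[OF weak[OF open_U bounded_U] Cw _ that(2)]) (use \<kappa> in auto)
  qed
  have part2: "\<exists>C1>0. \<forall>p. d < p \<longrightarrow> (\<forall>V. \<exists>C2>0. \<forall>(U::(real^'n) set) M A B c f.
         coeff_assms U lam M A B c \<and> measure lebesgue U = V \<and> Lp U (p * d / (d + p)) f
         \<longrightarrow> (\<exists>u G. weak_sol U A B c f u G \<and>
               (\<forall>u' G'. weak_sol U A B c f u' G' \<longrightarrow> (AE x in lebesgue_on U. u' x = u x)) \<and>
               Linf U u \<and>
               L2vec_norm U G \<le> C1 * Lp_norm U (2 * d / (d + 2)) f \<and>
               Linf_norm U u \<le> C2 * Lp_norm U (p * d / (d + p)) f))"
    if lam: "lam > 0" for lam :: real
  proof -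
    define m where "m = min lam 1"
    have m: "m > 0" using lam by (simp add: m_def)
    \<comment> \<open>The square root of the bound in \<open>existence\<close> for
      \<open>Cf = N\<^sup>2 * Cs powr (1 / \<kappa>)\<close>, with the norm \<open>N\<close> of the
      data factored out.\<close>
    define C1 where "C1 = 2 * Cs powr (1 / (2 * \<kappa>)) / m"
    have C1: "C1 > 0" using Cs m by (simp add: C1_def)
    define r where "r = 2 * d / (d + 2)"
    have r: "r > 1" using d by (simp add: r_def)
    show ?thesis
    proof (rule exI[of _ C1], rule conjI[OF C1], intro allI impI)
      fix p V :: real assume p: "d < p"
      define q where "q = p * d / (d + p)"
      have iq: "1 / q = 1 / p + 1 / d" using d p by (simp add: q_def field_simps)
      have ip: "1 / p < 1 / d" using d p by (simp add: field_simps)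
      have q2: "q > d / 2"
      proof -
        have "1 / q < 2 / d" using iq ip by simp
        moreover have "q > 0" using d p by (simp add: q_def)
        ultimately show ?thesis using d by (simp add: field_simps)
      qed
      have q: "q > 1" using q2 d by simp
      have rq: "r \<le> q"
      proof -
        have "r \<le> d / 2" using d by (simp add: r_def field_simps)
        then show ?thesis using q2 by simp
      qed
      \<comment> \<open>From \<open>p > d\<close> one gets \<open>1 / q < 2 / d\<close>, so
        \<open>1 - 1 / q\<close> exceeds \<open>1 - 2 / d\<close>, the reciprocal of
        \<open>\<kappa>\<close>.\<close>
      have \<beta>: "\<kappa> * (1 - 1 / q) > 1"
      proof -
        have "1 - 1 / q > (d - 2) / d" using iq ip d by (simp add: diff_divide_distrib)
        then have "\<kappa> * (1 - 1 / q) > \<kappa> * ((d - 2) / d)" using \<kappa> by (intro mult_strict_left_mono) auto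
        also have "\<kappa> * ((d - 2) / d) = 1" using d by (simp add: \<kappa>_def)
        finally show ?thesis .
      qed
      \<comment> \<open>\<open>V\<close> ranges over all reals; the absolute value keeps
        \<open>C2\<close> positive also for those that are not the measure of any set.\<close>
      define C2 where "C2 = 2 * exp 2 / lam * (Cw * (\<bar>V\<bar> + 1) powr (\<kappa> * (1 - 1 / q) - 1)
         * 2 powr (\<kappa> + \<kappa> / (\<kappa> * (1 - 1 / q) - 1))) powr (1 / \<kappa>)"
      have C2: "C2 > 0" using lam Cw by (simp add: C2_def add_nonneg_pos less_imp_neq)
      have main: "\<exists>u G. weak_sol U A B c f u G \<and>
               (\<forall>u' G'. weak_sol U A B c f u' G' \<longrightarrow> (AE x in lebesgue_on U. u' x = u x)) \<and>
               Linf U u \<and> L2vec_norm U G \<le> C1 * Lp_norm U r f \<and> Linf_norm U u \<le> C2 * Lp_norm U q f"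
        if coeff: "coeff_assms U lam M A B c" and V: "measure lebesgue U = V" and f: "Lp U q f"
        for U :: "(real^'n) set" and M A B c f
      proof -
        interpret elliptic U lam M A B c by standard (rule coeff)
        have fi: "integrable MU f" using Lp_integrable[OF open_U bounded_U f] q by simp
        have fr: "Lp U r f" using r rq by (intro Lp_mono[OF open_U bounded_U f]) auto
        note W = weak[OF open_U bounded_U] Cw
        have \<kappa>0: "\<kappa> > 0" using \<kappa> by simp
        define N where "N = Lp_norm U r f"
        have N: "N \<ge> 0" by (simp add: N_def Lp_norm_def)
        \<comment> \<open>The exponent \<open>r = 2d/(d+2)\<close> is conjugate to the Sobolev
          exponent \<open>2d/(d-2) = 2 \<kappa>\<close>.\<close>
        have dual: "(\<integral>x. f x * \<phi> x \<partial>MU)\<^sup>2 \<le> (N\<^sup>2 * Cs powr (1 / \<kappa>)) * energy U \<phi>" if \<phi>: "test_fun U \<phi>" for \<phi>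
        proof -
          have r': "2 * d / (d - 2) > 1" "1 / r + 1 / (2 * d / (d - 2)) = 1" "1 / (2 * d / (d - 2)) = 1 / (2 * \<kappa>)"
            using d by (auto simp: r_def \<kappa>_def field_simps)
          have "\<bar>\<integral>x. f x * \<phi> x \<partial>MU\<bar> \<le> (\<integral>x. \<bar>f x * \<phi> x\<bar> \<partial>MU)" by (rule integral_abs_bound)
          also have "\<dots> \<le> (\<integral>x. \<bar>f x\<bar> powr r \<partial>MU) powr (1 / r)
              * (\<integral>x. \<bar>\<phi> x\<bar> powr (2 * d / (d - 2)) \<partial>MU) powr (1 / (2 * d / (d - 2)))"
            using fr test_fun_measurable[OF \<phi>] strong[OF open_U bounded_U \<phi>]
            by (intro Hoelder_integral(2)[OF r r'(1,2)]) (auto simp: Lp_def)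
          also have "\<dots> = N * (\<integral>x. \<bar>\<phi> x\<bar> powr (2 * d / (d - 2)) \<partial>MU) powr (1 / (2 * \<kappa>))"
            unfolding r'(3) by (simp add: N_def Lp_norm_def)
          also have "\<dots> \<le> N * (Cs * energy U \<phi> powr \<kappa>) powr (1 / (2 * \<kappa>))"
            using strong[OF open_U bounded_U \<phi>] N \<kappa> by (intro mult_left_mono powr_mono2) auto
          finally have "\<bar>\<integral>x. f x * \<phi> x \<partial>MU\<bar>\<^sup>2 \<le> (N * (Cs * energy U \<phi> powr \<kappa>) powr (1 / (2 * \<kappa>)))\<^sup>2"
            by (intro power_mono) auto
          also have "\<dots> = N\<^sup>2 * ((Cs * energy U \<phi> powr \<kappa>) powr (1 / (2 * \<kappa>)))\<^sup>2"
            by (simp add: power_mult_distrib)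
          also have "((Cs * energy U \<phi> powr \<kappa>) powr (1 / (2 * \<kappa>)))\<^sup>2 = (Cs * energy U \<phi> powr \<kappa>) powr (1 / \<kappa>)"
          proof -
            have "(y powr (1 / (2 * \<kappa>)))\<^sup>2 = y powr (1 / \<kappa>)" for y
              using \<kappa> by (simp add: power2_eq_square powr_add[symmetric] field_simps)
            then show ?thesis .
          qed
          also have "\<dots> = Cs powr (1 / \<kappa>) * energy U \<phi>"
            using \<kappa> energy_nonneg[of U \<phi>] by (simp add: powr_mult powr_powr)
          finally show ?thesis by (simp add: mult.assoc)
        qed
        have "N\<^sup>2 * Cs powr (1 / \<kappa>) \<ge> 0" by simp
        from existence[OF test_mult_integrable[OF fi] dual this]
        obtain u G where sol: "weak_sol U A B c f u G"
          and G: "(\<integral>x. (norm (G x))\<^sup>2 \<partial>MU) \<le> 4 * (N\<^sup>2 * Cs powr (1 / \<kappa>)) / (min lam 1)\<^sup>2" by blast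
        have G': "L2vec_norm U G \<le> C1 * N"
        proof -
          have "4 * (N\<^sup>2 * Cs powr (1 / \<kappa>)) / (min lam 1)\<^sup>2 = (C1 * N)\<^sup>2"
          proof -
            have "Cs powr (1 / \<kappa>) = (Cs powr (1 / (2 * \<kappa>)))\<^sup>2"
              using \<kappa> by (simp add: power2_eq_square powr_add[symmetric] field_simps)
            then show ?thesis by (simp add: C1_def m_def[symmetric] power_mult_distrib power_divide)
          qed
          then have "sqrt (\<integral>x. (norm (G x))\<^sup>2 \<partial>MU) \<le> sqrt ((C1 * N)\<^sup>2)" using G by (intro real_sqrt_le_mono) simp
          then show ?thesis using C1 N by (simp add: L2vec_norm_def)
        qed
        define T where "T = C2 * Lp_norm U q f"
        have T0: "T \<ge> 0" using C2 by (simp add: T_def Lp_norm_def)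
        have Vabs: "\<bar>V\<bar> = measure lebesgue U" using V by (metis abs_of_nonneg measure_nonneg)
        have up: "AE x in MU. u x \<le> T"
          using weak_sol_le[OF W \<kappa>0 sol f q \<beta>] by (simp only: T_def C2_def Vabs)
        \<comment> \<open>The lower bound on \<open>u\<close> is the upper bound for the negated
          problem, whose data have the same norm.\<close>
        have "weak_sol U A B c (\<lambda>x. - f x) (\<lambda>x. - u x) (\<lambda>x. - G x)"
          using weak_sol_lincomb[OF sol sol fi fi, of "-1" 0] by simp
        moreover have "Lp U q (\<lambda>x. - f x)" using f by (simp add: Lp_def)
        ultimately have "AE x in MU. - u x \<le> C2 * Lp_norm U q (\<lambda>x. - f x)"
          using weak_sol_le[OF W \<kappa>0 _ _ q \<beta>] by (simp only: C2_def Vabs)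
        then have lo: "AE x in MU. - u x \<le> T" by (simp add: T_def Lp_norm_def)
        have abs: "AE x in MU. \<bar>u x\<bar> \<le> T" using up lo by eventually_elim simp
        have "Linf_norm U u \<le> T"
          unfolding Linf_norm_def using abs T0 by (intro cInf_lower bdd_belowI[of _ 0]) auto
        moreover have "Linf U u"
          using abs sol H012_L2(1) by (auto simp: Linf_def weak_sol_def L2_def)
        moreover have "\<forall>u' G'. weak_sol U A B c f u' G' \<longrightarrow> (AE x in MU. u' x = u x)"
          using weak_sol_unique[OF W \<kappa>0 sol _ fi] by blast
        ultimately show ?thesis using sol G' unfolding T_def N_def by blast
      qed
      show "\<exists>C2>0. \<forall>(U::(real^'n) set) M A B c f.
         coeff_assms U lam M A B c \<and> measure lebesgue U = V \<and> Lp U (p * d / (d + p)) f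
         \<longrightarrow> (\<exists>u G. weak_sol U A B c f u G \<and>
               (\<forall>u' G'. weak_sol U A B c f u' G' \<longrightarrow> (AE x in lebesgue_on U. u' x = u x)) \<and>
               Linf U u \<and>
               L2vec_norm U G \<le> C1 * Lp_norm U (2 * d / (d + 2)) f \<and>
               Linf_norm U u \<le> C2 * Lp_norm U (p * d / (d + p)) f)"
        by (rule exI[of _ C2], rule conjI[OF C2], intro allI impI)
          (rule main[unfolded r_def q_def], auto)
    qed
  qed
  show ?thesis using part1 part2 unfolding d_def by blast
qed

end
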